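(* Fix $x\in\mathbb{R}$. Suppose: (i) (shape space) $f$ takes values in $\Omega_{\mathcal F}$, where $\Omega_{\mathcal F}$ is the bi-Lipschitz shape space with constants $0<M<L<\infty$ described in the context; (ii) there exists $\kappa>0$ such that $\tau\ge\kappa$ almost surely; (iii) the marginal density $f_X$ of $X$ and the conditional densities $g_y$ of $X$ given $f=y$ exist and are twice continuously differentiable, the latter for all $y\in\Omega_{\mathcal F}$, with $\sup_{x',y}|g_y''(x')|<\infty$; additionally, for every open $U\subset\Omega_{\mathcal F}$, the map $x'\mapsto P(f\in U\mid X=x')$ is continuous; (iv) $f_X(\cdot)>0$; (v) $\alpha_n/\log n\to\infty$ as $n\to\infty$; (vi) $h=h_n\sim c_0n^{-1/5}$ for some constant $c_0>0$. Then $$d_{\mathcal F}\big(f_\oplus(x),\tilde f_\oplus(x)\big)=O_p\big(n^{-2/5}+\alpha_n^{-1/4}\big)\quad\text{as } n\to\infty.$$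
   Context: Shape space. Fix $T>0$ and constants $0<M<L<\infty$. The quantile function of a probability measure on $[0,T]$ with cdf $F$ is $t\mapsto\inf\{u\in[0,T]:F(u)\ge t\}$. Let $Q(\Omega_{\mathcal F})$ be the set of functions $q:[0,1]\to[0,T]$ with $q(0)=0$, $q(1)=T$ and $M|s-t|\le|q(s)-q(t)|\le L|s-t|$ for all $s,t\in[0,1]$ (assumed nonempty), and let $\Omega_{\mathcal F}$ be the set of probability densities on $[0,T]$ whose quantile functions lie in $Q(\Omega_{\mathcal F})$. For $f_1,f_2\in\Omega_{\mathcal F}$ with quantile functions $Q_1,Q_2$, $d_{\mathcal F}(f_1,f_2)=\|Q_1-Q_2\|_{L^2([0,1])}$ (the 2-Wasserstein distance). Sampling model. $(X,\Lambda)$ is a random pair, where $X$ is a real covariate and $\Lambda:[0,T]\to\mathbb{R}^+$ is a random integrable intensity function; $\tau=\int_0^T\Lambda(t)\,dt$, and $f=\Lambda/\tau$ is a random density with quantile function $Q$. $(X_i,\Lambda_i)$, $i=1,\dots,n$, are i.i.d. copies, with corresponding $\tau_i,f_i,Q_i$. $(\alpha_n)$ is a sequence of positive numbers. For each $n$, conditionally on $(X_i,\Lambda_i)_{i\le n}$, the point processes $N_1^{(n)},\dots,N_n^{(n)}$ on $[0,T]$ are independent and $N_i^{(n)}$ is a Poisson process with intensity function $\alpha_n\Lambda_i$ (its conditional law depends only on $\Lambda_i$). So given $\Lambda_i$ the total count $N_i^{(n)}(T)$ is Poisson with mean $\alpha_n\tau_i$, and given the count the unordered arrival times $Z_{i1},\dots,Z_{iN_i^{(n)}(T)}$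 are i.i.d. with density $f_i$. Target. $f_\oplus(x)=\arg\min_{f_0\in\Omega_{\mathcal F}}E(d_{\mathcal F}^2(f,f_0)\mid X=x)$. Estimator. $K$ is a continuous symmetric probability density with support $[-1,1]$, $h=h_n>0$ is a bandwidth, $K_h(u)=h^{-1}K(u/h)$, $\hat u_j=n^{-1}\sum_{i=1}^nK_h(X_i-x)(X_i-x)^j$ for $j=0,1,2$, $\hat\sigma_0^2=\hat u_0\hat u_2-\hat u_1^2$, and $s_{in}(x,h)=\hat\sigma_0^{-2}K_h(X_i-x)[\hat u_2-\hat u_1(X_i-x)]$ (on the event $\hat\sigma_0^2=0$, of vanishing probability, the weights may be defined arbitrarily). Let $\hat\mu_i$ be the empirical measure of the arrival times of $N_i^{(n)}$ if $N_i^{(n)}(T)\ge1$ and the uniform distribution on $[0,T]$ if $N_i^{(n)}(T)=0$; $\hat Q_i$ is the quantile function of $\hat\mu_i$. Then $\tilde Q_\oplus(\cdot,x)=\arg\min_{q\in Q(\Omega_{\mathcal F})}\|q-n^{-1}\sum_{i=1}^ns_{in}(x,h)\hat Q_i\|_{L^2([0,1])}^2$, and $\tilde f_\oplus(x)$ is the density with quantile function $\tilde Q_\oplus(\cdot,x)$. *)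

theory Defs
  imports "HOL-Probability.Probability" "HOL-Library.Landau_Symbols"
begin

text \<open>
  Functions on \<open>[0,T]\<close> (densities, intensities) are total functions of which only the values on
  \<open>[0,T]\<close> matter.  Functions on \<open>[0,1]\<close> (quantile functions) are extensional, that is, \<open>undefined\<close>
  outside of \<open>[0,1]\<close>, so that equality of quantile functions is equality on \<open>[0,1]\<close>.
\<close>

definition quantile_fun :: "real \<Rightarrow> real measure \<Rightarrow> real \<Rightarrow> real" where
  "quantile_fun T \<mu> = (\<lambda>t\<in>{0..1}. Inf {u \<in> {0..T}. t \<le> cdf \<mu> u})"

definition L2_dist :: "(real \<Rightarrow> real) \<Rightarrow> (real \<Rightarrow> real) \<Rightarrow> real" where
  "L2_dist p q = sqrt (LINT t:{0..1}|lborel. (p t - q t)\<^sup>2)"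

definition shape_quantiles :: "real \<Rightarrow> real \<Rightarrow> real \<Rightarrow> (real \<Rightarrow> real) set" where
  "shape_quantiles T M L =
     {q \<in> {0..1} \<rightarrow>\<^sub>E {0..T}. q 0 = 0 \<and> q 1 = T \<and>
        (\<forall>s\<in>{0..1}. \<forall>t\<in>{0..1}.
           M * \<bar>s - t\<bar> \<le> \<bar>q s - q t\<bar> \<and> \<bar>q s - q t\<bar> \<le> L * \<bar>s - t\<bar>)}"

definition prob_density_on :: "real \<Rightarrow> (real \<Rightarrow> real) \<Rightarrow> bool" where
  "prob_density_on T f \<longleftrightarrow>
     (\<forall>t\<in>{0..T}. 0 \<le> f t) \<and> set_integrable lborel {0..T} f \<and> (LINT t:{0..T}|lborel. f t) = 1"

definition density_quantile :: "real \<Rightarrow> (real \<Rightarrow> real) \<Rightarrow> real \<Rightarrow> real" where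
  "density_quantile T f =
     quantile_fun T (density lborel (\<lambda>t. ennreal (indicator {0..T} t * f t)))"

definition shape_densities :: "real \<Rightarrow> real \<Rightarrow> real \<Rightarrow> (real \<Rightarrow> real) set" where
  "shape_densities T M L =
     {f. prob_density_on T f \<and> density_quantile T f \<in> shape_quantiles T M L}"

definition shape_dist :: "real \<Rightarrow> (real \<Rightarrow> real) \<Rightarrow> (real \<Rightarrow> real) \<Rightarrow> real" where
  "shape_dist T f1 f2 = L2_dist (density_quantile T f1) (density_quantile T f2)"

text \<open>
  On functions, \<^term>\<open>shape_dist T\<close> is a pseudometric: densities that agree almost everywhere on
  \<open>[0,T]\<close> have distance 0.  All sets that are open or Borel in the following sense are unions of
  classes of almost everywhere equal densities.
\<close>

definition shape_open :: "real \<Rightarrow> real \<Rightarrow> real \<Rightarrow> (real \<Rightarrow> real) set \<Rightarrow> bool" where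
  "shape_open T M L U \<longleftrightarrow> U \<subseteq> shape_densities T M L \<and>
     (\<forall>f\<in>U. \<exists>e>0. \<forall>g\<in>shape_densities T M L. shape_dist T f g < e \<longrightarrow> g \<in> U)"

definition shape_borel :: "real \<Rightarrow> real \<Rightarrow> real \<Rightarrow> (real \<Rightarrow> real) measure" where
  "shape_borel T M L = sigma (shape_densities T M L) {U. shape_open T M L U}"

text \<open>
  The sigma-algebra generated by the maps \<open>\<lambda> \<mapsto> \<integral>\<^sub>A \<lambda>\<close>, for Borel sets \<open>A \<subseteq> [0,T]\<close>.  This is the
  (pullback of the) Borel sigma-algebra of the separable Banach space \<open>L\<^sup>1([0,T])\<close>.
\<close>

definition intensity_space :: "real \<Rightarrow> (real \<Rightarrow> real) measure" where
  "intensity_space T =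
     (SUP A \<in> sets borel.
        vimage_algebra {l. (\<forall>t\<in>{0..T}. 0 \<le> l t) \<and> set_integrable lborel {0..T} l}
          (\<lambda>l. LINT t:A \<inter> {0..T}|lborel. l t) borel)"

definition total_intensity :: "real \<Rightarrow> (real \<Rightarrow> real) \<Rightarrow> real" where
  "total_intensity T l = (LINT t:{0..T}|lborel. l t)"

definition intensity_shape :: "real \<Rightarrow> (real \<Rightarrow> real) \<Rightarrow> real \<Rightarrow> real" where
  "intensity_shape T l = (\<lambda>t. l t / total_intensity T l)"

text \<open>
  \<open>\<nu>\<close> is a regular conditional distribution of the random variable \<open>Y\<close> (with values in \<open>N\<close>) given
  the random variable \<open>X\<close> (with values in \<open>S\<close>).
\<close>

definition regular_cond_distr ::
  "'w measure \<Rightarrow> 's measure \<Rightarrow> ('w \<Rightarrow> 's) \<Rightarrow> 'y measure \<Rightarrow> ('w \<Rightarrow> 'y) \<Rightarrow> ('s \<Rightarrow> 'y measure) \<Rightarrow> bool"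
  where
  "regular_cond_distr P S X N Y \<nu> \<longleftrightarrow>
     X \<in> P \<rightarrow>\<^sub>M S \<and> Y \<in> P \<rightarrow>\<^sub>M N \<and> \<nu> \<in> S \<rightarrow>\<^sub>M prob_algebra N \<and>
     (\<forall>A\<in>sets S. \<forall>B\<in>sets N.
        measure P {w \<in> space P. X w \<in> A \<and> Y w \<in> B} =
        (LINT w|P. indicator A (X w) * measure (\<nu> (X w)) B))"

definition twice_continuously_differentiable :: "(real \<Rightarrow> real) \<Rightarrow> bool" where
  "twice_continuously_differentiable f \<longleftrightarrow>
     (\<forall>u. f differentiable (at u)) \<and> (\<forall>u. deriv f differentiable (at u)) \<and>
     continuous_on UNIV (deriv (deriv f))"

text \<open>
  A realisation of a finite point process is the multiset of its points.
\<close>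

definition points_in :: "real multiset \<Rightarrow> real set \<Rightarrow> nat" where
  "points_in N A = size (filter_mset (\<lambda>t. t \<in> A) N)"

text \<open>
  Unlike \<^const>\<open>poisson_pmf\<close>, this includes the rate 0 (point mass at 0).
\<close>

definition poisson_prob :: "real \<Rightarrow> nat \<Rightarrow> real" where
  "poisson_prob r m = r ^ m / fact m * exp (- r)"

text \<open>
  Conditionally on the random intensities and covariates \<open>Z i = (X i, \<Lambda> i)\<close>, \<open>i < n\<close>, the point
  processes \<open>N i\<close>, \<open>i < n\<close>, on \<open>[0,T]\<close> are independent Poisson processes with intensity functions
  \<open>a * \<Lambda> i\<close>: given the sigma-algebra generated by the \<open>Z i\<close>, the numbers of points of \<open>N i\<close> in
  disjoint Borel sets \<open>A i 0, \<dots>, A i (k-1)\<close> are, jointly over all \<open>i < n\<close>, independent and Poisson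
  distributed with means \<open>a * \<integral>\<^bsub>A i j\<^esub> \<Lambda> i\<close>.
\<close>

definition data_algebra ::
  "'w measure \<Rightarrow> real \<Rightarrow> nat \<Rightarrow> (nat \<Rightarrow> 'w \<Rightarrow> real \<times> (real \<Rightarrow> real)) \<Rightarrow> 'w measure" where
  "data_algebra P T n Z =
     vimage_algebra (space P) (\<lambda>w. \<lambda>i\<in>{..<n}. Z i w)
       (PiM {..<n} (\<lambda>_. borel \<Otimes>\<^sub>M intensity_space T))"

definition cond_poisson_processes ::
  "'w measure \<Rightarrow> real \<Rightarrow> real \<Rightarrow> nat \<Rightarrow> (nat \<Rightarrow> 'w \<Rightarrow> real \<times> (real \<Rightarrow> real)) \<Rightarrow>
   (nat \<Rightarrow> 'w \<Rightarrow> real multiset) \<Rightarrow> bool" where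
  "cond_poisson_processes P T a n Z N \<longleftrightarrow>
     (\<forall>i<n. (\<forall>w\<in>space P. set_mset (N i w) \<subseteq> {0..T}) \<and>
            (\<forall>A\<in>sets borel. (\<lambda>w. points_in (N i w) A) \<in> P \<rightarrow>\<^sub>M count_space UNIV)) \<and>
     (\<forall>(k::nat) A m.
        (\<forall>i<n. disjoint_family_on (A i) {..<k} \<and>
               (\<forall>j<k. A i j \<in> sets borel \<and> A i j \<subseteq> {0..T})) \<longrightarrow>
        (AE w in P.
           real_cond_exp P (data_algebra P T n Z)
             (indicator {w \<in> space P. \<forall>i<n. \<forall>j<k. points_in (N i w) (A i j) = m i j}) w =
           (\<Prod>i<n. \<Prod>j<k.
              poisson_prob (a * (LINT t:A i j|lborel. snd (Z i w) t)) (m i j))))"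

text \<open>
  \<open>\<nu>\<close> is the conditional distribution of the random density given that the covariate is \<open>x\<close>.
\<close>

definition frechet_mean ::
  "real \<Rightarrow> real \<Rightarrow> real \<Rightarrow> (real \<Rightarrow> real) measure \<Rightarrow> (real \<Rightarrow> real)" where
  "frechet_mean T M L \<nu> =
     arg_min_on (\<lambda>f0. LINT f|\<nu>. (shape_dist T f f0)\<^sup>2) (shape_densities T M L)"

definition kernel_scaled :: "(real \<Rightarrow> real) \<Rightarrow> real \<Rightarrow> real \<Rightarrow> real" where
  "kernel_scaled K h u = K (u / h) / h"

definition kernel_moment ::
  "(real \<Rightarrow> real) \<Rightarrow> real \<Rightarrow> real \<Rightarrow> nat \<Rightarrow> (nat \<Rightarrow> real) \<Rightarrow> nat \<Rightarrow> real" where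
  "kernel_moment K h x n X j = (\<Sum>i<n. kernel_scaled K h (X i - x) * (X i - x) ^ j) / real n"

definition kernel_sigma2 ::
  "(real \<Rightarrow> real) \<Rightarrow> real \<Rightarrow> real \<Rightarrow> nat \<Rightarrow> (nat \<Rightarrow> real) \<Rightarrow> real" where
  "kernel_sigma2 K h x n X =
     kernel_moment K h x n X 0 * kernel_moment K h x n X 2 - (kernel_moment K h x n X 1)\<^sup>2"

text \<open>
  When \<^const>\<open>kernel_sigma2\<close> is 0, all weights are 0.
\<close>

definition local_weight ::
  "(real \<Rightarrow> real) \<Rightarrow> real \<Rightarrow> real \<Rightarrow> nat \<Rightarrow> (nat \<Rightarrow> real) \<Rightarrow> nat \<Rightarrow> real" where
  "local_weight K h x n X i =
     kernel_scaled K h (X i - x) *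
     (kernel_moment K h x n X 2 - kernel_moment K h x n X 1 * (X i - x)) /
     kernel_sigma2 K h x n X"

definition empirical_quantile :: "real \<Rightarrow> real multiset \<Rightarrow> real \<Rightarrow> real" where
  "empirical_quantile T N =
     quantile_fun T
       (if N = {#} then uniform_measure lborel {0..T} else measure_pmf (pmf_of_multiset N))"

definition quantile_estimator ::
  "real \<Rightarrow> real \<Rightarrow> real \<Rightarrow> (real \<Rightarrow> real) \<Rightarrow> real \<Rightarrow> real \<Rightarrow> nat \<Rightarrow>
   (nat \<Rightarrow> real) \<Rightarrow> (nat \<Rightarrow> real multiset) \<Rightarrow> (real \<Rightarrow> real)" where
  "quantile_estimator T M L K h x n X N =
     arg_min_on
       (\<lambda>q. (L2_dist q
          (\<lambda>t. (\<Sum>i<n. local_weight K h x n X i * empirical_quantile T (N i) t) / real n))\<^sup>2)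
       (shape_quantiles T M L)"

definition density_estimator ::
  "real \<Rightarrow> real \<Rightarrow> real \<Rightarrow> (real \<Rightarrow> real) \<Rightarrow> real \<Rightarrow> real \<Rightarrow> nat \<Rightarrow>
   (nat \<Rightarrow> real) \<Rightarrow> (nat \<Rightarrow> real multiset) \<Rightarrow> (real \<Rightarrow> real)" where
  "density_estimator T M L K h x n X N =
     (SOME f. prob_density_on T f \<and> density_quantile T f = quantile_estimator T M L K h x n X N)"

text \<open>
  \<open>Z\<^sub>n = O\<^sub>p(r\<^sub>n)\<close>.  For measurable \<open>Z\<^sub>n\<close> the event \<open>E\<close> may be taken to be \<open>{\<bar>Z\<^sub>n\<bar> \<le> C * r\<^sub>n}\<close>; asking for
  a measurable \<open>E\<close> avoids applying \<^const>\<open>measure\<close> to sets that are not known to be measurable.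
\<close>

definition bigo_in_prob ::
  "'w measure \<Rightarrow> (nat \<Rightarrow> 'w \<Rightarrow> real) \<Rightarrow> (nat \<Rightarrow> real) \<Rightarrow> bool" where
  "bigo_in_prob P Z r \<longleftrightarrow>
     (\<forall>\<epsilon>>0. \<exists>C>0. \<forall>\<^sub>F n in sequentially.
        \<exists>E\<in>sets P. measure P E \<ge> 1 - \<epsilon> \<and> (\<forall>w\<in>E. \<bar>Z n w\<bar> \<le> C * r n))"

end

theory Submission
  imports Defs
begin

text \<open>
  The local linear weights have mean 1, so the error of the weighted mean of the empirical quantile
  functions splits into the weighted mean of the differences \<open>Q\<^sub>i - q\<close>, where \<open>q\<close> is the mean quantile
  function given \<open>X = x\<close>, and the weighted mean of the empirical errors.

  As the kernel is symmetric, \<open>u\<^sub>1 = O\<^sub>p(h\<^sup>2)\<close>, so subtracting the constant \<open>q(t)\<close> instead of a linear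
  function of the covariate already suffices for the first part.  With \<open>A\<^sub>j\<close> the unweighted mean of
  \<open>K\<^sub>h(X\<^sub>i - x) (X\<^sub>i - x)\<^sup>j (Q\<^sub>i - q)\<close>, this part is \<open>(u\<^sub>2 A\<^sub>0 - u\<^sub>1 A\<^sub>1) / \<sigma>\<^sup>2\<close>.  The expectation of
  \<open>A\<^sub>j\<close> is an integral of the conditional densities of the covariate against the kernel; second order
  Taylor expansion inside that integral and Bayes' formula at the point \<open>x\<close> give a bias of order
  \<open>h\<^sup>2\<close>, and the variance is of order \<open>h\<^sup>2\<^sup>j / (n h)\<close>.

  For the second part, shapes have \<open>L\<close>-Lipschitz quantile functions and \<open>1 / M\<close>-Lipschitz distribution
  functions, so the error of an empirical quantile function is at most \<open>L\<close> times the error of the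
  empirical distribution function on a grid of about \<open>\<surd>\<alpha>\<close> points, up to the mesh.  The mean square error
  of a Poisson count equals its mean, and summing over the grid gives a squared error of order
  \<open>1 / \<surd>\<alpha>\<close>.

  Finally, the estimator is a projection onto the shape space, which at most doubles the distance to \<open>q\<close>.
\<close>

text \<open>The claim concerns one point x, while conditional laws are fixed only up to null sets of
  covariates. Continuity of \<open>measure (\<nu> u) U\<close> in u for open U singles out the
  version at x: it makes the mean quantile at every level t continuous in u, so that Bayes' formula
  can be read off at x itself. Smoothness is available for the densities \<open>g y\<close> of the
  covariate given the shape, not for the regression function, so the expansion is made after
  conditioning on the shape, with bounds uniform in y. The second obstacle is measurability. The
  estimator is an arg min followed by a choice, and its measurability is not established. Hence the
  random parts of the error are first bounded by measurable quantities: kernel moments, integrated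
  squares of the A_j, and squared count errors summed (not maximised) over the grid. Markov's
  inequality is applied to these, and on the resulting events the error bound is
  deterministic.\<close>

section \<open>Square integrals over the unit interval\<close>

abbreviation unit_lborel :: "real measure" where
  "unit_lborel \<equiv> restrict_space lborel {0..1}"

lemma prob_space_unit_lborel: "prob_space unit_lborel"
  by (auto intro!: prob_spaceI simp: space_restrict_space emeasure_restrict_space)

lemma L2_dist_eq: "L2_dist p q = sqrt (LINT t|unit_lborel. (p t - q t)\<^sup>2)"
  unfolding L2_dist_def set_lebesgue_integral_def by (subst integral_restrict_space) auto

lemma L2_dist_nonneg: "0 \<le> L2_dist p q"
  unfolding L2_dist_eq by simp

lemma L2_dist_sq: "(L2_dist p q)\<^sup>2 = (LINT t|unit_lborel. (p t - q t)\<^sup>2)"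
  unfolding L2_dist_eq by simp

lemma L2_dist_commute: "L2_dist p q = L2_dist q p"
  unfolding L2_dist_eq by (simp add: power2_commute)

text \<open>A class closed under the algebraic operations below in which integrability over [0,1] is
  automatic; it settles the side conditions of the square integrals.\<close>

definition bounded_fun :: "(real \<Rightarrow> real) \<Rightarrow> bool" where
  "bounded_fun p \<longleftrightarrow> p \<in> borel_measurable unit_lborel \<and> (\<exists>B. \<forall>t\<in>{0..1}. \<bar>p t\<bar> \<le> B)"

lemma bounded_funI:
  "p \<in> borel_measurable unit_lborel \<Longrightarrow> (\<And>t. t \<in> {0..1} \<Longrightarrow> \<bar>p t\<bar> \<le> B) \<Longrightarrow> bounded_fun p"
  unfolding bounded_fun_def by blast

lemma bounded_fun_measurable: "bounded_fun p \<Longrightarrow> p \<in> borel_measurable unit_lborel"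
  unfolding bounded_fun_def by simp

lemma bounded_fun_integrable: "bounded_fun p \<Longrightarrow> integrable unit_lborel p"
proof -
  interpret prob_space unit_lborel by (rule prob_space_unit_lborel)
  show "bounded_fun p \<Longrightarrow> integrable unit_lborel p"
    unfolding bounded_fun_def
    by (auto intro!: integrable_const_bound AE_I2 simp: space_restrict_space)
qed

lemma bounded_fun_const: "bounded_fun (\<lambda>_. c)"
  unfolding bounded_fun_def by auto

lemma bounded_fun_add: "bounded_fun p \<Longrightarrow> bounded_fun q \<Longrightarrow> bounded_fun (\<lambda>t. p t + q t)"
  unfolding bounded_fun_def
proof (elim conjE exE, intro conjI)
  fix B C assume "\<forall>t\<in>{0..1}. \<bar>p t\<bar> \<le> B" "\<forall>t\<in>{0..1}. \<bar>q t\<bar> \<le> C"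
  then have "\<forall>t\<in>{0..1}. \<bar>p t + q t\<bar> \<le> B + C" by (smt (verit))
  then show "\<exists>B. \<forall>t\<in>{0..1}. \<bar>p t + q t\<bar> \<le> B" ..
qed auto

lemma bounded_fun_mult: "bounded_fun p \<Longrightarrow> bounded_fun q \<Longrightarrow> bounded_fun (\<lambda>t. p t * q t)"
  unfolding bounded_fun_def
proof (elim conjE exE, intro conjI)
  fix B C assume *: "\<forall>t\<in>{0..1}. \<bar>p t\<bar> \<le> B" "\<forall>t\<in>{0..1}. \<bar>q t\<bar> \<le> C"
  have "\<bar>p t * q t\<bar> \<le> \<bar>B\<bar> * \<bar>C\<bar>" if "t \<in> {0..1}" for t
    unfolding abs_mult using * that by (intro mult_mono) (smt (verit))+
  then show "\<exists>B. \<forall>t\<in>{0..1}. \<bar>p t * q t\<bar> \<le> B" by blast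
qed auto

lemma bounded_fun_diff: "bounded_fun p \<Longrightarrow> bounded_fun q \<Longrightarrow> bounded_fun (\<lambda>t. p t - q t)"
  using bounded_fun_add[of p "\<lambda>t. -1 * q t"] bounded_fun_mult[OF bounded_fun_const[of "-1"], of q]
  by simp

lemma bounded_fun_power2: "bounded_fun p \<Longrightarrow> bounded_fun (\<lambda>t. (p t)\<^sup>2)"
  unfolding power2_eq_square by (intro bounded_fun_mult)

lemma bounded_fun_sum:
  "(\<And>i. i \<in> I \<Longrightarrow> bounded_fun (p i)) \<Longrightarrow> bounded_fun (\<lambda>t. \<Sum>i\<in>I. p i t)"
  by (induction I rule: infinite_finite_induct) (auto intro: bounded_fun_const bounded_fun_add)

lemmas bounded_fun_intros =
  bounded_fun_const bounded_fun_add bounded_fun_diff bounded_fun_mult bounded_fun_power2 bounded_fun_sum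

text \<open>Covers quantile functions of empirical measures, which are step functions and not
  continuous.\<close>

lemma bounded_fun_mono_on:
  assumes "mono_on {0..1} p"
  shows "bounded_fun p"
proof (rule bounded_funI)
  have "p \<in> borel_measurable (restrict_space borel {0..1})"
    using assms by (rule borel_measurable_mono_on_fnc)
  then show "p \<in> borel_measurable unit_lborel"
    by (subst measurable_cong_sets[OF _ refl, where M'="restrict_space borel {0..1}"])
       (simp_all add: sets_restrict_space)
  fix t :: real assume "t \<in> {0..1}"
  then show "\<bar>p t\<bar> \<le> \<bar>p 0\<bar> + \<bar>p 1\<bar>"
    using mono_onD[OF assms, of 0 t] mono_onD[OF assms, of t 1] by auto
qed

lemma bounded_fun_continuous_on:
  assumes "continuous_on {0..1} p"
  shows "bounded_fun p"
proof -
  have "bounded (p ` {0..1})"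
    using assms by (intro compact_imp_bounded compact_continuous_image) auto
  then obtain B where "\<forall>t\<in>{0..1}. \<bar>p t\<bar> \<le> B"
    unfolding bounded_iff by auto
  moreover have "p \<in> borel_measurable (restrict_space borel {0..1})"
    using assms by (rule borel_measurable_continuous_on_restrict)
  then have "p \<in> borel_measurable unit_lborel"
    by (subst measurable_cong_sets[OF _ refl, where M'="restrict_space borel {0..1}"])
       (simp_all add: sets_restrict_space)
  ultimately show ?thesis unfolding bounded_fun_def by blast
qed

text \<open>Integrates a pointwise inequality, so no Minkowski inequality is involved; the factor 2
  is harmless for a rate.\<close>

lemma L2_dist_triangle_sq:
  assumes "bounded_fun p" "bounded_fun q" "bounded_fun r"
  shows "(L2_dist p r)\<^sup>2 \<le> 2 * (L2_dist p q)\<^sup>2 + 2 * (L2_dist q r)\<^sup>2"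
proof -
  have "(LINT t|unit_lborel. (p t - r t)\<^sup>2) \<le>
        (LINT t|unit_lborel. 2 * (p t - q t)\<^sup>2 + 2 * (q t - r t)\<^sup>2)"
  proof (intro integral_mono bounded_fun_integrable bounded_fun_intros assms)
    fix t
    have "0 \<le> ((p t - q t) - (q t - r t))\<^sup>2" by simp
    then show "(p t - r t)\<^sup>2 \<le> 2 * (p t - q t)\<^sup>2 + 2 * (q t - r t)\<^sup>2"
      by (simp add: power2_eq_square algebra_simps)
  qed
  also have "\<dots> = 2 * (L2_dist p q)\<^sup>2 + 2 * (L2_dist q r)\<^sup>2"
    unfolding L2_dist_sq
    by (subst Bochner_Integration.integral_add)
       (auto intro!: bounded_fun_integrable bounded_fun_intros assms)
  finally show ?thesis unfolding L2_dist_sq .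
qed

section \<open>The shape space\<close>

locale shape_space =
  fixes T M L :: real
  assumes T_pos: "0 < T" and M_pos: "0 < M" and M_less_L: "M < L"
    and shapes_nonempty: "shape_quantiles T M L \<noteq> {}"
begin

lemma L_pos: "0 < L" using M_pos M_less_L by simp

context
  fixes q assumes q: "q \<in> shape_quantiles T M L"
begin

lemma shape_quantile_range: "t \<in> {0..1} \<Longrightarrow> q t \<in> {0..T}"
  and shape_quantile_0: "q 0 = 0" and shape_quantile_1: "q 1 = T"
  and shape_quantile_lower: "s \<in> {0..1} \<Longrightarrow> t \<in> {0..1} \<Longrightarrow> M * \<bar>s - t\<bar> \<le> \<bar>q s - q t\<bar>"
  and shape_quantile_lipschitz: "s \<in> {0..1} \<Longrightarrow> t \<in> {0..1} \<Longrightarrow> \<bar>q s - q t\<bar> \<le> L * \<bar>s - t\<bar>"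
  and shape_quantile_ext: "q \<in> extensional {0..1}"
  using q unfolding shape_quantiles_def by (auto simp: PiE_def)

lemma shape_quantile_continuous: "continuous_on {0..1} q"
proof -
  have "L-lipschitz_on {0..1} q"
    using L_pos shape_quantile_lipschitz by (intro lipschitz_onI) (auto simp: dist_real_def)
  then show ?thesis by (rule lipschitz_on_continuous_on)
qed

lemma bounded_fun_shape_quantile: "bounded_fun q"
  by (rule bounded_fun_continuous_on[OF shape_quantile_continuous])

lemma shape_quantile_inj: "inj_on q {0..1}"
proof (rule inj_onI)
  fix s t :: real assume "s \<in> {0..1}" "t \<in> {0..1}" "q s = q t"
  then have "M * \<bar>s - t\<bar> \<le> 0" using shape_quantile_lower[of s t] by simp
  then show "s = t" using M_pos by (simp add: mult_le_0_iff)
qed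

text \<open>The definition bounds only absolute increments. The lower bound makes q injective, a
  continuous injective function on an interval is strictly monotone, and the maximal value
  \<open>q 1 = T\<close> decides the direction.\<close>

lemma shape_quantile_strict: assumes "0 \<le> s" "s < t" "t \<le> 1" shows "q s < q t"
proof -
  have s1: "q s < q 1"
    using shape_quantile_range[of s] shape_quantile_1 inj_onD[OF shape_quantile_inj, of s 1] assms by fastforce
  show ?thesis
  proof (cases "t = 1")
    case False
    have "continuous_on {s..1} q" by (rule continuous_on_subset[OF shape_quantile_continuous]) (use assms in auto)
    moreover have "inj_on q {s..1}" by (rule inj_on_subset[OF shape_quantile_inj]) (use assms in auto)
    ultimately have "(q s < q t \<and> q t < q 1) \<or> (q 1 < q t \<and> q t < q s)"
      using continuous_inj_imp_mono[of s t 1 q] assms False by auto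
    then show ?thesis using s1 by auto
  qed (use s1 in simp)
qed

lemma shape_quantile_le_iff: "s \<in> {0..1} \<Longrightarrow> t \<in> {0..1} \<Longrightarrow> q s \<le> q t \<longleftrightarrow> s \<le> t"
  using shape_quantile_strict[of s t] shape_quantile_strict[of t s] by (cases s t rule: linorder_cases) auto

lemma shape_quantile_incr: "0 \<le> s \<Longrightarrow> s \<le> t \<Longrightarrow> t \<le> 1 \<Longrightarrow> M * (t - s) \<le> q t - q s \<and> q t - q s \<le> L * (t - s)"
  using shape_quantile_lower[of s t] shape_quantile_lipschitz[of s t] shape_quantile_le_iff[of s t] by auto

lemma shape_quantile_surj: assumes "u \<in> {0..T}" obtains t where "t \<in> {0..1}" "q t = u"
  using IVT'[of q 0 u 1] assms shape_quantile_0 shape_quantile_1 shape_quantile_continuous by auto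

end

text \<open>For an increasing candidate the bounds can be stated without absolute values. In this
  form they are linear in q and pass to midpoints, pointwise limits and means.\<close>

lemma shape_quantileI:
  assumes "q \<in> extensional {0..1}" "q 0 = 0" "q 1 = T"
    "\<And>s t. 0 \<le> s \<Longrightarrow> s \<le> t \<Longrightarrow> t \<le> 1 \<Longrightarrow> M * (t - s) \<le> q t - q s \<and> q t - q s \<le> L * (t - s)"
  shows "q \<in> shape_quantiles T M L"
proof -
  have mono: "q s \<le> q t" if "0 \<le> s" "s \<le> t" "t \<le> 1" for s t
    using assms(4)[OF that] M_pos that mult_nonneg_nonneg[of M "t - s"] by linarith
  have "M * \<bar>s - t\<bar> \<le> \<bar>q s - q t\<bar> \<and> \<bar>q s - q t\<bar> \<le> L * \<bar>s - t\<bar>"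
    if "s \<in> {0..1}" "t \<in> {0..1}" for s t
    using assms(4)[of s t] assms(4)[of t s] mono[of s t] mono[of t s] that
    by (cases "s \<le> t") (auto simp: abs_minus_commute)
  moreover have "q t \<in> {0..T}" if "t \<in> {0..1}" for t
    using mono[of 0 t] mono[of t 1] that assms by auto
  ultimately show ?thesis unfolding shape_quantiles_def using assms(1-3) by (auto simp: PiE_def)
qed

lemma T_le_L: "T \<le> L"
proof -
  obtain q where "q \<in> shape_quantiles T M L" using shapes_nonempty by auto
  then show ?thesis using shape_quantile_incr[of q 0 1] shape_quantile_0[of q] shape_quantile_1[of q] by auto
qed

text \<open>
  On an interval of length \<open>\<delta> / (4 * L)\<close> next to \<open>t\<close>, the difference of the two functions stays
  above half of its value \<open>\<delta>\<close> at \<open>t\<close>.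
\<close>

lemma L2_dist_controls_pointwise:
  assumes p: "p \<in> shape_quantiles T M L" and q: "q \<in> shape_quantiles T M L" and t: "t \<in> {0..1}"
  shows "\<bar>p t - q t\<bar> ^ 3 \<le> 16 * L * (L2_dist p q)\<^sup>2"
proof -
  define \<delta> where "\<delta> = \<bar>p t - q t\<bar>"
  define r where "r = \<delta> / (4 * L)"
  have \<delta>: "0 \<le> \<delta>" "\<delta> \<le> L"
    using shape_quantile_range[OF p t] shape_quantile_range[OF q t] T_le_L by (auto simp: \<delta>_def)
  have r: "0 \<le> r" "r \<le> 1/4" using \<delta> L_pos by (auto simp: r_def field_simps)
  \<comment> \<open>The interval starts or ends at t, on the side where [0,1] leaves room;
    \<open>r \<le> 1/4\<close> guarantees that one side does.\<close>
  obtain a where a: "0 \<le> a" "a + r \<le> 1" "a \<le> t" "t \<le> a + r"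
  proof (cases "t \<le> 1/2")
    case True then show ?thesis using that[of t] t r by auto
  next
    case False then show ?thesis using that[of "t - r"] t r by auto
  qed
  have low: "\<delta> / 2 \<le> \<bar>p s - q s\<bar>" if s: "s \<in> {a..a+r}" for s
  proof -
    have s1: "s \<in> {0..1}" "\<bar>s - t\<bar> \<le> r" using s a r by auto
    have "\<bar>p s - p t\<bar> \<le> L * r" "\<bar>q s - q t\<bar> \<le> L * r"
      using shape_quantile_lipschitz[OF p s1(1) t] shape_quantile_lipschitz[OF q s1(1) t] s1(2) L_pos
      by (meson mult_left_mono order_less_imp_le order_trans)+
    moreover have "L * r = \<delta> / 4" using L_pos by (simp add: r_def)
    ultimately have "\<bar>p s - p t\<bar> \<le> \<delta> / 4" "\<bar>q s - q t\<bar> \<le> \<delta> / 4" by simp_all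
    moreover have "\<delta> \<le> \<bar>p s - p t\<bar> + \<bar>p s - q s\<bar> + \<bar>q s - q t\<bar>"
      unfolding \<delta>_def by arith
    ultimately show ?thesis by linarith
  qed
  have "(LINT s|unit_lborel. indicator {a..a+r} s * (\<delta> / 2)\<^sup>2) \<le> (LINT s|unit_lborel. (p s - q s)\<^sup>2)"
  proof (intro integral_mono)
    show "integrable unit_lborel (\<lambda>s. (p s - q s)\<^sup>2)"
      by (intro bounded_fun_integrable bounded_fun_intros bounded_fun_shape_quantile[OF p] bounded_fun_shape_quantile[OF q])
    show "integrable unit_lborel (\<lambda>s. indicator {a..a+r} s * (\<delta> / 2)\<^sup>2)"
      by (intro bounded_fun_integrable bounded_fun_intros bounded_funI[where B=1])
         (auto simp: indicator_def measurable_restrict_space1)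
    fix s show "indicator {a..a+r} s * (\<delta> / 2)\<^sup>2 \<le> (p s - q s)\<^sup>2"
      using low[of s] \<delta> by (auto simp: indicator_def intro: power_mono[of "\<delta>/2" "\<bar>p s - q s\<bar>" 2, simplified] split: if_splits)
  qed
  also have "(LINT s|unit_lborel. indicator {a..a+r} s * (\<delta> / 2)\<^sup>2) =
     (\<delta>/2)\<^sup>2 * measure lborel {a..a+r}"
  proof -
    have "{a..a+r} \<inter> {0..1} = {a..a+r}" using a by auto
    moreover have "measure unit_lborel {a..a+r} = measure lborel {a..a+r}"
      using a by (intro measure_restrict_space) auto
    ultimately show ?thesis by (simp add: space_restrict_space del: Int_atLeastAtMost)
  qed
  also have "\<dots> = (\<delta>/2)\<^sup>2 * r" using r by simp
  also have "\<dots> = \<delta> ^ 3 / (16 * L)"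
    using L_pos by (simp add: r_def power2_eq_square power3_eq_cube)
  finally show ?thesis using L_pos by (simp add: L2_dist_sq \<delta>_def field_simps)
qed

lemma shape_quantile_midpoint:
  assumes p: "p \<in> shape_quantiles T M L" and q: "q \<in> shape_quantiles T M L"
  shows "(\<lambda>t\<in>{0..1}. (p t + q t) / 2) \<in> shape_quantiles T M L"
proof (rule shape_quantileI)
  fix s t :: real assume *: "0 \<le> s" "s \<le> t" "t \<le> 1"
  show "M * (t - s) \<le> restrict (\<lambda>t. (p t + q t) / 2) {0..1} t - restrict (\<lambda>t. (p t + q t) / 2) {0..1} s \<and>
        restrict (\<lambda>t. (p t + q t) / 2) {0..1} t - restrict (\<lambda>t. (p t + q t) / 2) {0..1} s \<le> L * (t - s)"
    using shape_quantile_incr[OF p *] shape_quantile_incr[OF q *] * by (auto simp: field_simps)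
qed (use shape_quantile_0[OF p] shape_quantile_0[OF q] shape_quantile_1[OF p] shape_quantile_1[OF q] in auto)

text \<open>The Hilbert space projection argument: the parallelogram law makes a minimising sequence
  Cauchy in the mean square. \<open>L2_dist_controls_pointwise\<close> upgrades this to Cauchy at
  every t, so the limit is built pointwise, without completeness of L2, and inherits the shape
  constraints directly.\<close>

lemma shape_quantile_projection_exists:
  assumes Y: "bounded_fun Y"
  shows "\<exists>q\<in>shape_quantiles T M L. \<forall>p\<in>shape_quantiles T M L. (L2_dist q Y)\<^sup>2 \<le> (L2_dist p Y)\<^sup>2"
proof -
  let ?S = "shape_quantiles T M L"
  define J where "J p = (L2_dist p Y)\<^sup>2" for p
  define m where "m = Inf (J ` ?S)"
  have bdd: "bdd_below (J ` ?S)" by (auto intro!: bdd_belowI[of _ 0] simp: J_def)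
  have m_le: "m \<le> J p" if "p \<in> ?S" for p
    unfolding m_def using bdd that by (simp add: cINF_lower)
  have "\<exists>p\<in>?S. J p < m + 1 / (real k + 1)" for k :: nat
  proof -
    have "m < m + 1 / (real k + 1)" by simp
    then show ?thesis using bdd shapes_nonempty unfolding m_def by (subst (asm) cInf_less_iff) auto
  qed
  then obtain p where p: "\<And>k. p k \<in> ?S" "\<And>k. J (p k) < m + 1 / (real k + 1)" by metis
  have bf: "bounded_fun (p k)" for k by (rule bounded_fun_shape_quantile[OF p(1)])
  have par: "(L2_dist (p j) (p k))\<^sup>2 \<le> 2 / (real j + 1) + 2 / (real k + 1)" for j k
  proof -
    define c where "c = (\<lambda>t\<in>{0..1}. (p j t + p k t) / 2)"
    have c: "c \<in> ?S" unfolding c_def by (rule shape_quantile_midpoint[OF p(1) p(1)])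
    \<comment> \<open>Parallelogram identity around Y: the midpoint c is again a shape quantile
      function, so \<open>J c\<close> is at least m.\<close>
    have "(L2_dist (p j) (p k))\<^sup>2 + 4 * J c = (LINT t|unit_lborel. (p j t - p k t)\<^sup>2 + 4 * (c t - Y t)\<^sup>2)"
      unfolding J_def L2_dist_sq
      by (subst Bochner_Integration.integral_add)
         (auto intro!: bounded_fun_integrable bounded_fun_intros bf Y bounded_fun_shape_quantile[OF c])
    also have "\<dots> = (LINT t|unit_lborel. 2 * (p j t - Y t)\<^sup>2 + 2 * (p k t - Y t)\<^sup>2)"
      by (rule Bochner_Integration.integral_cong)
         (auto simp: c_def space_restrict_space power2_eq_square field_simps)
    also have "\<dots> = 2 * J (p j) + 2 * J (p k)"
      unfolding J_def L2_dist_sq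
      by (subst Bochner_Integration.integral_add)
         (auto intro!: bounded_fun_integrable bounded_fun_intros bf Y)
    finally show ?thesis using m_le[OF c] p(2)[of j] p(2)[of k] by linarith
  qed
  have pt: "\<bar>p j t - p k t\<bar> ^ 3 \<le> 16 * L * (2 / (real j + 1) + 2 / (real k + 1))" if "t \<in> {0..1}" for j k t
    using L2_dist_controls_pointwise[OF p(1) p(1) that, of j k] par[of j k] L_pos
    by (smt (verit) mult_left_mono)
  have cau: "Cauchy (\<lambda>k. p k t)" if t: "t \<in> {0..1}" for t
  proof (rule metric_CauchyI)
    fix e :: real assume e: "0 < e"
    obtain n :: nat where n: "64 * L / e ^ 3 < real n" using reals_Archimedean2 by blast
    have "dist (p j t) (p k t) < e" if jk: "n \<le> j" "n \<le> k" for j k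
    proof -
      have "16 * L * (2 / (real j + 1) + 2 / (real k + 1)) \<le> 16 * L * (2 / (real n + 1) + 2 / (real n + 1))"
        using jk L_pos by (intro mult_left_mono add_mono divide_left_mono) auto
      also have "\<dots> = 64 * L / (real n + 1)" by simp
      also have "\<dots> < e ^ 3"
      proof -
        have "0 < e ^ 3" using e by simp
        moreover from this have "64 * L < real n * e ^ 3" using n by (simp add: divide_less_eq)
        moreover have "e ^ 3 * (real n + 1) = real n * e ^ 3 + e ^ 3" by (simp add: algebra_simps)
        ultimately have "64 * L < e ^ 3 * (real n + 1)" by linarith
        then show ?thesis by (simp add: divide_less_eq)
      qed
      finally have "\<bar>p j t - p k t\<bar> ^ 3 < e ^ 3" using pt[OF t, of j k] by linarith
      then show ?thesis using e by (simp add: dist_real_def power_less_imp_less_base)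
    qed
    then show "\<exists>n. \<forall>j\<ge>n. \<forall>k\<ge>n. dist (p j t) (p k t) < e" by blast
  qed
  define q where "q = (\<lambda>t\<in>{0..1}. lim (\<lambda>k. p k t))"
  have lim: "(\<lambda>k. p k t) \<longlonglongrightarrow> q t" if "t \<in> {0..1}" for t
    using cau[OF that] that by (simp add: q_def Cauchy_convergent_iff convergent_LIMSEQ_iff)
  have q: "q \<in> ?S"
  proof (rule shape_quantileI)
    show "q 0 = 0" using lim[of 0] shape_quantile_0[OF p(1)] by (simp add: LIMSEQ_const_iff)
    show "q 1 = T" using lim[of 1] shape_quantile_1[OF p(1)] by (simp add: LIMSEQ_const_iff)
    fix s t :: real assume *: "0 \<le> s" "s \<le> t" "t \<le> 1"
    have l: "(\<lambda>k. p k t - p k s) \<longlonglongrightarrow> q t - q s"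
      using * by (intro tendsto_intros lim) auto
    show "M * (t - s) \<le> q t - q s \<and> q t - q s \<le> L * (t - s)"
      using shape_quantile_incr[OF p(1) *] LIMSEQ_le_const[OF l] LIMSEQ_le_const2[OF l] by blast
  qed (simp add: q_def)
  obtain B where B: "\<And>t. t \<in> {0..1} \<Longrightarrow> \<bar>Y t\<bar> \<le> B" using Y unfolding bounded_fun_def by blast
  have "(\<lambda>k. J (p k)) \<longlonglongrightarrow> J q"
    unfolding J_def L2_dist_sq
  proof (rule integral_dominated_convergence)
    show "integrable unit_lborel (\<lambda>_. (T + B)\<^sup>2)"
      by (intro bounded_fun_integrable bounded_fun_const)
    show "AE t in unit_lborel. (\<lambda>k. (p k t - Y t)\<^sup>2) \<longlonglongrightarrow> (q t - Y t)\<^sup>2"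
      by (rule AE_I2) (auto intro!: tendsto_intros lim simp: space_restrict_space)
    fix k show "AE t in unit_lborel. norm ((p k t - Y t)\<^sup>2) \<le> (T + B)\<^sup>2"
    proof (rule AE_I2)
      fix t assume "t \<in> space unit_lborel"
      then have "t \<in> {0..1}" by (simp add: space_restrict_space)
      then have "\<bar>p k t - Y t\<bar> \<le> T + B" using B[of t] shape_quantile_range[OF p(1), of t k] by auto
      then show "norm ((p k t - Y t)\<^sup>2) \<le> (T + B)\<^sup>2"
        using power_mono[of "\<bar>p k t - Y t\<bar>" "T + B" 2] by simp
    qed
  qed (intro bounded_fun_measurable bounded_fun_intros bf bounded_fun_shape_quantile[OF q] Y)+
  moreover have "(\<lambda>k. m + 1 / (real k + 1)) \<longlonglongrightarrow> m + 0"
    by (intro tendsto_intros LIMSEQ_inverse_real_of_nat[unfolded inverse_eq_divide Suc_eq_plus1 of_nat_add, simplified] )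
  ultimately have "J q \<le> m + 0"
    by (rule LIMSEQ_le) (use p(2) in \<open>auto intro!: exI[of _ 0] less_imp_le\<close>)
  then show ?thesis using m_le q unfolding J_def by (intro bexI[of _ q]) (fastforce simp: J_def)+
qed

end

section \<open>Quantile functions\<close>

lemma quantile_fun_extensional: "quantile_fun T \<mu> \<in> extensional {0..1}"
  unfolding quantile_fun_def by simp

text \<open>The hypothesis on \<open>cdf \<mu> T\<close> puts T into every set whose infimum is
  taken, so \<open>Inf\<close> is never applied to the empty set. An inequality is enough and holds
  for the uniform and the empirical measures alike.\<close>

lemma
  assumes "0 \<le> T" "1 \<le> cdf \<mu> T"
  shows quantile_fun_range: "t \<in> {0..1} \<Longrightarrow> quantile_fun T \<mu> t \<in> {0..T}"
    and quantile_fun_mono: "mono_on {0..1} (quantile_fun T \<mu>)"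
    and quantile_fun_le: "t \<in> {0..1} \<Longrightarrow> u \<in> {0..T} \<Longrightarrow> t \<le> cdf \<mu> u \<Longrightarrow> quantile_fun T \<mu> t \<le> u"
proof -
  have bdd: "bdd_below {u \<in> {0..T}. t \<le> cdf \<mu> u}" for t by (auto intro: bdd_belowI[of _ 0])
  have T: "T \<in> {u \<in> {0..T}. t \<le> cdf \<mu> u}" if "t \<in> {0..1}" for t using assms that by auto
  show le: "t \<in> {0..1} \<Longrightarrow> u \<in> {0..T} \<Longrightarrow> t \<le> cdf \<mu> u \<Longrightarrow> quantile_fun T \<mu> t \<le> u" for u t
    unfolding quantile_fun_def using bdd by (auto intro!: cInf_lower)
  show "t \<in> {0..1} \<Longrightarrow> quantile_fun T \<mu> t \<in> {0..T}" for t
    using le[of t T] T[of t] unfolding quantile_fun_def by (auto intro!: cInf_greatest)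
  show "mono_on {0..1} (quantile_fun T \<mu>)"
  proof (rule mono_onI)
    fix s t :: real assume st: "s \<in> {0..1}" "t \<in> {0..1}" "s \<le> t"
    have "Inf {u \<in> {0..T}. s \<le> cdf \<mu> u} \<le> Inf {u \<in> {0..T}. t \<le> cdf \<mu> u}"
      using st T[of t] by (intro cInf_superset_mono bdd) auto
    then show "quantile_fun T \<mu> s \<le> quantile_fun T \<mu> t" using st by (simp add: quantile_fun_def)
  qed
qed

text \<open>Right continuity of the distribution function makes the infimum attained, which gives
  the usual Galois connection between quantiles and distribution function.\<close>

lemma quantile_fun_le_iff:
  assumes \<mu>: "real_distribution \<mu>" and T: "0 \<le> T" "cdf \<mu> T = 1" and t: "t \<in> {0..1}" and u: "u \<in> {0..T}"
  shows "quantile_fun T \<mu> t \<le> u \<longleftrightarrow> t \<le> cdf \<mu> u"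
proof
  interpret real_distribution \<mu> by fact
  assume le: "quantile_fun T \<mu> t \<le> u"
  show "t \<le> cdf \<mu> u"
  proof (cases "u = T")
    case False
    then have uT: "u < T" using u by auto
    have "t \<le> cdf \<mu> v" if "u < v" "v < T" for v
    proof -
      have "Inf {u \<in> {0..T}. t \<le> cdf \<mu> u} < v" using le that t by (simp add: quantile_fun_def)
      then obtain s where "s \<in> {0..T}" "t \<le> cdf \<mu> s" "s < v"
        using T t by (subst (asm) cInf_less_iff) (auto intro: bdd_belowI[of _ 0])
      then show ?thesis using cdf_nondecreasing[of s v] by auto
    qed
    then have ev: "eventually (\<lambda>v. t \<le> cdf \<mu> v) (at_right u)"
      using uT by (auto simp: eventually_at_right)
    have "(cdf \<mu> \<longlongrightarrow> cdf \<mu> u) (at_right u)"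
      using cdf_is_right_cont[of u] by (simp add: continuous_within)
    then show ?thesis by (rule tendsto_lowerbound[OF _ ev]) simp
  qed (use T t in auto)
qed (use quantile_fun_le[of T \<mu> t u] assms in auto)

section \<open>Laws with a density on [0,T]\<close>

abbreviation density_measure :: "real \<Rightarrow> (real \<Rightarrow> real) \<Rightarrow> real measure" where
  "density_measure T f \<equiv> density lborel (\<lambda>t. ennreal (indicator {0..T} t * f t))"

lemma emeasure_density_measure:
  assumes nn: "\<And>t. t \<in> {0..T} \<Longrightarrow> 0 \<le> f t" and int: "set_integrable lborel {0..T} f" and A: "A \<in> sets borel"
  shows "emeasure (density_measure T f) A = ennreal (LINT t:A \<inter> {0..T}|lborel. f t)"
proof -
  have i: "integrable lborel (\<lambda>t. indicator {0..T} t * f t)"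
    using int by (simp add: set_integrable_def)
  have i2: "integrable lborel (\<lambda>t. indicator (A \<inter> {0..T}) t * f t)"
    using set_integrable_subset[OF int, of "A \<inter> {0..T}"] A by (simp add: set_integrable_def)
  have m: "(\<lambda>t. ennreal (indicator {0..T} t * f t)) \<in> borel_measurable lborel" using i by measurable
  have "emeasure (density_measure T f) A = (\<integral>\<^sup>+t. ennreal (indicator {0..T} t * f t) * indicator A t \<partial>lborel)"
    using A by (subst emeasure_density[OF m]) auto
  also have "\<dots> = (\<integral>\<^sup>+t. ennreal (indicator (A \<inter> {0..T}) t * f t) \<partial>lborel)"
    by (intro nn_integral_cong) (auto simp: indicator_def)
  also have "\<dots> = ennreal (LINT t|lborel. indicator (A \<inter> {0..T}) t * f t)"
    using nn by (intro nn_integral_eq_integral i2) (auto simp: indicator_def)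
  finally show ?thesis by (simp add: set_lebesgue_integral_def)
qed

lemma
  assumes f: "prob_density_on T f"
  shows real_distribution_density_measure: "real_distribution (density_measure T f)"
    and cdf_density_measure: "cdf (density_measure T f) u = (LINT t:{..u} \<inter> {0..T}|lborel. f t)"
    and cdf_density_measure_T: "cdf (density_measure T f) T = 1"
proof -
  have nn: "\<And>t. t \<in> {0..T} \<Longrightarrow> 0 \<le> f t" and int: "set_integrable lborel {0..T} f"
    and 1: "(LINT t:{0..T}|lborel. f t) = 1" using f by (auto simp: prob_density_on_def)
  note e = emeasure_density_measure[of T f, OF nn int]
  have "prob_space (density_measure T f)"
    by (rule prob_spaceI) (use e[of UNIV] 1 in simp)
  then show "real_distribution (density_measure T f)"
    by (simp add: real_distribution_def real_distribution_axioms_def)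
  show c: "cdf (density_measure T f) u = (LINT t:{..u} \<inter> {0..T}|lborel. f t)" for u
  proof -
    have "0 \<le> (LINT t:{..u} \<inter> {0..T}|lborel. f t)" unfolding set_lebesgue_integral_def
      by (intro integral_nonneg_AE AE_I2) (auto simp: indicator_def intro: nn)
    then show ?thesis unfolding cdf_def measure_def by (subst e) auto
  qed
  have "{..T} \<inter> {0..T} = {0..T}" by auto
  then show "cdf (density_measure T f) T = 1" using c[of T] 1 by simp
qed

section \<open>Stability of shape quantile functions under perturbation of the law\<close>

context shape_space
begin

context
  fixes \<mu> q
  assumes \<mu>: "real_distribution \<mu>" "cdf \<mu> T = 1" and q_def: "q = quantile_fun T \<mu>"
    and q: "q \<in> shape_quantiles T M L"
begin

text \<open>Strict monotonicity of q turns the Galois connection into a pair of inverse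
  functions.\<close>

lemma cdf_quantile_fun: assumes t: "t \<in> {0..1}" shows "cdf \<mu> (q t) = t"
proof (rule antisym)
  note iff = quantile_fun_le_iff[OF \<mu>(1) less_imp_le[OF T_pos] \<mu>(2), folded q_def]
  interpret real_distribution \<mu> by fact
  have qt: "q t \<in> {0..T}" by (rule shape_quantile_range[OF q t])
  have "q (cdf \<mu> (q t)) \<le> q t"
    using iff[of "cdf \<mu> (q t)" "q t"] qt cdf_bounded_prob[of "q t"] cdf_nonneg[of "q t"] by simp
  then show "cdf \<mu> (q t) \<le> t"
    using shape_quantile_le_iff[OF q, of "cdf \<mu> (q t)" t] t cdf_bounded_prob[of "q t"] cdf_nonneg[of "q t"] by simp
  show "t \<le> cdf \<mu> (q t)" using iff[OF t qt] by simp
qed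

lemma quantile_fun_cdf: assumes u: "u \<in> {0..T}" shows "cdf \<mu> u \<in> {0..1}" "q (cdf \<mu> u) = u"
proof -
  obtain t where t: "t \<in> {0..1}" "q t = u" using shape_quantile_surj[OF q u] .
  then show "cdf \<mu> u \<in> {0..1}" "q (cdf \<mu> u) = u" using cdf_quantile_fun[of t] by auto
qed

text \<open>The lower slope bound M of q is an upper slope bound 1/M of its inverse.\<close>

lemma cdf_lipschitz: assumes "0 \<le> u" "u \<le> v" "v \<le> T" shows "cdf \<mu> v \<le> cdf \<mu> u + (v - u) / M"
proof -
  interpret real_distribution \<mu> by fact
  have "M * (cdf \<mu> v - cdf \<mu> u) \<le> q (cdf \<mu> v) - q (cdf \<mu> u)"
    using shape_quantile_incr[OF q, of "cdf \<mu> u" "cdf \<mu> v"] quantile_fun_cdf[of u] quantile_fun_cdf[of v]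
      cdf_nondecreasing[of u v] assms by auto
  also have "\<dots> = v - u" using quantile_fun_cdf[of u] quantile_fun_cdf[of v] assms by auto
  finally show ?thesis using M_pos by (simp add: field_simps)
qed

text \<open>Let v be the perturbed quantile. Then \<open>cdf \<mu> v\<close> is within D of t, and
  \<open>v = q (cdf \<mu> v)\<close> is within L * D of \<open>q t\<close>. Since
  \<open>\<mu>'\<close> may have jumps and no right continuity is assumed of it, its distribution
  function is compared with t only at points slightly above or below v; the 1/M-Lipschitz function
  \<open>cdf \<mu>\<close> absorbs the shift.\<close>

lemma quantile_fun_close:
  assumes \<mu>': "1 \<le> cdf \<mu>' T"
    and close: "\<And>u. u \<in> {0..T} \<Longrightarrow> \<bar>cdf \<mu>' u - cdf \<mu> u\<bar> \<le> D" and t: "t \<in> {0..1}"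
  shows "\<bar>quantile_fun T \<mu>' t - q t\<bar> \<le> L * D"
proof -
  define v where "v = quantile_fun T \<mu>' t"
  have v: "v \<in> {0..T}" unfolding v_def using \<mu>' T_pos t by (intro quantile_fun_range) auto
  have D: "0 \<le> D" using close[of T] T_pos by (smt (verit) atLeastAtMost_iff)
  have "t \<le> cdf \<mu> v + D"
  proof (cases "v = T")
    case False
    have *: "t \<le> cdf \<mu> v + D + (w - v) / M" if w: "v < w" "w \<le> T" for w
    proof -
      have "Inf {u \<in> {0..T}. t \<le> cdf \<mu>' u} < w" using t w by (simp add: v_def quantile_fun_def)
      then obtain s where s: "s \<in> {0..T}" "t \<le> cdf \<mu>' s" "s < w"
        using \<mu>' T_pos t by (subst (asm) cInf_less_iff) (auto intro!: exI[of _ T] bdd_belowI[of _ 0])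
      have "t \<le> cdf \<mu> s + D" using close[OF s(1)] s(2) by linarith
      also have "cdf \<mu> s \<le> cdf \<mu> w"
        using \<mu>(1) s by (simp add: finite_borel_measure.cdf_nondecreasing real_distribution.finite_borel_measure_M)
      also have "cdf \<mu> w \<le> cdf \<mu> v + (w - v) / M" using v w by (intro cdf_lipschitz) auto
      finally show ?thesis by simp
    qed
    show ?thesis
    proof (rule field_le_epsilon)
      fix e :: real assume e: "0 < e"
      define w where "w = min T (v + e * M)"
      have w: "v < w" "w \<le> T" using False v e M_pos by (auto simp: w_def)
      have "(w - v) / M \<le> e" using M_pos by (simp add: w_def divide_le_eq)
      then show "t \<le> cdf \<mu> v + D + e" using *[OF w] by linarith
    qed
  qed (use \<mu> t D in auto)
  moreover have "cdf \<mu> v \<le> t + D"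
  proof (cases "v = 0")
    case True
    then show ?thesis using cdf_quantile_fun[of 0] shape_quantile_0[OF q] t D by auto
  next
    case False
    have *: "cdf \<mu> v \<le> t + D + (v - w) / M" if w: "0 \<le> w" "w < v" for w
    proof -
      have "cdf \<mu>' w \<le> t"
      proof (rule ccontr)
        assume "\<not> cdf \<mu>' w \<le> t"
        then have "v \<le> w" unfolding v_def using \<mu>' T_pos t w v by (intro quantile_fun_le) auto
        then show False using w by simp
      qed
      then have "cdf \<mu> w \<le> t + D" using close[of w] w v by auto
      then show ?thesis using cdf_lipschitz[of w v] w v by auto
    qed
    show ?thesis
    proof (rule field_le_epsilon)
      fix e :: real assume e: "0 < e"
      define w where "w = max 0 (v - e * M)"
      have w: "0 \<le> w" "w < v" using False v e M_pos by (auto simp: w_def)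
      have "(v - w) / M \<le> e" using M_pos by (simp add: w_def divide_le_eq)
      then show "cdf \<mu> v \<le> t + D + e" using *[OF w] by linarith
    qed
  qed
  ultimately have "\<bar>cdf \<mu> v - t\<bar> \<le> D" by linarith
  then have "L * \<bar>cdf \<mu> v - t\<bar> \<le> L * D" using L_pos by simp
  moreover have "\<bar>q (cdf \<mu> v) - q t\<bar> \<le> L * \<bar>cdf \<mu> v - t\<bar>"
    using quantile_fun_cdf[OF v] t by (intro shape_quantile_lipschitz[OF q]) auto
  ultimately show ?thesis using quantile_fun_cdf[OF v] unfolding v_def by simp
qed

text \<open>Monotonicity traps both distribution functions between neighbouring grid points, and
  over one mesh T/k that of \<open>\<mu>\<close> grows by at most T/(k*M).\<close>

lemma cdf_close_of_grid:
  assumes mono': "\<And>u v. u \<le> v \<Longrightarrow> cdf \<mu>' u \<le> cdf \<mu>' v" and k: "0 < k"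
    and grid: "\<And>j. j \<le> k \<Longrightarrow> \<bar>cdf \<mu>' (real j * T / real k) - cdf \<mu> (real j * T / real k)\<bar> \<le> \<delta>"
    and u: "u \<in> {0..T}"
  shows "\<bar>cdf \<mu>' u - cdf \<mu> u\<bar> \<le> \<delta> + T / (real k * M)"
proof -
  interpret real_distribution \<mu> by fact
  define w where "w j = real j * T / real k" for j :: nat
  have pos: "0 \<le> T / (real k * M)" using T_pos M_pos by simp
  \<comment> \<open>The endpoint u = T is assigned to the last interval, since rounding down would
    give j = k.\<close>
  obtain j where j: "j < k" "w j \<le> u" "u \<le> w (Suc j)"
  proof (cases "u = T")
    case True
    then show ?thesis using that[of "k - 1"] k T_pos by (auto simp: w_def field_simps of_nat_diff)
  next
    case False
    define j where "j = nat \<lfloor>u * real k / T\<rfloor>"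
    have j: "real j \<le> u * real k / T" "u * real k / T < real j + 1"
      using u T_pos by (auto simp: j_def)
    have "u * real k / T < real k" using False u T_pos k by (simp add: field_simps)
    then have "real j < real k" using j by linarith
    then show ?thesis using that[of j] j T_pos k by (auto simp: w_def field_simps)
  qed
  have w: "0 \<le> w j" "w j \<le> w (Suc j)" "w (Suc j) \<le> T" "w (Suc j) - w j = T / real k"
  proof -
    have "real (Suc j) * T \<le> real k * T" using j T_pos by (intro mult_right_mono) auto
    then show "w (Suc j) \<le> T" using k by (simp add: w_def field_simps)
    show "0 \<le> w j" "w j \<le> w (Suc j)" "w (Suc j) - w j = T / real k"
      using j k T_pos by (auto simp: w_def field_simps)
  qed
  have "cdf \<mu> (w (Suc j)) \<le> cdf \<mu> (w j) + T / (real k * M)"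
    using cdf_lipschitz[OF w(1-3)] w(4) by simp
  moreover have "\<bar>cdf \<mu>' (w j) - cdf \<mu> (w j)\<bar> \<le> \<delta>" "\<bar>cdf \<mu>' (w (Suc j)) - cdf \<mu> (w (Suc j))\<bar> \<le> \<delta>"
    using grid[of j] grid[of "Suc j"] j unfolding w_def by auto
  moreover have "cdf \<mu>' (w j) \<le> cdf \<mu>' u" "cdf \<mu>' u \<le> cdf \<mu>' (w (Suc j))"
    "cdf \<mu> (w j) \<le> cdf \<mu> u" "cdf \<mu> u \<le> cdf \<mu> (w (Suc j))"
    using j by (auto intro!: mono' cdf_nondecreasing)
  ultimately show ?thesis by linarith
qed

end

end

section \<open>Empirical quantile functions\<close>

lemma cdf_pmf_of_multiset:
  assumes "N \<noteq> {#}"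
  shows "cdf (measure_pmf (pmf_of_multiset N)) u = real (points_in N {..u}) / real (size N)"
proof -
  have "cdf (measure_pmf (pmf_of_multiset N)) u = (\<Sum>v\<in>set_mset N \<inter> {..u}. pmf (pmf_of_multiset N) v)"
    unfolding cdf_def using assms
    by (subst measure_Int_set_pmf[symmetric]) (auto simp: measure_measure_pmf_finite Int_commute)
  also have "\<dots> = (\<Sum>v\<in>set_mset N \<inter> {..u}. real (count N v)) / real (size N)"
    using assms by (simp add: sum_divide_distrib)
  also have "(\<Sum>v\<in>set_mset N \<inter> {..u}. real (count N v)) = real (points_in N {..u})"
    unfolding points_in_def size_multiset_overloaded_eq
    by (auto simp: Int_def intro!: sum.cong)
  finally show ?thesis .
qed

lemma cdf_measure_pmf_mono: "u \<le> v \<Longrightarrow> cdf (measure_pmf p) u \<le> cdf (measure_pmf p) v"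
  unfolding cdf_def by (intro measure_pmf.finite_measure_mono) auto

text \<open>
  The hypothesis at \<open>j = k\<close> bounds the error of the total count; if there are no points, it makes
  \<open>2 * e / (a * \<tau>)\<close> at least 2, and the bound is trivial.
\<close>

lemma (in shape_space) empirical_quantile_close:
  assumes f: "intensity_shape T l \<in> shape_densities T M L"
    and l: "\<And>t. t \<in> {0..T} \<Longrightarrow> 0 \<le> l t" "set_integrable lborel {0..T} l" and \<tau>: "0 < total_intensity T l"
    and N: "set_mset N \<subseteq> {0..T}" and a: "0 < a" and k: "0 < k"
    and e: "\<And>j. j \<le> k \<Longrightarrow> \<bar>real (points_in N {0..real j * T / real k}) -
             a * (LINT t:{0..real j * T / real k}|lborel. l t)\<bar> \<le> e"
    and t: "t \<in> {0..1}"
  shows "\<bar>empirical_quantile T N t - density_quantile T (intensity_shape T l) t\<bar> \<le>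
         L * (2 * e / (a * total_intensity T l) + T / (real k * M))"
proof -
  define \<tau>l where "\<tau>l = total_intensity T l"
  define f where "f = intensity_shape T l"
  define \<mu> where "\<mu> = density_measure T f"
  have a\<tau>: "0 < a * \<tau>l" using a \<tau> by (simp add: \<tau>l_def)
  have pd: "prob_density_on T f" and q: "quantile_fun T \<mu> \<in> shape_quantiles T M L"
    using f by (auto simp: f_def \<mu>_def shape_densities_def density_quantile_def)
  have \<mu>: "real_distribution \<mu>" "cdf \<mu> T = 1"
    using real_distribution_density_measure[OF pd] cdf_density_measure_T[OF pd] by (auto simp: \<mu>_def)
  have cdf: "cdf \<mu> u = (LINT t:{0..u}|lborel. l t) / \<tau>l" if "u \<in> {0..T}" for u
  proof -
    have "{..u} \<inter> {0..T} = {0..u}" using that by auto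
    then have "cdf \<mu> u = (LINT t:{0..u}|lborel. f t)"
      unfolding \<mu>_def cdf_density_measure[OF pd] by (simp only:)
    then show ?thesis by (simp add: f_def intensity_shape_def \<tau>l_def)
  qed
  have eT: "\<bar>real (size N) - a * \<tau>l\<bar> \<le> e"
  proof -
    have "points_in N {0..T} = size N" using N unfolding points_in_def
      by (metis filter_mset_eq_conv multiset_partition size_mset filter_mset_True subset_eq filter_mset_cong)
    then show ?thesis using e[of k] k by (simp add: \<tau>l_def total_intensity_def)
  qed
  have q_eq: "density_quantile T (intensity_shape T l) = quantile_fun T \<mu>"
    by (simp add: density_quantile_def \<mu>_def f_def)
  show ?thesis
  proof (cases "N = {#}")
    case True
    define U where "U = uniform_measure lborel {0..T}"
    have "1 \<le> cdf U T"
    proof -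
      have "{0..T} \<inter> {..T} = {0..T}" by auto
      then show ?thesis unfolding U_def cdf_def using T_pos
        by (simp add: measure_uniform_measure)
    qed
    then have "quantile_fun T U t \<in> {0..T}" using T_pos t by (intro quantile_fun_range) auto
    then have "\<bar>quantile_fun T U t - quantile_fun T \<mu> t\<bar> \<le> T"
      using shape_quantile_range[OF q t] by auto
    also have "T \<le> L * 2" using T_le_L L_pos by simp
    also have "\<dots> \<le> L * (2 * e / (a * \<tau>l) + T / (real k * M))"
    proof -
      have "1 \<le> e / (a * \<tau>l)" using eT True a\<tau> by (simp add: le_divide_eq)
      moreover have "0 \<le> T / (real k * M)" using T_pos M_pos by simp
      ultimately show ?thesis using L_pos by (intro mult_left_mono) auto
    qed
    finally show ?thesis using True by (simp add: empirical_quantile_def q_eq U_def \<tau>l_def)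
  next
    case False
    define \<mu>' where "\<mu>' = measure_pmf (pmf_of_multiset N)"
    have n: "0 < real (size N)" using False by (simp add: nonempty_has_size)
    have cdf': "cdf \<mu>' u = real (points_in N {0..u}) / real (size N)" if "u \<in> {0..T}" for u
    proof -
      have "points_in N {..u} = points_in N {0..u}" using N that unfolding points_in_def
        by (intro arg_cong[where f=size] filter_mset_cong) auto
      then show ?thesis by (simp add: \<mu>'_def cdf_pmf_of_multiset[OF False])
    qed
    have grid: "\<bar>cdf \<mu>' (real j * T / real k) - cdf \<mu> (real j * T / real k)\<bar> \<le> 2 * e / (a * \<tau>l)" if j: "j \<le> k" for j
    proof -
      define u where "u = real j * T / real k"
      have u: "u \<in> {0..T}" using j k T_pos by (auto simp: u_def field_simps)
      define x where "x = real (points_in N {0..u})"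
      define m where "m = real (size N)"
      define y where "y = (LINT t:{0..u}|lborel. l t)"
      have xm: "0 \<le> x" "x \<le> m" by (auto simp: x_def m_def points_in_def size_filter_mset_lesseq)
      have m: "0 < m" using n by (simp add: m_def)
      \<comment> \<open>Replaces the random total m by its mean a*\<tau>. The first term is the
        count error at u, the second the error of the total, damped by \<open>x / m \<le> 1\<close>;
        this is the origin of the factor 2.\<close>
      have "x / m - y / \<tau>l = (x - a * y) / (a * \<tau>l) + (x / m) * ((a * \<tau>l - m) / (a * \<tau>l))"
        using m a \<tau> unfolding \<tau>l_def by (simp add: field_simps)
      also have "\<bar>\<dots>\<bar> \<le> \<bar>(x - a * y) / (a * \<tau>l)\<bar> + \<bar>(x / m) * ((a * \<tau>l - m) / (a * \<tau>l))\<bar>"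
        by (rule abs_triangle_ineq)
      also have "\<dots> \<le> e / (a * \<tau>l) + 1 * (e / (a * \<tau>l))"
      proof (rule add_mono)
        show "\<bar>(x - a * y) / (a * \<tau>l)\<bar> \<le> e / (a * \<tau>l)"
          unfolding abs_divide abs_of_pos[OF a\<tau>] using e[OF j] a\<tau>
          by (intro divide_right_mono) (auto simp: x_def y_def u_def)
        have "\<bar>x / m\<bar> \<le> 1" using xm m by simp
        moreover have "\<bar>(a * \<tau>l - m) / (a * \<tau>l)\<bar> \<le> e / (a * \<tau>l)"
          unfolding abs_divide abs_of_pos[OF a\<tau>] using eT a\<tau>
          by (intro divide_right_mono) (auto simp: m_def)
        ultimately show "\<bar>(x / m) * ((a * \<tau>l - m) / (a * \<tau>l))\<bar> \<le> 1 * (e / (a * \<tau>l))"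
          unfolding abs_mult[of "x / m"] by (intro mult_mono) auto
      qed
      finally show ?thesis using cdf[OF u] cdf'[OF u] unfolding u_def[symmetric]
        by (simp add: x_def y_def m_def mult.commute)
    qed
    have "1 \<le> cdf \<mu>' T"
      using cdf'[of T] N T_pos n unfolding points_in_def
      by (metis (no_types, lifting) atLeastAtMost_iff divide_self_if filter_mset_cong filter_mset_True less_eq_real_def less_irrefl subset_eq)
    moreover have "\<bar>cdf \<mu>' u - cdf \<mu> u\<bar> \<le> 2 * e / (a * \<tau>l) + T / (real k * M)" if "u \<in> {0..T}" for u
      using cdf_measure_pmf_mono k grid that unfolding \<mu>'_def
      by (intro cdf_close_of_grid[OF \<mu> refl q]) auto
    ultimately have "\<bar>quantile_fun T \<mu>' t - quantile_fun T \<mu> t\<bar> \<le> L * (2 * e / (a * \<tau>l) + T / (real k * M))"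
      using t by (intro quantile_fun_close[OF \<mu> refl q]) auto
    then show ?thesis using False by (simp add: empirical_quantile_def q_eq \<mu>'_def \<tau>l_def)
  qed
qed

lemma bounded_fun_empirical_quantile:
  assumes "0 < T" "set_mset N \<subseteq> {0..T}"
  shows "bounded_fun (empirical_quantile T N)"
proof -
  define \<mu> where "\<mu> = (if N = {#} then uniform_measure lborel {0..T} else measure_pmf (pmf_of_multiset N))"
  have "1 \<le> cdf \<mu> T"
  proof (cases "N = {#}")
    case True
    have "{0..T} \<inter> {..T} = {0..T}" by auto
    then show ?thesis unfolding \<mu>_def cdf_def using True \<open>0 < T\<close>
      by (simp add: measure_uniform_measure)
  next
    case False
    have "points_in N {..T} = size N" unfolding points_in_def
      using assms(2) by (metis atLeastAtMost_iff atMost_iff filter_mset_True filter_mset_cong subset_eq)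
    then show ?thesis using False by (simp add: \<mu>_def cdf_pmf_of_multiset)
  qed
  then show ?thesis unfolding empirical_quantile_def \<mu>_def[symmetric]
    using assms by (intro bounded_fun_mono_on quantile_fun_mono) auto
qed

section \<open>Densities with a prescribed quantile function\<close>

context shape_space
begin

text \<open>The inverse of q is 1/M-Lipschitz, and Lipschitz maps send null sets to null sets; the
  preimage of A is the image of part of A under this inverse.\<close>

lemma shape_quantile_vimage_null:
  assumes q: "q \<in> shape_quantiles T M L" and A: "A \<in> null_sets lborel"
  shows "emeasure lborel {t \<in> {0..1}. q t \<in> A} = 0"
proof -
  define B where "B = {t \<in> {0..1}. q t \<in> A}"
  define p where "p = inv_into {0..1} q"
  have B: "B = p ` (q ` B)"
    using inv_into_image_cancel[OF shape_quantile_inj[OF q], of B] unfolding p_def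
    by (simp add: subset_eq) (simp add: B_def)
  have "negligible (p ` (q ` B))"
  proof (rule negligible_locally_Lipschitz_image)
    have "q ` B \<subseteq> A" by (auto simp: B_def)
    moreover have "negligible A" using A by (simp add: negligible_iff_null_sets null_sets_completionI)
    ultimately show "negligible (q ` B)" by (rule negligible_subset[rotated])
    fix u assume u: "u \<in> q ` B"
    have "norm (p v - p u) \<le> 1 / M * norm (v - u)" if v: "v \<in> q ` B" for v
    proof -
      obtain s t where "s \<in> {0..1}" "t \<in> {0..1}" "u = q s" "v = q t" using u v by (auto simp: B_def)
      then show ?thesis using shape_quantile_lower[OF q, of t s] shape_quantile_inj[OF q] M_pos
        by (simp add: p_def field_simps)
    qed
    then show "\<exists>T B'. open T \<and> u \<in> T \<and> (\<forall>v\<in>q ` B \<inter> T. norm (p v - p u) \<le> B' * norm (v - u))"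
      by (intro exI[of _ UNIV] exI[of _ "1 / M"]) auto
  qed simp
  then have "negligible B" using B by simp
  moreover have "B \<in> sets borel"
  proof -
    have "q -` A \<inter> space unit_lborel \<in> sets unit_lborel"
      using A by (intro measurable_sets[OF bounded_fun_measurable[OF bounded_fun_shape_quantile[OF q]]]) auto
    also have "q -` A \<inter> space unit_lborel = B" by (auto simp: B_def space_restrict_space)
    finally show ?thesis by (subst (asm) sets_restrict_space_iff) auto
  qed
  ultimately show ?thesis unfolding B_def[symmetric]
    by (simp add: negligible_iff_null_sets null_sets_def emeasure_completion)
qed

text \<open>The image of the uniform law under q is absolutely continuous by the preceding lemma,
  and its Radon-Nikodym derivative is the density. This guarantees that the choices in
  \<open>frechet_mean\<close> and \<open>density_estimator\<close> have candidates.\<close>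

lemma shape_quantile_density_exists:
  assumes q: "q \<in> shape_quantiles T M L"
  shows "\<exists>f. prob_density_on T f \<and> density_quantile T f = q"
proof -
  interpret U: prob_space unit_lborel by (rule prob_space_unit_lborel)
  have qm: "q \<in> borel_measurable unit_lborel" by (rule bounded_fun_measurable[OF bounded_fun_shape_quantile[OF q]])
  define \<mu> where "\<mu> = distr unit_lborel borel q"
  interpret \<mu>: prob_space \<mu> unfolding \<mu>_def by (rule U.prob_space_distr[OF qm])
  have vimage: "q -` A \<inter> space unit_lborel = {t \<in> {0..1}. q t \<in> A}" for A
    by (auto simp: space_restrict_space)
  have em: "emeasure \<mu> A = emeasure lborel {t \<in> {0..1}. q t \<in> A}" if "A \<in> sets borel" for A
  proof -
    have "emeasure \<mu> A = emeasure unit_lborel (q -` A \<inter> space unit_lborel)"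
      unfolding \<mu>_def using that by (rule emeasure_distr[OF qm])
    also have "\<dots> = emeasure lborel (q -` A \<inter> space unit_lborel)"
      by (rule emeasure_restrict_space) (auto simp: space_restrict_space)
    finally show ?thesis unfolding vimage .
  qed
  have "absolutely_continuous lborel \<mu>"
    unfolding absolutely_continuous_def
  proof
    fix A :: "real set" assume A: "A \<in> null_sets lborel"
    then show "A \<in> null_sets \<mu>" using em[of A] shape_quantile_vimage_null[OF q A] by (auto simp: \<mu>_def null_sets_def)
  qed
  then obtain r where r[measurable]: "r \<in> borel_measurable lborel" and r\<mu>: "density lborel r = \<mu>"
    using sigma_finite_measure.Radon_Nikodym[OF sigma_finite_lborel, of \<mu>] by (auto simp: \<mu>_def)
  define f where "f t = enn2real (r t)" for t
  have "(\<integral>\<^sup>+t. r t \<partial>lborel) = emeasure \<mu> (space \<mu>)"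
    unfolding r\<mu>[symmetric] by (simp add: emeasure_density)
  also have "\<dots> = 1" by (rule \<mu>.emeasure_space_1)
  finally have int_r: "(\<integral>\<^sup>+t. r t \<partial>lborel) = 1" .
  have fin: "AE t in lborel. r t \<noteq> \<infinity>"
    by (rule nn_integral_PInf_AE) (use int_r in auto)
  have out: "AE t in lborel. r t * indicator (- {0..T}) t = 0"
  proof -
    have "(\<integral>\<^sup>+t. r t * indicator (- {0..T}) t \<partial>lborel) = emeasure \<mu> (- {0..T})"
      unfolding r\<mu>[symmetric] by (subst emeasure_density) auto
    also have "\<dots> = 0"
    proof -
      have none: "{t \<in> {0..1}. q t \<in> - {0..T}} = {}" using shape_quantile_range[OF q] by auto
      show ?thesis using em[of "- {0..T}"] unfolding none by simp
    qed
    finally show ?thesis by (subst (asm) nn_integral_0_iff_AE) auto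
  qed
  \<comment> \<open>The derivative r can be infinite, or positive outside [0,T], only on null sets;
    off these it agrees with the real function f cut off to [0,T].\<close>
  have dens: "density_measure T f = \<mu>"
    unfolding r\<mu>[symmetric]
  proof (rule density_cong)
    show "AE t in lborel. ennreal (indicator {0..T} t * f t) = r t"
      using fin out
    proof eventually_elim
      case (elim t)
      then show ?case
        by (auto simp: indicator_def f_def less_top split: if_splits)
    qed
  qed (auto simp: f_def[abs_def])
  have "(\<integral>\<^sup>+t. ennreal (indicator {0..T} t * f t) \<partial>lborel) = emeasure (density_measure T f) UNIV"
    by (subst emeasure_density) (auto simp: f_def[abs_def])
  also have "\<dots> = 1" unfolding dens using \<mu>.emeasure_space_1 by (simp add: \<mu>_def)
  finally have int: "(\<integral>\<^sup>+t. ennreal (indicator {0..T} t * f t) \<partial>lborel) = 1" .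
  have hbi: "has_bochner_integral lborel (\<lambda>t. indicator {0..T} t * f t) 1"
    by (rule has_bochner_integral_nn_integral) (use int in \<open>auto simp: f_def[abs_def]\<close>)
  have pd: "prob_density_on T f"
    using hbi by (auto simp: prob_density_on_def set_integrable_def set_lebesgue_integral_def
        has_bochner_integral_iff f_def)
  have cdf: "t \<le> cdf \<mu> u \<longleftrightarrow> q t \<le> u" if t: "t \<in> {0..1}" and u: "u \<in> {0..T}" for t u
  proof -
    obtain s where s: "s \<in> {0..1}" "q s = u" using shape_quantile_surj[OF q u] .
    have eq: "{x \<in> {0..1}. q x \<in> {..u}} = {0..s}"
      using shape_quantile_le_iff[OF q _ s(1)] s by auto
    have "cdf \<mu> u = s" using em[of "{..u}"] eq s by (simp add: cdf_def measure_def)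
    then show ?thesis using shape_quantile_le_iff[OF q t s(1)] s by simp
  qed
  have "density_quantile T f = q"
  proof (rule extensionalityI[OF _ shape_quantile_ext[OF q]])
    show "density_quantile T f \<in> extensional {0..1}"
      unfolding density_quantile_def by (rule quantile_fun_extensional)
    fix t :: real assume t: "t \<in> {0..1}"
    have "{u \<in> {0..T}. t \<le> cdf \<mu> u} = {q t..T}" using cdf[OF t] shape_quantile_range[OF q t] by auto
    then show "density_quantile T f t = q t"
      using t shape_quantile_range[OF q t] unfolding density_quantile_def dens quantile_fun_def by simp
  qed
  with pd show ?thesis by blast
qed

section \<open>Evaluation of quantile functions on the shape space\<close>

abbreviation shapes :: "(real \<Rightarrow> real) set" where
  "shapes \<equiv> shape_densities T M L"

lemma density_quantile_shape: "f \<in> shapes \<Longrightarrow> density_quantile T f \<in> shape_quantiles T M L"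
  by (simp add: shape_densities_def)

lemma density_quantile_range: "f \<in> shapes \<Longrightarrow> t \<in> {0..1} \<Longrightarrow> density_quantile T f t \<in> {0..T}"
  by (rule shape_quantile_range[OF density_quantile_shape])

lemma space_shape_borel: "space (shape_borel T M L) = shapes"
  unfolding shape_borel_def by (rule space_measure_of) (auto simp: shape_open_def)

lemma shape_open_sets: "shape_open T M L U \<Longrightarrow> U \<in> sets (shape_borel T M L)"
  unfolding shape_borel_def by (subst sets_measure_of) (auto simp: shape_open_def)

text \<open>Evaluation at a point is continuous although the metric is an integral: the radius is
  the cubic bound \<open>L2_dist_controls_pointwise\<close> solved for the distance.\<close>

lemma shape_dist_pointwise_less:
  assumes f: "f \<in> shapes" and t: "t \<in> {0..1}" and e: "0 < e"
  shows "\<exists>d>0. \<forall>g\<in>shapes. shape_dist T f g < d \<longrightarrow> \<bar>density_quantile T f t - density_quantile T g t\<bar> < e"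
proof (intro exI[of _ "sqrt (e ^ 3 / (16 * L))"] conjI ballI impI)
  show "0 < sqrt (e ^ 3 / (16 * L))" using e L_pos by simp
  fix g assume g: "g \<in> shapes" and d: "shape_dist T f g < sqrt (e ^ 3 / (16 * L))"
  have "(shape_dist T f g)\<^sup>2 < (sqrt (e ^ 3 / (16 * L)))\<^sup>2"
    using d by (intro power_strict_mono) (auto simp: shape_dist_def L2_dist_nonneg)
  then have "16 * L * (shape_dist T f g)\<^sup>2 < e ^ 3" using e L_pos by (simp add: field_simps)
  then have "\<bar>density_quantile T f t - density_quantile T g t\<bar> ^ 3 < e ^ 3"
    using L2_dist_controls_pointwise[OF density_quantile_shape[OF f] density_quantile_shape[OF g] t]
    unfolding shape_dist_def by linarith
  then show "\<bar>density_quantile T f t - density_quantile T g t\<bar> < e"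
    using e by (simp add: power_less_imp_less_base)
qed

text \<open>Besides giving measurability of evaluation, these are the open sets on which the
  continuity of the conditional law is used.\<close>

lemma shape_open_quantile:
  assumes t: "t \<in> {0..1}" and V: "open V"
  shows "shape_open T M L {f \<in> shapes. density_quantile T f t \<in> V}"
  unfolding shape_open_def
proof (intro conjI ballI)
  fix f assume f: "f \<in> {f \<in> shapes. density_quantile T f t \<in> V}"
  then have "density_quantile T f t \<in> V" by simp
  then obtain e where e: "0 < e" "\<And>y. \<bar>y - density_quantile T f t\<bar> < e \<Longrightarrow> y \<in> V"
    using V unfolding open_dist dist_real_def by meson
  obtain d where d: "0 < d" "\<And>g. g \<in> shapes \<Longrightarrow> shape_dist T f g < d \<Longrightarrow>
      \<bar>density_quantile T f t - density_quantile T g t\<bar> < e"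
    using shape_dist_pointwise_less[of f t e] f t e by blast
  then show "\<exists>d>0. \<forall>g\<in>shapes. shape_dist T f g < d \<longrightarrow> g \<in> {f \<in> shapes. density_quantile T f t \<in> V}"
    by (intro exI[of _ d] conjI ballI impI CollectI e(2)) (simp_all add: abs_minus_commute)
qed auto

lemma density_quantile_measurable:
  assumes t: "t \<in> {0..1}"
  shows "(\<lambda>f. density_quantile T f t) \<in> borel_measurable (shape_borel T M L)"
proof (rule borel_measurableI)
  fix V :: "real set" assume "open V"
  then have "{f \<in> shapes. density_quantile T f t \<in> V} \<in> sets (shape_borel T M L)"
    by (intro shape_open_sets shape_open_quantile t)
  then show "(\<lambda>f. density_quantile T f t) -` V \<inter> space (shape_borel T M L) \<in> sets (shape_borel T M L)"
    by (simp add: space_shape_borel vimage_def Int_def conj_commute)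
qed

end

section \<open>Measurability in two variables\<close>

text \<open>Rounding the real argument down to a multiple of 1/(k+1) leaves countably many values,
  where measurability in w suffices; continuity gives the limit.\<close>

lemma borel_measurable_caratheodory:
  fixes F :: "'a \<Rightarrow> real \<Rightarrow> real"
  assumes meas: "\<And>t. (\<lambda>w. F w t) \<in> borel_measurable N"
    and cont: "\<And>w. w \<in> space N \<Longrightarrow> continuous_on UNIV (F w)"
  shows "(\<lambda>p. F (fst p) (snd p)) \<in> borel_measurable (N \<Otimes>\<^sub>M borel)"
proof (rule borel_measurable_LIMSEQ_real)
  fix k :: nat
  show "(\<lambda>p. F (fst p) (real_of_int \<lfloor>snd p * (real k + 1)\<rfloor> / (real k + 1))) \<in> borel_measurable (N \<Otimes>\<^sub>M borel)"
  proof (rule measurable_compose_countable[where f="\<lambda>i p. F (fst p) (real_of_int i / (real k + 1))"])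
    show "(\<lambda>p. F (fst p) (real_of_int i / (real k + 1))) \<in> borel_measurable (N \<Otimes>\<^sub>M borel)" for i
      by (rule measurable_compose[OF measurable_fst meas])
    show "(\<lambda>p. \<lfloor>snd p * (real k + 1)\<rfloor>) \<in> N \<Otimes>\<^sub>M borel \<rightarrow>\<^sub>M count_space UNIV"
      by measurable
  qed
next
  fix p assume "p \<in> space (N \<Otimes>\<^sub>M (borel :: real measure))"
  then have w: "fst p \<in> space N" by (auto simp: space_pair_measure)
  define t where "t = snd p"
  have "(\<lambda>k. real_of_int \<lfloor>t * (real k + 1)\<rfloor> / (real k + 1)) \<longlonglongrightarrow> t"
  proof (rule tendsto_sandwich)
    show "(\<lambda>k. t - 1 / (real k + 1)) \<longlonglongrightarrow> t"
      using tendsto_diff[OF tendsto_const LIMSEQ_inverse_real_of_nat, of t]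
      by (simp add: inverse_eq_divide add.commute)
    show "\<forall>\<^sub>F k in sequentially. t - 1 / (real k + 1) \<le> real_of_int \<lfloor>t * (real k + 1)\<rfloor> / (real k + 1)"
    proof (intro always_eventually allI)
      fix k :: nat
      have "t * (real k + 1) - 1 \<le> real_of_int \<lfloor>t * (real k + 1)\<rfloor>" by linarith
      then have "(t * (real k + 1) - 1) / (real k + 1) \<le> real_of_int \<lfloor>t * (real k + 1)\<rfloor> / (real k + 1)"
        by (rule divide_right_mono) simp
      then show "t - 1 / (real k + 1) \<le> real_of_int \<lfloor>t * (real k + 1)\<rfloor> / (real k + 1)"
        by (simp add: diff_divide_distrib)
    qed
    show "\<forall>\<^sub>F k in sequentially. real_of_int \<lfloor>t * (real k + 1)\<rfloor> / (real k + 1) \<le> t"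
      by (intro always_eventually allI) (simp add: divide_le_eq)
  qed simp
  then show "(\<lambda>k. F (fst p) (real_of_int \<lfloor>snd p * (real k + 1)\<rfloor> / (real k + 1))) \<longlonglongrightarrow> F (fst p) (snd p)"
    unfolding t_def by (rule continuous_on_tendsto_compose[OF cont[OF w]]) auto
qed

text \<open>Extends continuous functions on [0,1] continuously to the whole line, as the preceding
  lemma requires.\<close>

definition clamp01 :: "real \<Rightarrow> real" where "clamp01 t = max 0 (min 1 t)"

lemma clamp01_mem: "clamp01 t \<in> {0..1}" and clamp01_id: "t \<in> {0..1} \<Longrightarrow> clamp01 t = t"
  and continuous_clamp01: "continuous_on A clamp01"
  unfolding clamp01_def by (auto intro!: continuous_intros)

section \<open>Frechet means\<close>

locale shape_law = shape_space +
  fixes \<nu> :: "(real \<Rightarrow> real) measure"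
  assumes prob_\<nu>: "prob_space \<nu>" and sets_\<nu>: "sets \<nu> = sets (shape_borel T M L)"
begin

sublocale \<nu>: prob_space \<nu> by (rule prob_\<nu>)

lemma space_\<nu>: "space \<nu> = shapes"
  using sets_eq_imp_space_eq[OF sets_\<nu>] by (simp add: space_shape_borel)

lemma quantile_measurable_\<nu>: "t \<in> {0..1} \<Longrightarrow> (\<lambda>f. density_quantile T f t) \<in> borel_measurable \<nu>"
  using density_quantile_measurable by (simp cong: measurable_cong_sets add: sets_\<nu>)

definition mean_quantile :: "real \<Rightarrow> real" where
  "mean_quantile = (\<lambda>t\<in>{0..1}. LINT f|\<nu>. density_quantile T f t)"

lemma integrable_quantile: "t \<in> {0..1} \<Longrightarrow> integrable \<nu> (\<lambda>f. density_quantile T f t)"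
  using density_quantile_range
  by (intro \<nu>.integrable_const_bound[where B=T] quantile_measurable_\<nu> AE_I2) (auto simp: space_\<nu>)

text \<open>The constraints are linear in q, hence preserved by averaging; the shape space is convex
  in quantile coordinates, so the Frechet mean becomes an ordinary mean.\<close>

lemma mean_quantile_shape: "mean_quantile \<in> shape_quantiles T M L"
proof (rule shape_quantileI)
  show "mean_quantile 0 = 0"
  proof -
    have "(LINT f|\<nu>. density_quantile T f 0) = (LINT f|\<nu>. 0)"
      using shape_quantile_0[OF density_quantile_shape] by (intro Bochner_Integration.integral_cong) (auto simp: space_\<nu>)
    then show ?thesis by (simp add: mean_quantile_def)
  qed
  show "mean_quantile 1 = T"
  proof -
    have "(LINT f|\<nu>. density_quantile T f 1) = (LINT f|\<nu>. T)"
      using shape_quantile_1[OF density_quantile_shape] by (intro Bochner_Integration.integral_cong) (auto simp: space_\<nu>)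
    then show ?thesis by (simp add: mean_quantile_def \<nu>.prob_space)
  qed
  fix s t :: real assume st: "0 \<le> s" "s \<le> t" "t \<le> 1"
  then have "mean_quantile t - mean_quantile s = (LINT f|\<nu>. density_quantile T f t - density_quantile T f s)"
    unfolding mean_quantile_def by (subst Bochner_Integration.integral_diff) (auto intro!: integrable_quantile)
  moreover have "(LINT f|\<nu>. M * (t - s)) \<le> (LINT f|\<nu>. density_quantile T f t - density_quantile T f s)"
    using st shape_quantile_incr[OF density_quantile_shape st]
    by (intro integral_mono) (auto intro!: integrable_quantile Bochner_Integration.integrable_diff simp: space_\<nu>)
  moreover have "(LINT f|\<nu>. density_quantile T f t - density_quantile T f s) \<le> (LINT f|\<nu>. L * (t - s))"
    using st shape_quantile_incr[OF density_quantile_shape st]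
    by (intro integral_mono) (auto intro!: integrable_quantile Bochner_Integration.integrable_diff simp: space_\<nu>)
  ultimately show "M * (t - s) \<le> mean_quantile t - mean_quantile s \<and> mean_quantile t - mean_quantile s \<le> L * (t - s)"
    by (simp add: \<nu>.prob_space)
qed (simp add: mean_quantile_def)

text \<open>
  The bias-variance decomposition makes the objective differ from the squared distance to the
  mean quantile function by a constant.
\<close>

lemma frechet_objective:
  assumes q: "q \<in> shape_quantiles T M L"
  shows "(LINT f|\<nu>. (L2_dist (density_quantile T f) q)\<^sup>2) =
    (LINT t|unit_lborel. (LINT f|\<nu>. (density_quantile T f t)\<^sup>2) - (mean_quantile t)\<^sup>2) +
    (L2_dist mean_quantile q)\<^sup>2"
proof -
  interpret U: prob_space unit_lborel by (rule prob_space_unit_lborel)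
  interpret pair_sigma_finite \<nu> unit_lborel ..
  interpret P: pair_prob_space \<nu> unit_lborel ..
  define D where "D f t = (density_quantile T f (clamp01 t) - q (clamp01 t))\<^sup>2" for f t
  have comp: "continuous_on UNIV (\<lambda>t. p (clamp01 t))" if "p \<in> shape_quantiles T M L" for p
    by (rule continuous_on_compose2[OF shape_quantile_continuous[OF that] continuous_clamp01])
       (auto simp: clamp01_mem[simplified])
  have "(\<lambda>p. D (fst p) (snd p)) \<in> borel_measurable (\<nu> \<Otimes>\<^sub>M borel)"
    unfolding D_def
    by (intro borel_measurable_caratheodory[where F="\<lambda>f t. (density_quantile T f (clamp01 t) - q (clamp01 t))\<^sup>2"]
        borel_measurable_power borel_measurable_diff quantile_measurable_\<nu> clamp01_mem continuous_on_power
        continuous_on_diff comp density_quantile_shape q)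
       (auto simp: space_\<nu>)
  then have meas: "case_prod D \<in> borel_measurable (\<nu> \<Otimes>\<^sub>M unit_lborel)"
  proof -
    have "(\<lambda>p. (fst p, snd p)) \<in> \<nu> \<Otimes>\<^sub>M unit_lborel \<rightarrow>\<^sub>M \<nu> \<Otimes>\<^sub>M borel"
      by (intro measurable_Pair measurable_fst measurable_compose[OF measurable_snd] measurable_restrict_space1) simp
    then show ?thesis
      using \<open>(\<lambda>p. D (fst p) (snd p)) \<in> _\<close> by (simp add: split_beta' measurable_compose[of "\<lambda>p. (fst p, snd p)"])
  qed
  have bound: "\<bar>D f t\<bar> \<le> T\<^sup>2" if "f \<in> space \<nu>" for f t
  proof -
    have "\<bar>density_quantile T f (clamp01 t) - q (clamp01 t)\<bar> \<le> T"
      using density_quantile_range[OF that[unfolded space_\<nu>] clamp01_mem, of t] shape_quantile_range[OF q clamp01_mem, of t] by auto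
    then show ?thesis using power_mono[of "\<bar>density_quantile T f (clamp01 t) - q (clamp01 t)\<bar>" T 2]
      by (simp add: D_def)
  qed
  have int: "integrable (\<nu> \<Otimes>\<^sub>M unit_lborel) (case_prod D)"
    using bound by (intro P.P.integrable_const_bound[where B="T\<^sup>2"] AE_I2 meas) (auto simp: space_pair_measure)
  have "(LINT f|\<nu>. (L2_dist (density_quantile T f) q)\<^sup>2) = (LINT f|\<nu>. LINT t|unit_lborel. D f t)"
    unfolding L2_dist_sq D_def
    by (intro Bochner_Integration.integral_cong) (auto simp: space_restrict_space clamp01_id)
  also have "\<dots> = (LINT t|unit_lborel. LINT f|\<nu>. D f t)" by (rule Fubini_integral[OF int, symmetric])
  also have "\<dots> = (LINT t|unit_lborel. ((LINT f|\<nu>. (density_quantile T f t)\<^sup>2) - (mean_quantile t)\<^sup>2) +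
                                     (mean_quantile t - q t)\<^sup>2)"
  proof (rule Bochner_Integration.integral_cong)
    fix t assume "t \<in> space unit_lborel"
    then have t: "t \<in> {0..1}" by (simp add: space_restrict_space)
    have i2: "integrable \<nu> (\<lambda>f. (density_quantile T f t)\<^sup>2)"
    proof (intro \<nu>.integrable_const_bound[where B="T\<^sup>2"] AE_I2 borel_measurable_power quantile_measurable_\<nu> t)
      fix f assume "f \<in> space \<nu>"
      then show "norm ((density_quantile T f t)\<^sup>2) \<le> T\<^sup>2"
        using density_quantile_range[OF _ t, of f] by (auto simp: space_\<nu> intro: power_mono)
    qed
    have "(LINT f|\<nu>. D f t) = (LINT f|\<nu>. ((density_quantile T f t)\<^sup>2 - 2 * q t * density_quantile T f t) + (q t)\<^sup>2)"
      using t by (simp add: D_def clamp01_id power2_diff algebra_simps)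
    also have "\<dots> = (LINT f|\<nu>. (density_quantile T f t)\<^sup>2) - 2 * q t * mean_quantile t + (q t)\<^sup>2"
      using i2 integrable_quantile[OF t] t
      by (simp add: Bochner_Integration.integral_diff Bochner_Integration.integral_add \<nu>.prob_space mean_quantile_def)
    finally show "(LINT f|\<nu>. D f t) = ((LINT f|\<nu>. (density_quantile T f t)\<^sup>2) - (mean_quantile t)\<^sup>2) +
                                     (mean_quantile t - q t)\<^sup>2"
      by (simp add: power2_eq_square algebra_simps)
  qed simp
  also have "\<dots> = (LINT t|unit_lborel. (LINT f|\<nu>. (density_quantile T f t)\<^sup>2) - (mean_quantile t)\<^sup>2) +
    (L2_dist mean_quantile q)\<^sup>2"
  proof (subst Bochner_Integration.integral_add)
    \<comment> \<open>Measurability in t of the second moment comes from monotonicity, since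
      quantile functions are nonnegative and increasing.\<close>
    have mono: "mono_on {0..1} (\<lambda>t. LINT f|\<nu>. (density_quantile T f t)\<^sup>2)"
    proof (rule mono_onI)
      fix s t :: real assume st: "s \<in> {0..1}" "t \<in> {0..1}" "s \<le> t"
      have i: "integrable \<nu> (\<lambda>f. (density_quantile T f t)\<^sup>2)" if t: "t \<in> {0..1}" for t
      proof (intro \<nu>.integrable_const_bound[where B="T\<^sup>2"] AE_I2 borel_measurable_power quantile_measurable_\<nu> t)
        fix f assume "f \<in> space \<nu>"
        then show "norm ((density_quantile T f t)\<^sup>2) \<le> T\<^sup>2"
          using density_quantile_range[OF _ t, of f] by (auto simp: space_\<nu> intro: power_mono)
      qed
      show "(LINT f|\<nu>. (density_quantile T f s)\<^sup>2) \<le> (LINT f|\<nu>. (density_quantile T f t)\<^sup>2)"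
        using st density_quantile_range shape_quantile_le_iff[OF density_quantile_shape]
        by (intro integral_mono i power_mono) (auto simp: space_\<nu>)
    qed
    show "integrable unit_lborel (\<lambda>t. (LINT f|\<nu>. (density_quantile T f t)\<^sup>2) - (mean_quantile t)\<^sup>2)"
      by (intro bounded_fun_integrable bounded_fun_intros bounded_fun_mono_on[OF mono] bounded_fun_shape_quantile[OF mean_quantile_shape])
    show "integrable unit_lborel (\<lambda>t. (mean_quantile t - q t)\<^sup>2)"
      by (intro bounded_fun_integrable bounded_fun_intros bounded_fun_shape_quantile[OF mean_quantile_shape] bounded_fun_shape_quantile[OF q])
  qed (simp add: L2_dist_sq)
  finally show ?thesis .
qed

text \<open>By \<open>frechet_objective\<close> the objective is a constant plus the squared
  distance to the mean quantile function, and some shape has exactly this quantile function. So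
  minimisers exist, the arg min is a genuine one, and its distance to the mean is zero.\<close>

lemma
  shows frechet_mean_mem: "frechet_mean T M L \<nu> \<in> shapes"
    and frechet_mean_quantile: "L2_dist mean_quantile (density_quantile T (frechet_mean T M L \<nu>)) = 0"
proof -
  define J where "J f0 = (LINT f|\<nu>. (shape_dist T f f0)\<^sup>2)" for f0
  define V where "V = (LINT t|unit_lborel. (LINT f|\<nu>. (density_quantile T f t)\<^sup>2) - (mean_quantile t)\<^sup>2)"
  have J: "J f0 = V + (L2_dist mean_quantile (density_quantile T f0))\<^sup>2" if "f0 \<in> shapes" for f0
    unfolding J_def shape_dist_def V_def by (rule frechet_objective[OF density_quantile_shape[OF that]])
  obtain g where g: "prob_density_on T g" "density_quantile T g = mean_quantile"
    using shape_quantile_density_exists[OF mean_quantile_shape] by blast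
  have gS: "g \<in> shapes" using g mean_quantile_shape by (simp add: shape_densities_def)
  have Jg: "J g = V" using J[OF gS] g(2) by (simp add: L2_dist_eq)
  define f where "f = frechet_mean T M L \<nu>"
  have "is_arg_min J (\<lambda>x. x \<in> shapes) f"
    unfolding f_def frechet_mean_def arg_min_on_def arg_min_def J_def[symmetric]
    by (rule someI[of _ g]) (use gS Jg J in \<open>auto simp: is_arg_min_linorder\<close>)
  then have f: "f \<in> shapes" "J f \<le> J g" using gS by (auto simp: is_arg_min_linorder)
  then show "frechet_mean T M L \<nu> \<in> shapes" by (simp add: f_def)
  have "(L2_dist mean_quantile (density_quantile T f))\<^sup>2 \<le> 0" using f J[OF f(1)] Jg by simp
  then show "L2_dist mean_quantile (density_quantile T (frechet_mean T M L \<nu>)) = 0" by (simp add: f_def)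
qed

end

text \<open>
  The distribution functions of the quantiles at \<open>t\<close> converge everywhere, hence so do the means.
\<close>

lemma (in shape_space) continuous_mean_quantile:
  assumes \<nu>: "\<And>u. prob_space (\<nu> u)" "\<And>u. sets (\<nu> u) = sets (shape_borel T M L)"
    and cont: "\<And>U. shape_open T M L U \<Longrightarrow> continuous_on UNIV (\<lambda>u. measure (\<nu> u) U)"
    and t: "t \<in> {0..1}"
  shows "continuous_on UNIV (\<lambda>u::real. LINT f|\<nu> u. density_quantile T f t)"
proof -
  have law: "shape_law T M L (\<nu> u)" for u
    using \<nu> shape_space_axioms by (simp add: shape_law_def shape_law_axioms_def)
  note meas = shape_law.quantile_measurable_\<nu>[OF law t]
  define D where "D u = distr (\<nu> u) borel (\<lambda>f. density_quantile T f t)" for u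
  have D: "real_distribution (D u)" for u
    unfolding D_def using prob_space.real_distribution_distr[OF \<nu>(1) meas] by simp
  \<comment> \<open>The event of a quantile above c is open, so continuity of the law on open sets
    gives convergence of the distribution functions at every c.\<close>
  have cdfD: "cdf (D u) c = 1 - measure (\<nu> u) {f \<in> shapes. density_quantile T f t \<in> {c<..}}" for u c
  proof -
    interpret prob_space "\<nu> u" by (rule \<nu>)
    have sp: "space (\<nu> u) = shapes" by (rule shape_law.space_\<nu>[OF law])
    have "{f \<in> shapes. density_quantile T f t \<in> {c<..}} \<in> sets (\<nu> u)"
      using measurable_sets[OF meas, of "{c<..}" u] by (simp add: sp vimage_def Int_def conj_commute)
    moreover have "space (\<nu> u) - {f \<in> shapes. density_quantile T f t \<in> {c<..}} =
      (\<lambda>f. density_quantile T f t) -` {..c} \<inter> space (\<nu> u)" by (auto simp: sp)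
    ultimately show ?thesis unfolding D_def cdf_def
      by (subst measure_distr[OF meas]) (auto simp: prob_compl[symmetric])
  qed
  \<comment> \<open>Truncation to [0,T] changes nothing on the range of the quantiles and makes the
    integrand bounded and continuous, as weak convergence demands.\<close>
  have mean: "(LINT f|\<nu> u. density_quantile T f t) = (LINT y|D u. max 0 (min T y))" for u
    unfolding D_def using density_quantile_range[OF _ t]
    by (subst integral_distr[OF meas])
       (auto intro!: Bochner_Integration.integral_cong simp: shape_law.space_\<nu>[OF law])
  show ?thesis
    unfolding continuous_on_sequentially
  proof (intro allI ballI impI)
    fix S :: "nat \<Rightarrow> real" and u assume "(\<forall>n. S n \<in> UNIV) \<and> S \<longlonglongrightarrow> u"
    then have S: "S \<longlonglongrightarrow> u" by simp
    have "weak_conv_m (\<lambda>n. D (S n)) (D u)"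
      unfolding weak_conv_m_def weak_conv_def cdfD
      by (intro allI impI tendsto_intros continuous_on_tendsto_compose[OF cont S] shape_open_quantile t) auto
    then have "(\<lambda>n. LINT y|D (S n). max 0 (min T y)) \<longlonglongrightarrow> (LINT y|D u. max 0 (min T y))"
      by (rule weak_conv_imp_integral_bdd_continuous_conv[OF D D, where B=T])
         (use T_pos in \<open>auto intro!: continuous_intros\<close>)
    then show "((\<lambda>u. LINT f|\<nu> u. density_quantile T f t) \<circ> S) \<longlonglongrightarrow> (LINT f|\<nu> u. density_quantile T f t)"
      unfolding mean by (simp add: o_def)
  qed
qed

lemma (in finite_measure) integrable_bounded_mult:
  fixes f g :: "'a \<Rightarrow> real"
  assumes [measurable]: "f \<in> borel_measurable M" "g \<in> borel_measurable M"
    and le: "\<And>w. w \<in> space M \<Longrightarrow> \<bar>f w\<bar> \<le> a" "\<And>w. w \<in> space M \<Longrightarrow> \<bar>g w\<bar> \<le> b"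
  shows "integrable M (\<lambda>w. f w * g w)"
proof (intro integrable_const_bound[where B="\<bar>a\<bar> * \<bar>b\<bar>"] AE_I2)
  fix w assume "w \<in> space M"
  then show "norm (f w * g w) \<le> \<bar>a\<bar> * \<bar>b\<bar>"
    using le[of w] unfolding real_norm_def abs_mult by (intro mult_mono) auto
qed measurable

section \<open>Integration against a regular conditional distribution\<close>

context
  fixes P :: "'w measure" and S :: "'s measure" and X N and Y :: "'w \<Rightarrow> 'y" and \<nu>
  assumes P: "prob_space P" and rcd: "regular_cond_distr P S X N Y \<nu>"
begin

interpretation prob_space P by (rule P)

lemma rcd_measurable[measurable]:
  "X \<in> P \<rightarrow>\<^sub>M S" "Y \<in> P \<rightarrow>\<^sub>M N" "\<nu> \<in> S \<rightarrow>\<^sub>M subprob_algebra N"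
  using rcd by (auto simp: regular_cond_distr_def intro: measurable_prob_algebraD)

lemma rcd_space: assumes "u \<in> space S" shows "prob_space (\<nu> u)" "sets (\<nu> u) = sets N" "space (\<nu> u) = space N"
proof -
  have "\<nu> u \<in> space (prob_algebra N)"
    using rcd assms by (auto simp: regular_cond_distr_def dest: measurable_space)
  then show "prob_space (\<nu> u)" "sets (\<nu> u) = sets N" "space (\<nu> u) = space N"
    by (auto simp: space_prob_algebra dest: sets_eq_imp_space_eq)
qed

lemma rcd_X_space: "w \<in> space P \<Longrightarrow> X w \<in> space S" and rcd_Y_space: "w \<in> space P \<Longrightarrow> Y w \<in> space N"
  by (blast intro: measurable_space rcd_measurable(1) rcd_measurable(2))+

lemma rcd_measurable_emeasure[measurable]:
  "B \<in> sets N \<Longrightarrow> (\<lambda>w. emeasure (\<nu> (X w)) B) \<in> borel_measurable P"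
  by (rule measurable_compose[OF measurable_compose[OF rcd_measurable(1) rcd_measurable(3)]
        measurable_emeasure_subprob_algebra])

lemma rcd_rectangle:
  assumes [measurable]: "A \<in> sets S" "B \<in> sets N"
  shows "emeasure P {w \<in> space P. X w \<in> A \<and> Y w \<in> B} = (\<integral>\<^sup>+w. indicator A (X w) * emeasure (\<nu> (X w)) B \<partial>P)"
proof -
  have m[measurable]: "(\<lambda>w. measure (\<nu> (X w)) B) \<in> borel_measurable P"
    unfolding measure_def by measurable
  have le: "measure (\<nu> (X w)) B \<le> 1" if "w \<in> space P" for w
    using rcd_space(1)[OF rcd_X_space[OF that]] by (rule prob_space.prob_le_1)
  have "measure P {w \<in> space P. X w \<in> A \<and> Y w \<in> B} = (LINT w|P. indicator A (X w) * measure (\<nu> (X w)) B)"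
    using rcd assms unfolding regular_cond_distr_def by auto
  then have "emeasure P {w \<in> space P. X w \<in> A \<and> Y w \<in> B} = ennreal (LINT w|P. indicator A (X w) * measure (\<nu> (X w)) B)"
    by (simp add: emeasure_eq_measure)
  also have "\<dots> = (\<integral>\<^sup>+w. ennreal (indicator A (X w) * measure (\<nu> (X w)) B) \<partial>P)"
    by (intro nn_integral_eq_integral[symmetric] integrable_const_bound[where B=1] AE_I2)
       (auto simp: indicator_def le)
  also have "\<dots> = (\<integral>\<^sup>+w. indicator A (X w) * emeasure (\<nu> (X w)) B \<partial>P)"
  proof (rule nn_integral_cong)
    fix w assume "w \<in> space P"
    then interpret Q: prob_space "\<nu> (X w)" by (intro rcd_space(1) rcd_X_space)
    show "ennreal (indicator A (X w) * measure (\<nu> (X w)) B) = indicator A (X w) * emeasure (\<nu> (X w)) B"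
      by (auto simp: indicator_def Q.emeasure_eq_measure)
  qed
  finally show ?thesis .
qed

text \<open>The formula for rectangles is extended one factor at a time. For fixed A, the law of Y
  on the event X in A equals a mixture of the \<open>\<nu> (X w)\<close>, which allows any \<psi>.
  For fixed \<psi>, two measures on the covariate space then agree on every A, which allows any
  \<phi>.\<close>

lemma rcd_nn_integral:
  assumes [measurable]: "\<phi> \<in> borel_measurable S" "\<psi> \<in> borel_measurable N"
  shows "(\<integral>\<^sup>+w. \<phi> (X w) * \<psi> (Y w) \<partial>P) = (\<integral>\<^sup>+w. \<phi> (X w) * (\<integral>\<^sup>+y. \<psi> y \<partial>\<nu> (X w)) \<partial>P)"
proof -
  have [measurable]: "(\<lambda>w. \<nu> (X w)) \<in> P \<rightarrow>\<^sub>M subprob_algebra N" by measurable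
  have int[measurable]: "(\<lambda>w. \<integral>\<^sup>+y. \<psi> y \<partial>\<nu> (X w)) \<in> borel_measurable P"
    by (rule measurable_compose[OF _ nn_integral_measurable_subprob_algebra]) measurable
  have step: "(\<integral>\<^sup>+w. indicator A (X w) * \<psi> (Y w) \<partial>P) = (\<integral>\<^sup>+w. indicator A (X w) * (\<integral>\<^sup>+y. \<psi> y \<partial>\<nu> (X w)) \<partial>P)"
    if [measurable]: "A \<in> sets S" for A
  proof -
    \<comment> \<open>R is P restricted to the event that X lies in A.\<close>
    define R where "R = density P (\<lambda>w. indicator A (X w) :: ennreal)"
    have ne: "space R \<noteq> {}" using not_empty by (simp add: R_def)
    have [measurable_cong]: "sets R = sets P" by (simp add: R_def)
    have "distr R N Y = R \<bind> (\<lambda>w. \<nu> (X w))"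
    proof (rule measure_eqI)
      show "sets (distr R N Y) = sets (R \<bind> (\<lambda>w. \<nu> (X w)))"
        by (subst sets_bind[where N=N]) (use ne rcd_space rcd_X_space in \<open>auto simp: R_def\<close>)
      fix B assume "B \<in> sets (distr R N Y)"
      then have [measurable]: "B \<in> sets N" by simp
      have "emeasure (distr R N Y) B = emeasure R (Y -` B \<inter> space P)"
        by (subst emeasure_distr) (auto simp: R_def)
      also have "\<dots> = (\<integral>\<^sup>+w. indicator {w \<in> space P. X w \<in> A \<and> Y w \<in> B} w \<partial>P)"
      proof -
        have "emeasure R (Y -` B \<inter> space P) = (\<integral>\<^sup>+w. indicator A (X w) * indicator (Y -` B \<inter> space P) w \<partial>P)"
          unfolding R_def by (rule emeasure_density) measurable
        also have "\<dots> = (\<integral>\<^sup>+w. indicator {w \<in> space P. X w \<in> A \<and> Y w \<in> B} w \<partial>P)"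
          by (intro nn_integral_cong) (simp add: indicator_def)
        finally show ?thesis .
      qed
      also have "\<dots> = emeasure P {w \<in> space P. X w \<in> A \<and> Y w \<in> B}"
        by (rule nn_integral_indicator) measurable
      also have "\<dots> = (\<integral>\<^sup>+w. indicator A (X w) * emeasure (\<nu> (X w)) B \<partial>P)"
        by (rule rcd_rectangle) measurable
      also have "\<dots> = (\<integral>\<^sup>+w. emeasure (\<nu> (X w)) B \<partial>R)"
        unfolding R_def by (subst nn_integral_density) auto
      also have "\<dots> = emeasure (R \<bind> (\<lambda>w. \<nu> (X w))) B"
        by (rule emeasure_bind[OF ne, symmetric, where N=N]) measurable
      finally show "emeasure (distr R N Y) B = emeasure (R \<bind> (\<lambda>w. \<nu> (X w))) B" .
    qed
    then have "(\<integral>\<^sup>+y. \<psi> y \<partial>distr R N Y) = (\<integral>\<^sup>+w. \<integral>\<^sup>+y. \<psi> y \<partial>\<nu> (X w) \<partial>R)"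
      by (subst nn_integral_bind[symmetric, where B=N]) auto
    then show ?thesis
      by (subst (asm) nn_integral_distr) (auto simp: R_def nn_integral_density)
  qed
  define R1 where "R1 = distr (density P (\<lambda>w. \<psi> (Y w))) S X"
  define R2 where "R2 = distr (density P (\<lambda>w. \<integral>\<^sup>+y. \<psi> y \<partial>\<nu> (X w))) S X"
  have "R1 = R2"
  proof (rule measure_eqI)
    fix A assume "A \<in> sets R1"
    then have [measurable]: "A \<in> sets S" by (simp add: R1_def)
    have "emeasure R1 A = (\<integral>\<^sup>+w. indicator A (X w) * \<psi> (Y w) \<partial>P)"
      unfolding R1_def by (subst emeasure_distr) (auto simp: emeasure_density intro!: nn_integral_cong simp: indicator_def)
    also have "\<dots> = emeasure R2 A"
      unfolding R2_def step[OF \<open>A \<in> sets S\<close>]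
      by (subst emeasure_distr) (auto simp: emeasure_density intro!: nn_integral_cong simp: indicator_def)
    finally show "emeasure R1 A = emeasure R2 A" .
  qed (simp add: R1_def R2_def)
  then have "(\<integral>\<^sup>+x. \<phi> x \<partial>R1) = (\<integral>\<^sup>+x. \<phi> x \<partial>R2)" by simp
  then show ?thesis
    unfolding R1_def R2_def
    by (simp add: nn_integral_distr nn_integral_density mult.commute)
qed

lemma rcd_integral_measurable[measurable]:
  fixes \<psi> :: "'y \<Rightarrow> real"
  assumes [measurable]: "\<psi> \<in> borel_measurable N"
  shows "(\<lambda>w. LINT y|\<nu> (X w). \<psi> y) \<in> borel_measurable P"
  by (rule measurable_compose[OF measurable_compose[OF rcd_measurable(1) rcd_measurable(3)]
        integral_measurable_subprob_algebra]) measurable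

lemma rcd_integrable:
  fixes \<psi> :: "'y \<Rightarrow> real"
  assumes \<psi>: "\<psi> \<in> borel_measurable N" "\<And>y. y \<in> space N \<Longrightarrow> \<bar>\<psi> y\<bar> \<le> b" and u: "u \<in> space S"
  shows "integrable (\<nu> u) \<psi>" "\<bar>LINT y|\<nu> u. \<psi> y\<bar> \<le> b"
proof -
  interpret Q: prob_space "\<nu> u" by (rule rcd_space[OF u])
  have m: "\<psi> \<in> borel_measurable (\<nu> u)" using \<psi>(1) by (simp cong: measurable_cong_sets add: rcd_space[OF u])
  show i: "integrable (\<nu> u) \<psi>"
    using \<psi>(2) by (intro Q.integrable_const_bound[where B=b] AE_I2 m) (auto simp: rcd_space[OF u])
  have "\<bar>LINT y|\<nu> u. \<psi> y\<bar> \<le> (LINT y|\<nu> u. \<bar>\<psi> y\<bar>)" by (rule integral_abs_bound)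
  also have "\<dots> \<le> (LINT y|\<nu> u. b)" using i \<psi>(2) by (intro integral_mono) (auto simp: rcd_space[OF u])
  finally show "\<bar>LINT y|\<nu> u. \<psi> y\<bar> \<le> b" by (simp add: Q.prob_space)
qed

text \<open>Reduced to nonnegative functions by adding constants, which shift both sides alike:
  \<phi> is shifted by a' in \<open>pos\<close>, then \<psi> by b'.\<close>

lemma rcd_integral:
  fixes \<phi> :: "'s \<Rightarrow> real" and \<psi> :: "'y \<Rightarrow> real"
  assumes \<phi>[measurable]: "\<phi> \<in> borel_measurable S" and \<phi>_le: "\<And>x. x \<in> space S \<Longrightarrow> \<bar>\<phi> x\<bar> \<le> a"
    and \<psi>[measurable]: "\<psi> \<in> borel_measurable N" and \<psi>_le: "\<And>y. y \<in> space N \<Longrightarrow> \<bar>\<psi> y\<bar> \<le> b"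
  shows "(LINT w|P. \<phi> (X w) * \<psi> (Y w)) = (LINT w|P. \<phi> (X w) * (LINT y|\<nu> (X w). \<psi> y))"
proof -
  have nonneg: "(LINT w|P. \<xi> (X w) * \<eta> (Y w)) = (LINT w|P. \<xi> (X w) * (LINT y|\<nu> (X w). \<eta> y))"
    if [measurable]: "\<xi> \<in> borel_measurable S" "\<eta> \<in> borel_measurable N"
      and \<xi>: "\<And>x. x \<in> space S \<Longrightarrow> 0 \<le> \<xi> x" and \<eta>: "\<And>y. y \<in> space N \<Longrightarrow> 0 \<le> \<eta> y"
      and \<eta>_le: "\<And>y. y \<in> space N \<Longrightarrow> \<eta> y \<le> c" for \<xi> :: "'s \<Rightarrow> real" and \<eta> :: "'y \<Rightarrow> real" and c
  proof -
    have int_eq: "ennreal (LINT y|\<nu> u. \<eta> y) = (\<integral>\<^sup>+y. ennreal (\<eta> y) \<partial>\<nu> u)" "0 \<le> (LINT y|\<nu> u. \<eta> y)"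
      if u: "u \<in> space S" for u
    proof -
      have "integrable (\<nu> u) \<eta>" using \<eta> \<eta>_le u by (intro rcd_integrable(1)[where b=c]) (auto simp: abs_le_iff intro: order_trans)
      then show "ennreal (LINT y|\<nu> u. \<eta> y) = (\<integral>\<^sup>+y. ennreal (\<eta> y) \<partial>\<nu> u)"
        using \<eta> by (intro nn_integral_eq_integral[symmetric] AE_I2) (auto simp: rcd_space[OF u])
      show "0 \<le> (LINT y|\<nu> u. \<eta> y)" using \<eta> by (intro integral_nonneg_AE AE_I2) (auto simp: rcd_space[OF u])
    qed
    have "(LINT w|P. \<xi> (X w) * \<eta> (Y w)) = enn2real (\<integral>\<^sup>+w. ennreal (\<xi> (X w) * \<eta> (Y w)) \<partial>P)"
      using \<xi> \<eta> by (intro integral_eq_nn_integral AE_I2) (auto simp: rcd_X_space rcd_Y_space)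
    also have "(\<integral>\<^sup>+w. ennreal (\<xi> (X w) * \<eta> (Y w)) \<partial>P) = (\<integral>\<^sup>+w. ennreal (\<xi> (X w)) * ennreal (\<eta> (Y w)) \<partial>P)"
      using \<xi> \<eta> by (intro nn_integral_cong) (auto simp: ennreal_mult rcd_X_space rcd_Y_space)
    also have "\<dots> = (\<integral>\<^sup>+w. ennreal (\<xi> (X w)) * (\<integral>\<^sup>+y. ennreal (\<eta> y) \<partial>\<nu> (X w)) \<partial>P)"
      by (rule rcd_nn_integral) measurable
    also have "\<dots> = (\<integral>\<^sup>+w. ennreal (\<xi> (X w) * (LINT y|\<nu> (X w). \<eta> y)) \<partial>P)"
      using \<xi> \<eta> int_eq by (intro nn_integral_cong) (auto simp: ennreal_mult rcd_X_space)
    also have "enn2real \<dots> = (LINT w|P. \<xi> (X w) * (LINT y|\<nu> (X w). \<eta> y))"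
      using \<xi> int_eq by (intro integral_eq_nn_integral[symmetric] AE_I2) (auto simp: rcd_X_space)
    finally show ?thesis .
  qed
  define a' b' where "a' = \<bar>a\<bar>" and "b' = \<bar>b\<bar>"
  have \<phi>': "\<bar>\<phi> x\<bar> \<le> a'" if "x \<in> space S" for x using \<phi>_le[OF that] by (simp add: a'_def)
  have \<psi>': "\<bar>\<psi> y\<bar> \<le> b'" if "y \<in> space N" for y using \<psi>_le[OF that] by (simp add: b'_def)
  note ib = integrable_bounded_mult
  have 1: "(LINT w|P. (\<phi> (X w) + a') * \<psi>' (Y w)) = (LINT w|P. \<phi> (X w) * \<psi>' (Y w)) + (LINT w|P. a' * \<psi>' (Y w))"
    "(LINT w|P. (\<phi> (X w) + a') * (LINT y|\<nu> (X w). \<psi>' y)) =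
      (LINT w|P. \<phi> (X w) * (LINT y|\<nu> (X w). \<psi>' y)) + (LINT w|P. a' * (LINT y|\<nu> (X w). \<psi>' y))"
    if [measurable]: "\<psi>' \<in> borel_measurable N" and b: "\<And>y. y \<in> space N \<Longrightarrow> \<bar>\<psi>' y\<bar> \<le> c" for \<psi>' c
    unfolding distrib_right using rcd_integrable(2)[OF that] b \<phi>'
    by (intro Bochner_Integration.integral_add ib[where a=a' and b=c];
        auto simp: rcd_X_space rcd_Y_space a'_def)+
  have pos: "(LINT w|P. \<phi> (X w) * \<psi>' (Y w)) = (LINT w|P. \<phi> (X w) * (LINT y|\<nu> (X w). \<psi>' y))"
    if m[measurable]: "\<psi>' \<in> borel_measurable N" and b: "\<And>y. y \<in> space N \<Longrightarrow> \<bar>\<psi>' y\<bar> \<le> c"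
      and n: "\<And>y. y \<in> space N \<Longrightarrow> 0 \<le> \<psi>' y" for \<psi>' c
  proof -
    have "(LINT w|P. (\<phi> (X w) + a') * \<psi>' (Y w)) = (LINT w|P. (\<phi> (X w) + a') * (LINT y|\<nu> (X w). \<psi>' y))"
      using \<phi>' n b by (intro nonneg[of "\<lambda>x. \<phi> x + a'" \<psi>' c]) (auto simp: abs_le_iff minus_le_iff, (smt (verit))+)
    moreover have "(LINT w|P. a' * \<psi>' (Y w)) = (LINT w|P. a' * (LINT y|\<nu> (X w). \<psi>' y))"
      using n b by (intro nonneg[of "\<lambda>x. a'" \<psi>' c]) (auto simp: a'_def)
    ultimately show ?thesis using 1[OF m b] by linarith
  qed
  have "(LINT w|P. \<phi> (X w) * (\<psi> (Y w) + b')) = (LINT w|P. \<phi> (X w) * (LINT y|\<nu> (X w). \<psi> y + b'))"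
    using \<psi>' by (intro pos[of "\<lambda>y. \<psi> y + b'" "2*b'"]) (auto simp: abs_le_iff, (smt (verit))+)
  moreover have "(LINT w|P. \<phi> (X w) * (\<psi> (Y w) + b')) = (LINT w|P. \<phi> (X w) * \<psi> (Y w)) + (LINT w|P. \<phi> (X w) * b')"
    unfolding distrib_left using \<phi>' \<psi>'
    by (intro Bochner_Integration.integral_add ib[where a=a' and b=b'])
       (auto simp: rcd_X_space rcd_Y_space b'_def)
  moreover have "(LINT w|P. \<phi> (X w) * (LINT y|\<nu> (X w). \<psi> y + b')) =
     (LINT w|P. \<phi> (X w) * (LINT y|\<nu> (X w). \<psi> y)) + (LINT w|P. \<phi> (X w) * b')"
  proof -
    have "(LINT w|P. \<phi> (X w) * (LINT y|\<nu> (X w). \<psi> y + b')) =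
      (LINT w|P. \<phi> (X w) * (LINT y|\<nu> (X w). \<psi> y) + \<phi> (X w) * b')"
    proof (rule Bochner_Integration.integral_cong)
      fix w assume w: "w \<in> space P"
      interpret Q: prob_space "\<nu> (X w)" by (rule rcd_space(1)[OF rcd_X_space[OF w]])
      show "\<phi> (X w) * (LINT y|\<nu> (X w). \<psi> y + b') = \<phi> (X w) * (LINT y|\<nu> (X w). \<psi> y) + \<phi> (X w) * b'"
        using rcd_integrable(1)[OF \<psi> \<psi>' rcd_X_space[OF w]]
        by (simp add: Bochner_Integration.integral_add Q.prob_space distrib_left)
    qed simp
    also have "\<dots> = (LINT w|P. \<phi> (X w) * (LINT y|\<nu> (X w). \<psi> y)) + (LINT w|P. \<phi> (X w) * b')"
      using \<phi>' rcd_integrable(2)[OF \<psi> \<psi>']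
      by (intro Bochner_Integration.integral_add ib[where a=a' and b=b'])
         (auto simp: rcd_X_space b'_def)
    finally show ?thesis .
  qed
  ultimately show ?thesis by simp
qed

end

declare rcd_measurable [measurable del] rcd_measurable_emeasure [measurable del]
  rcd_integral_measurable [measurable del]

section \<open>Kernels and functions with bounded second derivative\<close>

locale smoothing_kernel =
  fixes K :: "real \<Rightarrow> real"
  assumes K_cont: "continuous_on UNIV K" and K_sym: "\<And>u. K (- u) = K u" and K_nonneg: "\<And>u. 0 \<le> K u"
    and K_integrable: "integrable lborel K" and K_integral: "(LINT u|lborel. K u) = 1"
    and K_support: "closure {u. K u \<noteq> 0} = {-1..1}"
begin

lemma K_measurable[measurable]: "K \<in> borel_measurable borel"
  by (rule borel_measurable_continuous_onI[OF K_cont])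

lemma K_zero: "1 < \<bar>u\<bar> \<Longrightarrow> K u = 0"
  using closure_subset[of "{u. K u \<noteq> 0}"] unfolding K_support by (auto simp: abs_if split: if_splits)

lemma K_bounded: "\<exists>b>0. \<forall>u. K u \<le> b"
proof -
  have "bounded (K ` {-1..1})"
    by (intro compact_imp_bounded compact_continuous_image continuous_on_subset[OF K_cont]) auto
  then obtain b where b: "\<forall>y\<in>K ` {-1..1}. norm y \<le> b" unfolding bounded_iff by blast
  have "K u \<le> max 1 b" for u
    using bspec[OF b, of "K u"] K_zero[of u] by (cases "\<bar>u\<bar> \<le> 1") (auto simp: abs_le_iff)
  then show ?thesis by (intro exI[of _ "max 1 b"]) auto
qed

text \<open>K is a probability density living on |v| \<le> 1, so integration against it is an
  average of values of p there.\<close>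

lemma
  assumes [measurable]: "p \<in> borel_measurable borel" and p: "\<And>v. \<bar>v\<bar> \<le> 1 \<Longrightarrow> \<bar>p v\<bar> \<le> c"
  shows K_weighted_integrable: "integrable lborel (\<lambda>v. K v * p v)"
    and K_weighted_le: "\<bar>LINT v|lborel. K v * p v\<bar> \<le> c"
proof -
  have le: "\<bar>K v * p v\<bar> \<le> K v * c" for v
    using p[of v] K_zero[of v] K_nonneg[of v] by (cases "\<bar>v\<bar> \<le> 1") (auto simp: abs_mult intro: mult_left_mono)
  have ic: "integrable lborel (\<lambda>v. K v * c)" using K_integrable by simp
  show i: "integrable lborel (\<lambda>v. K v * p v)"
  proof (rule Bochner_Integration.integrable_bound[OF ic])
    show "AE v in lborel. norm (K v * p v) \<le> norm (K v * c)"
      using order_trans[OF le abs_ge_self] by (auto intro!: AE_I2)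
  qed measurable
  have "\<bar>LINT v|lborel. K v * p v\<bar> \<le> (LINT v|lborel. \<bar>K v * p v\<bar>)" by (rule integral_abs_bound)
  also have "\<dots> \<le> (LINT v|lborel. K v * c)" by (intro integral_mono integrable_abs i ic le)
  also have "\<dots> = c" by (simp add: K_integral)
  finally show "\<bar>LINT v|lborel. K v * p v\<bar> \<le> c" .
qed

definition k_moment :: "nat \<Rightarrow> real" where "k_moment j = (LINT v|lborel. K v * v ^ j)"

lemma power_abs_le_1: "\<bar>v::real\<bar> \<le> 1 \<Longrightarrow> \<bar>v ^ j\<bar> \<le> 1"
  by (simp add: power_abs power_le_one)

lemma k_moment_0: "k_moment 0 = 1" by (simp add: k_moment_def K_integral)

lemma k_moment_1: "k_moment 1 = 0"
proof -
  have "(LINT v|lborel. K v * v) = (LINT v|lborel. K (- v) * (- v))"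
    by (subst lborel_integral_real_affine[where c="-1" and t=0]) auto
  then show ?thesis by (simp add: k_moment_def K_sym)
qed

text \<open>Otherwise K would vanish almost everywhere off 0 and could not have integral 1.
  Positivity is what keeps \<open>kernel_sigma2\<close> away from 0.\<close>

lemma k_moment_2: "0 < k_moment 2"
proof -
  have i: "integrable lborel (\<lambda>v. K v * v ^ 2)"
    by (rule K_weighted_integrable[where c=1]) (auto intro: power_abs_le_1[of _ 2, simplified])
  have "0 \<le> k_moment 2" unfolding k_moment_def using K_nonneg by (intro integral_nonneg_AE AE_I2) simp
  moreover have "k_moment 2 \<noteq> 0"
  proof
    assume "k_moment 2 = 0"
    then have "AE v in lborel. K v * v ^ 2 = 0"
      unfolding k_moment_def using integral_nonneg_eq_0_iff_AE[OF i] K_nonneg by simp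
    moreover have "AE v in lborel. v \<noteq> (0::real)" by (rule AE_lborel_singleton)
    ultimately have "AE v in lborel. K v = 0" by eventually_elim auto
    then have "integral\<^sup>L lborel K = 0" by (rule integral_eq_zero_AE)
    then show False using K_integral by simp
  qed
  ultimately show ?thesis by simp
qed

lemma kernel_scaled_measurable[measurable]: "kernel_scaled K h \<in> borel_measurable borel"
  unfolding kernel_scaled_def[abs_def] by measurable

lemma kernel_scaled_nonneg: "0 < h \<Longrightarrow> 0 \<le> kernel_scaled K h u"
  by (simp add: kernel_scaled_def K_nonneg)

lemma kernel_scaled_zero: "0 < h \<Longrightarrow> h < \<bar>u\<bar> \<Longrightarrow> kernel_scaled K h u = 0"
  by (simp add: kernel_scaled_def K_zero)

text \<open>On the support |u| \<le> h. In the second bound one kernel factor is deliberately kept: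
  its expectation stays bounded as h tends to 0, so second moments cost 1/h and not 1/h^2.\<close>

lemma kernel_scaled_power_le:
  assumes "0 < h" "\<And>v. K v \<le> b"
  shows "\<bar>kernel_scaled K h u * u ^ j\<bar> \<le> b / h * h ^ j"
    and "(kernel_scaled K h u * u ^ j)\<^sup>2 \<le> b / h * h ^ (2 * j) * kernel_scaled K h u"
proof -
  have kb: "kernel_scaled K h u \<le> b / h" using assms by (simp add: kernel_scaled_def divide_right_mono)
  have b: "0 \<le> b" using assms(2)[of 0] K_nonneg[of 0] by linarith
  have "kernel_scaled K h u * \<bar>u\<bar> ^ i \<le> kernel_scaled K h u * h ^ i" for i
    using kernel_scaled_zero[OF assms(1), of u] kernel_scaled_nonneg[OF assms(1), of u]
    by (cases "\<bar>u\<bar> \<le> h") (auto intro!: mult_left_mono power_mono)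
  note le = this
  have "\<bar>kernel_scaled K h u * u ^ j\<bar> = kernel_scaled K h u * \<bar>u\<bar> ^ j"
    using kernel_scaled_nonneg[OF assms(1), of u] by (simp add: abs_mult power_abs)
  also have "\<dots> \<le> b / h * h ^ j"
    by (rule order_trans[OF le]) (intro mult_right_mono kb, use assms in simp)
  finally show "\<bar>kernel_scaled K h u * u ^ j\<bar> \<le> b / h * h ^ j" .
  have "(kernel_scaled K h u * u ^ j)\<^sup>2 = kernel_scaled K h u * (kernel_scaled K h u * \<bar>u\<bar> ^ (2 * j))"
  proof -
    have "\<bar>u\<bar> ^ (2 * j) = u ^ (2 * j)" by (simp add: power_even_abs)
    then show ?thesis by (simp add: power2_eq_square mult_2 mult_2_right power_add mult_ac)
  qed
  also have "\<dots> \<le> kernel_scaled K h u * (kernel_scaled K h u * h ^ (2 * j))"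
    by (intro mult_left_mono le kernel_scaled_nonneg assms)
  also have "\<dots> \<le> kernel_scaled K h u * (b / h * h ^ (2 * j))"
    using assms by (intro mult_left_mono mult_right_mono kb kernel_scaled_nonneg) auto
  finally show "(kernel_scaled K h u * u ^ j)\<^sup>2 \<le> b / h * h ^ (2 * j) * kernel_scaled K h u"
    by (simp add: mult_ac)
qed

text \<open>Substitution u = x + h v.\<close>

lemma kernel_scaled_integral:
  assumes h: "0 < h"
  shows "(LINT u|lborel. kernel_scaled K h (u - x) * (u - x) ^ j * G u) =
         h ^ j * (LINT v|lborel. K v * (v ^ j * G (x + h * v)))"
proof -
  have "(LINT u|lborel. kernel_scaled K h (u - x) * (u - x) ^ j * G u) =
    \<bar>h\<bar> *\<^sub>R (LINT v|lborel. kernel_scaled K h (h * v) * (h * v) ^ j * G (x + h * v))"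
    using h by (subst lborel_integral_real_affine[where c=h and t=x]) auto
  also have "\<dots> = (LINT v|lborel. h ^ j * (K v * (v ^ j * G (x + h * v))))"
    using h by (auto simp: kernel_scaled_def power_mult_distrib field_simps
        simp flip: integral_mult_right_zero intro!: Bochner_Integration.integral_cong)
  finally show ?thesis by simp
qed

end

section \<open>Probability densities with bounded second derivative\<close>

lemma taylor2:
  assumes "twice_continuously_differentiable G" "\<And>u. \<bar>deriv (deriv G) u\<bar> \<le> B"
  shows "\<bar>G (x + d) - G x - deriv G x * d\<bar> \<le> B / 2 * d\<^sup>2"
proof (cases "d = 0")
  case False
  define diff where "diff m = (if m = 0 then G else if m = 1 then deriv G else deriv (deriv G))" for m :: nat
  have D: "DERIV G u :> deriv G u" "DERIV (deriv G) u :> deriv (deriv G) u" for u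
    using assms(1) unfolding twice_continuously_differentiable_def
    by (auto simp: DERIV_deriv_iff_real_differentiable)
  have "\<exists>t. (if x + d < x then x + d < t \<and> t < x else x < t \<and> t < x + d) \<and>
     G (x + d) = (\<Sum>m<2. (diff m x / fact m) * (x + d - x) ^ m) + (diff 2 t / fact 2) * (x + d - x) ^ 2"
    by (rule Taylor[where a="min x (x + d)" and b="max x (x + d)"])
       (use False D in \<open>auto simp: diff_def less_Suc_eq numeral_2_eq_2\<close>)
  then obtain t where "G (x + d) = (\<Sum>m<2. (diff m x / fact m) * d ^ m) + (diff 2 t / fact 2) * d\<^sup>2" by auto
  then have "G (x + d) - G x - deriv G x * d = deriv (deriv G) t / 2 * d\<^sup>2"
    by (simp add: diff_def numeral_2_eq_2)
  moreover have "\<bar>deriv (deriv G) t / 2 * d\<^sup>2\<bar> \<le> B / 2 * d\<^sup>2"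
    unfolding abs_mult using assms(2)[of t] by (intro mult_mono) auto
  ultimately show ?thesis by (simp only:)
qed simp

lemma twice_continuously_differentiable_continuous:
  "twice_continuously_differentiable G \<Longrightarrow> continuous_on A G"
  unfolding twice_continuously_differentiable_def
  by (intro continuous_at_imp_continuous_on ballI) (auto intro: differentiable_imp_continuous_within)

text \<open>On [x-1, x+1] the density lies above its tangent minus B/2; the linear term integrates
  to 0 over this interval, so a large value at x would push the total mass above 1. A steep slope
  would make the upper parabola negative at distance 1. The resulting bounds depend on B only and
  are therefore uniform over all shapes.\<close>

lemma prob_density_bounds:
  assumes G: "twice_continuously_differentiable G" "\<And>u. \<bar>deriv (deriv G) u\<bar> \<le> B"
    and nn: "\<And>u. 0 \<le> G u" and i: "integrable lborel G" "(LINT u|lborel. G u) = 1"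
  shows "G x \<le> 1 + B" "\<bar>deriv G x\<bar> \<le> 1 + 2 * B"
proof -
  have B: "0 \<le> B" using G(2)[of 0] by linarith
  define s where "s = deriv G x"
  have low: "G x + s * d - B / 2 \<le> G (x + d)" "G (x + d) \<le> G x + s * d + B / 2" if "\<bar>d\<bar> \<le> 1" for d
  proof -
    have "d\<^sup>2 \<le> 1" using that by (simp add: abs_square_le_1)
    then have "B / 2 * d\<^sup>2 \<le> B / 2 * 1" using B by (intro mult_left_mono) auto
    then show "G x + s * d - B / 2 \<le> G (x + d)" "G (x + d) \<le> G x + s * d + B / 2"
      using taylor2[OF G, of x d] unfolding s_def by linarith+
  qed
  have "2 * (G x - B / 2) = (LINT d|lborel. indicator {-1..1} d * (G x - B / 2 + s * d))"
  proof -
    have "(LINT d|lborel. indicator {-1..1} d * (s * d)) = (LINT d|lborel. indicator {-1..1} (-d) * (s * (-d)))"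
      by (subst lborel_integral_real_affine[where c="-1" and t=0]) auto
    also have "\<dots> = - (LINT d|lborel. indicator {-1..1} d * (s * d))"
      by (auto simp flip: Bochner_Integration.integral_minus intro!: Bochner_Integration.integral_cong simp: indicator_def)
    finally have 0: "(LINT d|lborel. indicator {-1..1} d * (s * d)) = 0" by simp
    have i1: "integrable lborel (\<lambda>d::real. indicator {-1..1} d * (s * d))"
      using borel_integrable_atLeastAtMost'[of "-1" 1 "\<lambda>d. s * d"]
      by (auto simp: set_integrable_def intro!: continuous_intros)
    show ?thesis
      unfolding distrib_left using 0 i1
      by (subst Bochner_Integration.integral_add) auto
  qed
  also have "\<dots> \<le> (LINT d|lborel. G (x + 1 * d))"
  proof (rule integral_mono)
    show "integrable lborel (\<lambda>d. G (x + 1 * d))"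
      using i by (subst lborel_integrable_real_affine_iff) auto
    have "continuous_on {-1..1} (\<lambda>d. G x - B / 2 + s * d)" by (intro continuous_intros)
    from borel_integrable_atLeastAtMost'[OF this]
    show "integrable lborel (\<lambda>d. indicator {-1..1} d * (G x - B / 2 + s * d))"
      by (simp add: set_integrable_def)
    fix d show "indicator {-1..1} d * (G x - B / 2 + s * d) \<le> G (x + 1 * d)"
      using low(1)[of d] nn[of "x + d"] by (auto simp: indicator_def abs_le_iff)
  qed
  also have "\<dots> = 1"
    using lborel_integral_real_affine[of 1 G x] i by simp
  finally show *: "G x \<le> 1 + B" using B by simp
  have "\<bar>s\<bar> \<le> G x + B / 2" 
  proof -
    \<comment> \<open>The unit step in the direction in which the tangent falls.\<close>
    obtain d where d: "\<bar>d\<bar> = 1" "s * d = - \<bar>s\<bar>"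
      by (cases "0 \<le> s") (auto intro: that[of 1] that[of "-1"])
    show ?thesis using low(2)[of d] nn[of "x + d"] d by simp
  qed
  also have "\<dots> \<le> 1 + 2 * B" using * B by simp
  finally show "\<bar>deriv G x\<bar> \<le> 1 + 2 * B" by (simp add: s_def)
qed

lemma average_tendsto:
  fixes G :: "real \<Rightarrow> real"
  assumes G: "continuous_on UNIV G"
  shows "(\<lambda>n. real (Suc n) * (LINT u|lborel. indicator {x..x + 1 / real (Suc n)} u * G u)) \<longlonglongrightarrow> G x"
proof (rule metric_LIMSEQ_I)
  fix e :: real assume e: "0 < e"
  have "isCont G x" using G by (simp add: continuous_on_eq_continuous_at)
  then have "\<exists>d>0. \<forall>u. dist u x < d \<longrightarrow> dist (G u) (G x) < e / 2"
    using half_gt_zero[OF e] unfolding continuous_at_eps_delta by blast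
  then obtain d where d: "0 < d" "\<And>u. \<bar>u - x\<bar> < d \<Longrightarrow> \<bar>G u - G x\<bar> < e / 2"
    by (auto simp: dist_real_def)
  obtain m :: nat where m: "1 / d < real m" using reals_Archimedean2 by blast
  show "\<exists>m. \<forall>n\<ge>m. dist (real (Suc n) * (LINT u|lborel. indicator {x..x + 1 / real (Suc n)} u * G u)) (G x) < e"
  proof (intro exI[of _ m] allI impI)
    fix n assume n: "m \<le> n"
    define c where "c = 1 / real (Suc n)"
    have c: "0 < c" "c < d"
    proof -
      have "1 / d < real (Suc n)" using m n by linarith
      then show "c < d" using d by (simp add: c_def field_simps)
    qed (simp add: c_def)
    have i: "integrable lborel (\<lambda>u. indicator {x..x + c} u * p u)" if "continuous_on UNIV p" for p :: "real \<Rightarrow> real"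
      using borel_integrable_atLeastAtMost'[of x "x + c" p] continuous_on_subset[OF that]
      by (auto simp: set_integrable_def)
    have "(LINT u|lborel. indicator {x..x + c} u * G u) - c * G x =
      (LINT u|lborel. indicator {x..x + c} u * (G u - G x))"
      using i[OF G] i[of "\<lambda>_. G x"] c by (simp add: right_diff_distrib Bochner_Integration.integral_diff)
    also have "\<bar>\<dots>\<bar> \<le> (LINT u|lborel. \<bar>indicator {x..x + c} u * (G u - G x)\<bar>)" by (rule integral_abs_bound)
    also have "\<dots> \<le> (LINT u|lborel. indicator {x..x + c} u * (e / 2))"
    proof (intro integral_mono integrable_abs i continuous_intros G)
      fix u show "\<bar>indicator {x..x + c} u * (G u - G x)\<bar> \<le> indicator {x..x + c} u * (e / 2)"
        using d(2)[of u] c by (auto simp: indicator_def)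
    qed
    also have "\<dots> = c * (e / 2)" using c by simp
    finally have "\<bar>(LINT u|lborel. indicator {x..x + c} u * G u) - c * G x\<bar> \<le> c * (e / 2)" .
    then have "\<bar>(LINT u|lborel. indicator {x..x + c} u * G u) / c - G x\<bar> \<le> e / 2"
      using c by (simp add: field_simps abs_le_iff)
    then show "dist (real (Suc n) * (LINT u|lborel. indicator {x..x + 1 / real (Suc n)} u * G u)) (G x) < e"
      using e by (simp add: c_def dist_real_def mult.commute)
  qed
qed

context smoothing_kernel
begin

text \<open>The first bound uses only that G varies by O(h) on the support. For j = 0 the linear
  Taylor term meets the vanishing first moment of the symmetric kernel, which leaves the curvature
  term of order h^2.\<close>

lemma kernel_scaled_density:
  assumes G: "twice_continuously_differentiable G" "\<And>u. \<bar>deriv (deriv G) u\<bar> \<le> B"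
    and nn: "\<And>u. 0 \<le> G u" and i: "integrable lborel G" "(LINT u|lborel. G u) = 1" and h: "0 < h" "h \<le> 1"
  shows "\<bar>(LINT u|lborel. kernel_scaled K h (u - x) * (u - x) ^ j * G u) - h ^ j * k_moment j * G x\<bar>
           \<le> (1 + 3 * B) * h ^ Suc j"
    and "\<bar>(LINT u|lborel. kernel_scaled K h (u - x) * G u) - G x\<bar> \<le> B * h\<^sup>2"
proof -
  have B: "0 \<le> B" using G(2)[of 0] by linarith
  have [measurable]: "G \<in> borel_measurable borel"
    by (rule borel_measurable_continuous_onI[OF twice_continuously_differentiable_continuous[OF G(1)]])
  have t: "\<bar>G (x + h * v) - G x - deriv G x * (h * v)\<bar> \<le> B * h\<^sup>2" if "\<bar>v\<bar> \<le> 1" for v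
  proof -
    have "v\<^sup>2 \<le> 1" using that by (simp add: abs_square_le_1)
    then have "B / 2 * (h * v)\<^sup>2 \<le> B * (h\<^sup>2 * 1)"
      using B h unfolding power_mult_distrib by (intro mult_mono) auto
    then show ?thesis using taylor2[OF G, of x "h * v"] by simp
  qed
  have h2: "h\<^sup>2 \<le> h" using h by (simp add: power2_eq_square mult_left_le)
  \<comment> \<open>1 + 2B bounds the slope and the further B the curvature, as h^2 \<le> h.\<close>
  have l: "\<bar>G (x + h * v) - G x\<bar> \<le> (1 + 3 * B) * h" if "\<bar>v\<bar> \<le> 1" for v
  proof -
    have "\<bar>deriv G x * (h * v)\<bar> \<le> (1 + 2 * B) * (h * 1)"
      unfolding abs_mult using prob_density_bounds(2)[OF G nn i] h that B by (intro mult_mono) auto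
    moreover have "B * h\<^sup>2 \<le> B * h" using h2 B by (intro mult_left_mono) auto
    ultimately show ?thesis using t[OF that] by (simp add: algebra_simps)
  qed
  have Gb: "\<bar>G u\<bar> \<le> 1 + B" for u using prob_density_bounds(1)[OF G nn i, of u] nn[of u] by simp
  have i1: "integrable lborel (\<lambda>v. K v * (v ^ j * G (x + h * v)))" for j
  proof (rule K_weighted_integrable)
    fix v :: real assume v: "\<bar>v\<bar> \<le> 1"
    show "\<bar>v ^ j * G (x + h * v)\<bar> \<le> 1 * (1 + B)"
      unfolding abs_mult[of "v ^ j"] by (intro mult_mono power_abs_le_1 v Gb) auto
  qed measurable
  have i2: "integrable lborel (\<lambda>v. K v * v ^ j)" for j
    by (rule K_weighted_integrable[where c=1]) (auto intro: power_abs_le_1)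
  have eq: "(LINT u|lborel. kernel_scaled K h (u - x) * (u - x) ^ j * G u) - h ^ j * k_moment j * G x =
    h ^ j * (LINT v|lborel. K v * (v ^ j * (G (x + h * v) - G x)))" for j
  proof -
    have "(LINT v|lborel. K v * (v ^ j * (G (x + h * v) - G x))) =
      (LINT v|lborel. K v * (v ^ j * G (x + h * v)) - K v * v ^ j * G x)"
      by (simp add: algebra_simps)
    also have "\<dots> = (LINT v|lborel. K v * (v ^ j * G (x + h * v))) - k_moment j * G x"
      using i1 i2 by (simp add: Bochner_Integration.integral_diff k_moment_def)
    finally have A: "(LINT v|lborel. K v * (v ^ j * (G (x + h * v) - G x))) =
      (LINT v|lborel. K v * (v ^ j * G (x + h * v))) - k_moment j * G x" .
    show ?thesis unfolding kernel_scaled_integral[OF h(1)] A by (simp add: algebra_simps)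
  qed
  have "\<bar>LINT v|lborel. K v * (v ^ j * (G (x + h * v) - G x))\<bar> \<le> (1 + 3 * B) * h"
  proof (rule K_weighted_le)
    fix v :: real assume v: "\<bar>v\<bar> \<le> 1"
    have "\<bar>v ^ j * (G (x + h * v) - G x)\<bar> \<le> 1 * ((1 + 3 * B) * h)"
      unfolding abs_mult[of "v ^ j"] using B h by (intro mult_mono power_abs_le_1 v l) auto
    then show "\<bar>v ^ j * (G (x + h * v) - G x)\<bar> \<le> (1 + 3 * B) * h" by simp
  qed measurable
  then show "\<bar>(LINT u|lborel. kernel_scaled K h (u - x) * (u - x) ^ j * G u) - h ^ j * k_moment j * G x\<bar>
           \<le> (1 + 3 * B) * h ^ Suc j"
    unfolding eq abs_mult using h
    by (simp add: mult.assoc[symmetric] mult.commute[of "h ^ j"] mult_left_mono)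
  have "(LINT v|lborel. K v * (v ^ 0 * (G (x + h * v) - G x))) =
    (LINT v|lborel. K v * (G (x + h * v) - G x - deriv G x * (h * v)) + K v * v ^ 1 * (deriv G x * h))"
    by (simp add: algebra_simps)
  also have "\<dots> = (LINT v|lborel. K v * (G (x + h * v) - G x - deriv G x * (h * v))) + k_moment 1 * (deriv G x * h)"
    unfolding k_moment_def
    by (subst Bochner_Integration.integral_add)
       (use i2[of 1] in \<open>auto intro!: K_weighted_integrable[where c="B * h\<^sup>2"] t\<close>)
  also have "\<dots> = (LINT v|lborel. K v * (G (x + h * v) - G x - deriv G x * (h * v)))"
    unfolding k_moment_1 by simp
  also have "\<bar>\<dots>\<bar> \<le> B * h\<^sup>2" by (rule K_weighted_le) (auto intro: t)
  finally show "\<bar>(LINT u|lborel. kernel_scaled K h (u - x) * G u) - G x\<bar> \<le> B * h\<^sup>2"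
    using eq[of 0] by (simp add: k_moment_0)
qed

end

section \<open>Averages of independent identically distributed variables\<close>

text \<open>Squared bias plus variance over n, by pairwise orthogonality of the centred variables.
  The centre c is arbitrary because the intended limit is not the mean of a local average at
  positive bandwidth.\<close>

lemma (in prob_space) iid_average_mean_square:
  fixes G :: "'z \<Rightarrow> real"
  assumes indep: "indep_vars (\<lambda>_. N) Z (UNIV :: nat set)"
    and Z0: "Z0 \<in> M \<rightarrow>\<^sub>M N" and distr: "\<And>i. distr M N (Z i) = distr M N Z0"
    and G[measurable]: "G \<in> borel_measurable N" and b: "\<And>z. z \<in> space N \<Longrightarrow> \<bar>G z\<bar> \<le> b" and n: "0 < n"
  shows "integrable M (\<lambda>w. ((\<Sum>i<n. G (Z i w)) / real n - c)\<^sup>2)"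
    and "expectation (\<lambda>w. ((\<Sum>i<n. G (Z i w)) / real n - c)\<^sup>2) \<le>
      (expectation (\<lambda>w. G (Z0 w)) - c)\<^sup>2 + expectation (\<lambda>w. (G (Z0 w))\<^sup>2) / real n"
proof -
  have Z[measurable]: "Z i \<in> M \<rightarrow>\<^sub>M N" for i using indep by (simp add: indep_vars_def)
  note Z0[measurable]
  define m where "m = expectation (\<lambda>w. G (Z0 w))"
  define Y where "Y i w = G (Z i w) - m" for i w
  have Y_meas[measurable]: "Y i \<in> borel_measurable M" for i unfolding Y_def[abs_def] by measurable
  have bZ: "\<bar>G (Z i w)\<bar> \<le> b" if "w \<in> space M" for i w using b measurable_space[OF Z that] by auto
  have bY: "\<bar>Y i w\<bar> \<le> b + \<bar>m\<bar>" if "w \<in> space M" for i w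
    using bZ[OF that, of i] unfolding Y_def by linarith
  have iYY: "integrable M (\<lambda>w. Y i w * Y j w)" for i j
    by (rule integrable_bounded_mult[where a="b + \<bar>m\<bar>" and b="b + \<bar>m\<bar>"]) (auto intro: bY)
  have iY: "integrable M (Y i)" for i
    by (rule integrable_const_bound[where B="b + \<bar>m\<bar>"]) (auto intro: bY)
  have same: "expectation (\<lambda>w. p (Z i w)) = expectation (\<lambda>w. p (Z0 w))"
    if [measurable]: "p \<in> borel_measurable N" for p :: "'z \<Rightarrow> real" and i
  proof -
    have "expectation (\<lambda>w. p (Z i w)) = (LINT z|distr M N (Z i). p z)"
      by (rule integral_distr[symmetric]) measurable
    also have "\<dots> = expectation (\<lambda>w. p (Z0 w))" unfolding distr by (rule integral_distr) measurable
    finally show ?thesis .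
  qed
  have iG: "integrable M (\<lambda>w. G (Z i w))" for i
    by (rule integrable_const_bound[where B=b]) (auto intro: bZ)
  have EY: "expectation (Y i) = 0" for i
    unfolding Y_def[abs_def] using same[OF G, of i] iG[of i] by (simp add: m_def prob_space)
  have orth: "expectation (\<lambda>w. Y i w * Y j w) = 0" if "i \<noteq> j" for i j
  proof -
    have iv: "indep_vars (\<lambda>_. borel) Y {i, j}"
      unfolding Y_def[abs_def]
      by (rule indep_vars_subset[OF indep_vars_compose2[OF indep, where Y="\<lambda>i z. G z - m" and N="\<lambda>_. borel"]]) auto
    have "(\<integral>w. (\<Prod>l\<in>{i,j}. Y l w) \<partial>M) = (\<Prod>l\<in>{i,j}. \<integral>w. Y l w \<partial>M)"
      by (rule indep_vars_lebesgue_integral[OF _ iv]) (auto intro: iY)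
    then show ?thesis using that by (simp add: EY)
  qed
  have var: "expectation (\<lambda>w. Y i w * Y i w) \<le> expectation (\<lambda>w. (G (Z0 w))\<^sup>2)" for i
  proof -
    have i0: "integrable M (\<lambda>w. G (Z0 w))"
      using b measurable_space[OF Z0] by (intro integrable_const_bound[where B=b]) auto
    have i2: "integrable M (\<lambda>w. (G (Z0 w))\<^sup>2)"
      unfolding power2_eq_square using b measurable_space[OF Z0]
      by (intro integrable_bounded_mult[where a=b and b=b]) auto
    have "expectation (\<lambda>w. Y i w * Y i w) = expectation (\<lambda>w. (G (Z0 w) - m) * (G (Z0 w) - m))"
      unfolding Y_def by (rule same[of "\<lambda>z. (G z - m) * (G z - m)"]) measurable
    also have "\<dots> = expectation (\<lambda>w. (G (Z0 w))\<^sup>2 - 2 * m * G (Z0 w) + m\<^sup>2)"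
      by (simp add: power2_eq_square algebra_simps)
    also have "\<dots> = expectation (\<lambda>w. (G (Z0 w))\<^sup>2) - m\<^sup>2"
      using i0 i2 by (simp add: prob_space power2_eq_square) (simp add: m_def)
    finally show ?thesis by simp
  qed
  have avg: "(\<Sum>i<n. G (Z i w)) / real n - c = (\<Sum>i<n. Y i w) / real n + (m - c)" for w
    using n by (simp add: Y_def sum_subtractf field_simps)
  have sq: "((\<Sum>i<n. G (Z i w)) / real n - c)\<^sup>2 =
    (\<Sum>i<n. \<Sum>j<n. Y i w * Y j w) / (real n)\<^sup>2 + 2 * (m - c) / real n * (\<Sum>i<n. Y i w) + (m - c)\<^sup>2" for w
    unfolding avg power2_sum by (simp add: power_divide power2_eq_square sum_product mult_ac)
  show "integrable M (\<lambda>w. ((\<Sum>i<n. G (Z i w)) / real n - c)\<^sup>2)"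
    unfolding sq using iY iYY by auto
  have "expectation (\<lambda>w. ((\<Sum>i<n. G (Z i w)) / real n - c)\<^sup>2) =
    (\<Sum>i<n. \<Sum>j<n. expectation (\<lambda>w. Y i w * Y j w)) / (real n)\<^sup>2 + (m - c)\<^sup>2"
    unfolding sq using iY iYY by (simp add: EY prob_space Bochner_Integration.integral_sum)
  also have "(\<Sum>i<n. \<Sum>j<n. expectation (\<lambda>w. Y i w * Y j w)) = (\<Sum>i<n. expectation (\<lambda>w. Y i w * Y i w))"
  proof (rule sum.cong[OF refl])
    fix i assume "i \<in> {..<n}"
    then have "(\<Sum>j<n. expectation (\<lambda>w. Y i w * Y j w)) = (\<Sum>j\<in>{i}. expectation (\<lambda>w. Y i w * Y j w))"
      by (intro sum.mono_neutral_right) (auto intro: orth)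
    then show "(\<Sum>j<n. expectation (\<lambda>w. Y i w * Y j w)) = expectation (\<lambda>w. Y i w * Y i w)" by simp
  qed
  also have "\<dots> \<le> (\<Sum>i<n. expectation (\<lambda>w. (G (Z0 w))\<^sup>2))" by (intro sum_mono var)
  also have "\<dots> / (real n)\<^sup>2 = expectation (\<lambda>w. (G (Z0 w))\<^sup>2) / real n"
    using n by (simp add: power2_eq_square)
  finally show "expectation (\<lambda>w. ((\<Sum>i<n. G (Z i w)) / real n - c)\<^sup>2) \<le>
      (expectation (\<lambda>w. G (Z0 w)) - c)\<^sup>2 + expectation (\<lambda>w. (G (Z0 w))\<^sup>2) / real n"
    by (simp add: m_def divide_right_mono)
qed

section \<open>Local moments of the covariate and the shape\<close>

text \<open>Here f is the random shape itself. Intensities and samples come later, so this part is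
  about the law of a single pair.\<close>

locale shape_regression = prob_space P + shape_space T M L + smoothing_kernel K
  for P :: "'w measure" and T M L :: real and K +
  fixes X :: "'w \<Rightarrow> real" and f :: "'w \<Rightarrow> real \<Rightarrow> real" and fX :: "real \<Rightarrow> real"
    and g :: "(real \<Rightarrow> real) \<Rightarrow> real \<Rightarrow> real" and \<nu> :: "real \<Rightarrow> (real \<Rightarrow> real) measure" and B :: real
  assumes X_density: "distributed P lborel X (\<lambda>u. ennreal (fX u))"
    and fX_cont: "continuous_on UNIV fX" and fX_pos: "\<And>u. fX u > 0"
    and law_X_given_f: "regular_cond_distr P (shape_borel T M L) f borel X
              (\<lambda>y. density lborel (\<lambda>u. ennreal (g y u)))"
    and g_nonneg: "\<And>y u. y \<in> shape_densities T M L \<Longrightarrow> 0 \<le> g y u"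
    and g_smooth: "\<And>y. y \<in> shape_densities T M L \<Longrightarrow> twice_continuously_differentiable (g y)"
    and g_bound: "\<And>y u. y \<in> shape_densities T M L \<Longrightarrow> \<bar>deriv (deriv (g y)) u\<bar> \<le> B"
    and law_f_given_X: "regular_cond_distr P borel X (shape_borel T M L) f \<nu>"
    and \<nu>_cont: "\<And>U. shape_open T M L U \<Longrightarrow> continuous_on UNIV (\<lambda>u. measure (\<nu> u) U)"
begin

lemma f_measurable[measurable]: "f \<in> P \<rightarrow>\<^sub>M shape_borel T M L"
  and X_measurable[measurable]: "X \<in> borel_measurable P"
  using law_f_given_X by (auto simp: regular_cond_distr_def)

lemma f_shape: "w \<in> space P \<Longrightarrow> f w \<in> shapes"
  using measurable_space[OF f_measurable] by (simp add: space_shape_borel)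

lemma \<nu>_prob: "prob_space (\<nu> u)" and \<nu>_sets: "sets (\<nu> u) = sets (shape_borel T M L)"
  using rcd_space[OF prob_space_axioms law_f_given_X, of u] by auto

lemma g_measurable[measurable]: "y \<in> shapes \<Longrightarrow> g y \<in> borel_measurable borel"
  by (rule borel_measurable_continuous_onI[OF twice_continuously_differentiable_continuous[OF g_smooth]])

text \<open>The conditional law of the covariate is a probability measure for every shape y, not
  merely for almost every one, so the Taylor bounds hold for all shapes.\<close>

lemma g_density:
  assumes y: "y \<in> shapes"
  shows g_integrable: "integrable lborel (g y)" and g_integral: "(LINT u|lborel. g y u) = 1"
proof -
  interpret D: prob_space "density lborel (\<lambda>u. ennreal (g y u))"
    by (rule rcd_space[OF prob_space_axioms law_X_given_f]) (simp add: space_shape_borel y)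
  have "(\<integral>\<^sup>+u. ennreal (g y u) \<partial>lborel) = ennreal 1"
    using D.emeasure_space_1 g_measurable[OF y] by (simp add: emeasure_density)
  then have "has_bochner_integral lborel (g y) 1"
    using g_measurable[OF y] g_nonneg[OF y] by (intro has_bochner_integral_nn_integral) auto
  then show "integrable lborel (g y)" "(LINT u|lborel. g y u) = 1" by (auto simp: has_bochner_integral_iff)
qed

lemma B_nonneg: "0 \<le> B"
proof -
  obtain w where "w \<in> space P" using not_empty by blast
  then show ?thesis using g_bound[OF f_shape, of w 0] by linarith
qed

lemma g_le: "y \<in> shapes \<Longrightarrow> g y u \<le> 1 + B"
  by (rule prob_density_bounds(1)) (auto intro: g_smooth g_bound g_nonneg g_density)

lemma integral_X_given_f:
  assumes \<phi>: "\<phi> \<in> borel_measurable (shape_borel T M L)" "\<And>y. y \<in> shapes \<Longrightarrow> \<bar>\<phi> y\<bar> \<le> a"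
    and \<psi>[measurable]: "\<psi> \<in> borel_measurable borel" and b: "\<And>u. \<bar>\<psi> u\<bar> \<le> b"
  shows "expectation (\<lambda>w. \<phi> (f w) * \<psi> (X w)) = expectation (\<lambda>w. \<phi> (f w) * (LINT u|lborel. \<psi> u * g (f w) u))"
proof -
  have "expectation (\<lambda>w. \<phi> (f w) * \<psi> (X w)) =
    expectation (\<lambda>w. \<phi> (f w) * (LINT u|density lborel (\<lambda>u. ennreal (g (f w) u)). \<psi> u))"
    using \<phi> b by (intro rcd_integral[OF prob_space_axioms law_X_given_f]) (auto simp: space_shape_borel)
  also have "\<dots> = expectation (\<lambda>w. \<phi> (f w) * (LINT u|lborel. \<psi> u * g (f w) u))"
    using g_measurable[OF f_shape] g_nonneg[OF f_shape]
    by (intro Bochner_Integration.integral_cong) (auto simp: integral_density mult.commute)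
  finally show ?thesis .
qed

lemma integral_kernel_measurable[measurable]:
  assumes \<psi>: "\<psi> \<in> borel_measurable borel"
  shows "(\<lambda>w. LINT u|lborel. \<psi> u * g (f w) u) \<in> borel_measurable P"
proof -
  have "(\<lambda>w. LINT u|density lborel (\<lambda>u. ennreal (g (f w) u)). \<psi> u) \<in> borel_measurable P"
    using \<psi> by (intro rcd_integral_measurable[OF prob_space_axioms law_X_given_f]) auto
  also have "?this \<longleftrightarrow> ?thesis"
    using g_measurable[OF f_shape] g_nonneg[OF f_shape] \<psi>
    by (intro measurable_cong) (auto simp: integral_density mult.commute)
  finally show ?thesis .
qed

lemma g_at_tendsto:
  assumes y: "y \<in> shapes"
  shows "(\<lambda>n. real (Suc n) * (LINT u|lborel. indicator {x..x + 1 / real (Suc n)} u * g y u)) \<longlonglongrightarrow> g y x"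
  by (rule average_tendsto[OF twice_continuously_differentiable_continuous[OF g_smooth[OF y]]])

text \<open>Measurability of g in the shape is not assumed. It is recovered from averages over
  shrinking intervals, which are measurable because the conditional laws form a kernel.\<close>

lemma g_at_measurable[measurable]: "(\<lambda>w. g (f w) x) \<in> borel_measurable P"
proof (rule borel_measurable_LIMSEQ_real[OF g_at_tendsto])
  show "(\<lambda>w. real (Suc n) * (LINT u|lborel. indicator {x..x + 1 / real (Suc n)} u * g (f w) u)) \<in> borel_measurable P" for n
    by measurable
qed (rule f_shape)

lemma g_average_le:
  assumes y: "y \<in> shapes"
  shows "\<bar>real (Suc n) * (LINT u|lborel. indicator {x..x + 1 / real (Suc n)} u * g y u)\<bar> \<le> 1 + B"
proof -
  have i: "integrable lborel (\<lambda>u. indicator {x..x + 1 / real (Suc n)} u * g y u)"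
    using integrable_real_mult_indicator[OF _ g_integrable[OF y], of "{x..x + 1 / real (Suc n)}"]
    by (simp add: mult.commute)
  have "(LINT u|lborel. indicator {x..x + 1 / real (Suc n)} u * g y u) \<le>
    (LINT u|lborel. indicator {x..x + 1 / real (Suc n)} u * (1 + B))"
  proof (intro integral_mono i)
    show "integrable lborel (\<lambda>u. indicator {x..x + 1 / real (Suc n)} u * (1 + B))" by simp
  qed (use g_le[OF y] in \<open>auto simp: indicator_def\<close>)
  also have "\<dots> = (1 + B) / real (Suc n)" by simp
  finally have "real (Suc n) * (LINT u|lborel. indicator {x..x + 1 / real (Suc n)} u * g y u) \<le> 1 + B"
    by (simp add: field_simps)
  moreover have "0 \<le> (LINT u|lborel. indicator {x..x + 1 / real (Suc n)} u * g y u)"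
    using g_nonneg[OF y] by (intro integral_nonneg_AE AE_I2) simp
  ultimately show ?thesis by (subst abs_of_nonneg) auto
qed

text \<open>
  Bayes' formula, pointwise rather than almost everywhere: both sides are limits of averages over
  the intervals \<open>[x, x + 1 / n]\<close> of the covariate.
\<close>

lemma expectation_g_at:
  assumes \<phi>: "\<phi> \<in> borel_measurable (shape_borel T M L)" and b: "\<And>y. y \<in> shapes \<Longrightarrow> \<bar>\<phi> y\<bar> \<le> b"
    and cont: "continuous_on UNIV (\<lambda>u. LINT y|\<nu> u. \<phi> y)"
  shows "expectation (\<lambda>w. \<phi> (f w) * g (f w) x) = fX x * (LINT y|\<nu> x. \<phi> y)"
proof -
  define I where "I n = {x..x + 1 / real (Suc n)}" for n
  define m where "m u = (LINT y|\<nu> u. \<phi> y)" for u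
  have m_meas[measurable]: "m \<in> borel_measurable borel"
    unfolding m_def by (rule borel_measurable_continuous_onI[OF cont])
  have \<phi>f[measurable]: "(\<lambda>w. \<phi> (f w)) \<in> borel_measurable P" using \<phi> by measurable
  have bf: "\<bar>\<phi> (f w)\<bar> \<le> b" if "w \<in> space P" for w using b f_shape[OF that] by auto
  have "(\<lambda>n. expectation (\<lambda>w. \<phi> (f w) * (real (Suc n) * (LINT u|lborel. indicator (I n) u * g (f w) u))))
    \<longlonglongrightarrow> expectation (\<lambda>w. \<phi> (f w) * g (f w) x)"
  proof (rule integral_dominated_convergence)
    show "integrable P (\<lambda>_. \<bar>b\<bar> * (1 + B))" by simp
    show "AE w in P. (\<lambda>n. \<phi> (f w) * (real (Suc n) * (LINT u|lborel. indicator (I n) u * g (f w) u)))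
       \<longlonglongrightarrow> \<phi> (f w) * g (f w) x"
      unfolding I_def by (intro AE_I2 tendsto_intros g_at_tendsto f_shape)
    show "AE w in P. norm (\<phi> (f w) * (real (Suc n) * (LINT u|lborel. indicator (I n) u * g (f w) u)))
       \<le> \<bar>b\<bar> * (1 + B)" for n
    proof (rule AE_I2)
      fix w assume w: "w \<in> space P"
      show "norm (\<phi> (f w) * (real (Suc n) * (LINT u|lborel. indicator (I n) u * g (f w) u))) \<le> \<bar>b\<bar> * (1 + B)"
        unfolding real_norm_def abs_mult[of "\<phi> (f w)"] I_def
        using bf[OF w] by (intro mult_mono g_average_le f_shape w) auto
    qed
  qed (simp_all add: I_def)
  moreover have "expectation (\<lambda>w. \<phi> (f w) * (real (Suc n) * (LINT u|lborel. indicator (I n) u * g (f w) u))) =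
    real (Suc n) * (LINT u|lborel. indicator (I n) u * (fX u * m u))" for n
  proof -
    \<comment> \<open>The joint expectation is evaluated twice, conditioning on the shape and then
      on the covariate.\<close>
    have "expectation (\<lambda>w. \<phi> (f w) * (real (Suc n) * (LINT u|lborel. indicator (I n) u * g (f w) u))) =
      real (Suc n) * expectation (\<lambda>w. \<phi> (f w) * (LINT u|lborel. indicator (I n) u * g (f w) u))"
      by (simp add: mult.left_commute[of _ "real (Suc n)"] del: of_nat_Suc)
    also have "expectation (\<lambda>w. \<phi> (f w) * (LINT u|lborel. indicator (I n) u * g (f w) u)) =
      expectation (\<lambda>w. \<phi> (f w) * indicator (I n) (X w))"
      by (rule integral_X_given_f[OF \<phi> b, where b=1, symmetric]) (auto simp: I_def indicator_def)
    also have "\<dots> = expectation (\<lambda>w. indicator (I n) (X w) * \<phi> (f w))" by (simp add: mult.commute)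
    also have "\<dots> = expectation (\<lambda>w. indicator (I n) (X w) * m (X w))"
      unfolding m_def using \<phi> b
      by (intro rcd_integral[OF prob_space_axioms law_f_given_X, where a=1 and b=b])
         (auto simp: space_shape_borel I_def indicator_def)
    also have "\<dots> = (LINT u|lborel. fX u * (indicator (I n) u * m u))"
      using fX_pos by (intro distributed_integral[OF X_density, symmetric]) (auto simp: I_def less_imp_le)
    finally show ?thesis by (simp add: mult_ac)
  qed
  moreover have "(\<lambda>n. real (Suc n) * (LINT u|lborel. indicator (I n) u * (fX u * m u))) \<longlonglongrightarrow> fX x * m x"
    unfolding I_def by (intro average_tendsto continuous_on_mult fX_cont) (simp add: m_def cont)
  ultimately show ?thesis unfolding m_def using LIMSEQ_unique by auto
qed

lemma expectation_g_at_1: "expectation (\<lambda>w. g (f w) x) = fX x"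
  using expectation_g_at[of "\<lambda>_. 1" 1 x] prob_space.prob_space[OF \<nu>_prob] by simp

text \<open>Weighting by \<open>g (f w) x\<close> amounts, up to the factor \<open>fX x\<close>, to
  conditioning on X = x, under which the quantile at t has mean m. This removes the leading term of
  A_0 and leaves a bias of order h^2.\<close>

lemma expectation_g_at_centred:
  assumes t: "t \<in> {0..1}"
  shows "expectation (\<lambda>w. (density_quantile T (f w) t - (LINT y|\<nu> x. density_quantile T y t)) * g (f w) x) = 0"
proof -
  define m where "m = (LINT y|\<nu> x. density_quantile T y t)"
  have cont: "continuous_on UNIV (\<lambda>u. LINT f|\<nu> u. density_quantile T f t)"
    by (rule continuous_mean_quantile[OF \<nu>_prob \<nu>_sets \<nu>_cont t])
  have int: "integrable (\<nu> u) (\<lambda>y. density_quantile T y t)" for u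
    using shape_space_axioms \<nu>_prob \<nu>_sets t
    by (intro shape_law.integrable_quantile) (auto simp: shape_law_def shape_law_axioms_def)
  have diff: "(LINT y|\<nu> u. density_quantile T y t - m) = (LINT y|\<nu> u. density_quantile T y t) - m" for u
  proof -
    interpret Q: prob_space "\<nu> u" by (rule \<nu>_prob)
    show ?thesis using int by (simp add: Q.prob_space)
  qed
  have "expectation (\<lambda>w. (density_quantile T (f w) t - m) * g (f w) x) =
    fX x * (LINT y|\<nu> x. density_quantile T y t - m)"
  proof (rule expectation_g_at)
    show "(\<lambda>y. density_quantile T y t - m) \<in> borel_measurable (shape_borel T M L)"
      using density_quantile_measurable[OF t] by simp
    show "\<bar>density_quantile T y t - m\<bar> \<le> T + \<bar>m\<bar>" if "y \<in> shapes" for y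
      using density_quantile_range[OF that t] by auto
    show "continuous_on UNIV (\<lambda>u. LINT y|\<nu> u. density_quantile T y t - m)"
      unfolding diff by (intro continuous_intros cont)
  qed
  also have "\<dots> = 0" by (simp add: diff) (simp add: m_def)
  finally show ?thesis by (simp add: m_def)
qed

section \<open>Bias and second moment of kernel-weighted variables\<close>

context
  fixes \<phi> :: "(real \<Rightarrow> real) \<Rightarrow> real" and b h kb x :: real
  assumes \<phi>: "\<phi> \<in> borel_measurable (shape_borel T M L)" and b: "\<And>y. y \<in> shapes \<Longrightarrow> \<bar>\<phi> y\<bar> \<le> b"
    and h: "0 < h" "h \<le> 1" and kb: "\<And>v. K v \<le> kb"
begin

lemma local_moment_eq:
  "expectation (\<lambda>w. kernel_scaled K h (X w - x) * (X w - x) ^ j * \<phi> (f w)) =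
   expectation (\<lambda>w. \<phi> (f w) * (LINT u|lborel. kernel_scaled K h (u - x) * (u - x) ^ j * g (f w) u))"
proof -
  have "expectation (\<lambda>w. \<phi> (f w) * (kernel_scaled K h (X w - x) * (X w - x) ^ j)) =
   expectation (\<lambda>w. \<phi> (f w) * (LINT u|lborel. kernel_scaled K h (u - x) * (u - x) ^ j * g (f w) u))"
    by (rule integral_X_given_f[OF \<phi> b _ kernel_scaled_power_le(1)[OF h(1) kb]]) auto
  then show ?thesis by (simp add: mult_ac)
qed

lemma b_nonneg: "0 \<le> b"
proof -
  obtain w where "w \<in> space P" using not_empty by blast
  then show ?thesis using b[OF f_shape, of w] by linarith
qed

text \<open>After conditioning on the shape, an approximation of the kernel integrals that is
  uniform over shapes passes to the expectation at the cost of the bound b on \<phi>.\<close>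

lemma local_moment_close:
  assumes close: "\<And>y. y \<in> shapes \<Longrightarrow>
    \<bar>(LINT u|lborel. kernel_scaled K h (u - x) * (u - x) ^ j * g y u) - c * g y x\<bar> \<le> e"
  shows "\<bar>expectation (\<lambda>w. kernel_scaled K h (X w - x) * (X w - x) ^ j * \<phi> (f w)) -
    c * expectation (\<lambda>w. \<phi> (f w) * g (f w) x)\<bar> \<le> b * e"
proof -
  define H where "H w = (LINT u|lborel. kernel_scaled K h (u - x) * (u - x) ^ j * g (f w) u)" for w
  have [measurable]: "H \<in> borel_measurable P" unfolding H_def[abs_def] by measurable
  have [measurable]: "(\<lambda>w. \<phi> (f w)) \<in> borel_measurable P" using \<phi> by measurable
  have e: "0 \<le> e"
  proof -
    obtain w where "w \<in> space P" using not_empty by blast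
    then show ?thesis using close[OF f_shape, of w] by linarith
  qed
  have iHg: "integrable P (\<lambda>w. \<phi> (f w) * (H w - c * g (f w) x))"
    by (rule integrable_bounded_mult[where a=b and b=e]) (auto simp: b f_shape H_def close)
  have ig: "integrable P (\<lambda>w. \<phi> (f w) * g (f w) x)"
    by (rule integrable_bounded_mult[where a=b and b="1 + B"]) (auto simp: b f_shape g_le g_nonneg)
  have "expectation (\<lambda>w. \<phi> (f w) * H w) = expectation (\<lambda>w. \<phi> (f w) * (H w - c * g (f w) x) + c * (\<phi> (f w) * g (f w) x))"
    by (simp add: algebra_simps)
  also have "\<dots> = expectation (\<lambda>w. \<phi> (f w) * (H w - c * g (f w) x)) + c * expectation (\<lambda>w. \<phi> (f w) * g (f w) x)"
    using iHg ig by simp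
  finally have "\<bar>expectation (\<lambda>w. \<phi> (f w) * H w) - c * expectation (\<lambda>w. \<phi> (f w) * g (f w) x)\<bar> =
    \<bar>expectation (\<lambda>w. \<phi> (f w) * (H w - c * g (f w) x))\<bar>" by simp
  also have "\<dots> \<le> expectation (\<lambda>w. \<bar>\<phi> (f w) * (H w - c * g (f w) x)\<bar>)" by (rule integral_abs_bound)
  also have "\<dots> \<le> expectation (\<lambda>w. b * e)"
    unfolding abs_mult using iHg b f_shape close b_nonneg
    by (intro integral_mono mult_mono) (auto simp: H_def abs_mult[symmetric])
  also have "\<dots> = b * e" by (simp add: prob_space)
  finally show ?thesis unfolding local_moment_eq H_def .
qed

lemma local_moment_bias:
  "\<bar>expectation (\<lambda>w. kernel_scaled K h (X w - x) * (X w - x) ^ j * \<phi> (f w)) -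
    h ^ j * k_moment j * expectation (\<lambda>w. \<phi> (f w) * g (f w) x)\<bar> \<le> b * ((1 + 3 * B) * h ^ Suc j)"
  by (intro local_moment_close kernel_scaled_density(1) g_smooth g_bound g_nonneg g_density h)

lemma local_moment_bias_0:
  "\<bar>expectation (\<lambda>w. kernel_scaled K h (X w - x) * \<phi> (f w)) - expectation (\<lambda>w. \<phi> (f w) * g (f w) x)\<bar> \<le> b * (B * h\<^sup>2)"
  using local_moment_close[of 0 1 "B * h\<^sup>2"]
    kernel_scaled_density(2)[OF g_smooth g_bound g_nonneg g_density h] by simp

lemma expectation_kernel_le: "expectation (\<lambda>w. kernel_scaled K h (X w - x)) \<le> 1 + B"
proof -
  have "expectation (\<lambda>w. kernel_scaled K h (X w - x)) = expectation (\<lambda>w. 1 * kernel_scaled K h (X w - x))" by simp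
  also have "\<dots> = expectation (\<lambda>w. 1 * (LINT u|lborel. kernel_scaled K h (u - x) * g (f w) u))"
    using kernel_scaled_power_le(1)[OF h(1) kb, of _ 0]
    by (intro integral_X_given_f[where a=1]) auto
  also have "\<dots> \<le> expectation (\<lambda>w. 1 + B)"
  proof (rule integral_mono)
    have le: "\<bar>LINT u|lborel. kernel_scaled K h (u - x) * g (f w) u\<bar> \<le> 1 + B" if "w \<in> space P" for w
      using kernel_scaled_integral[OF h(1), of x 0 "g (f w)"]
        K_weighted_le[of "\<lambda>v. g (f w) (x + h * v)" "1 + B"] g_measurable[OF f_shape[OF that]]
        g_le[OF f_shape[OF that]] g_nonneg[OF f_shape[OF that]] by simp
    show "integrable P (\<lambda>w. 1 * (LINT u|lborel. kernel_scaled K h (u - x) * g (f w) u))"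
      using le by (intro integrable_const_bound[where B="1 + B"]) auto
    show "1 * (LINT u|lborel. kernel_scaled K h (u - x) * g (f w) u) \<le> 1 + B" if "w \<in> space P" for w
      using le[OF that] by simp
  qed simp
  finally show ?thesis by (simp add: prob_space)
qed

text \<open>\<phi> contributes b^2, one kernel factor is bounded by kb/h, and the other has
  expectation at most 1 + B.\<close>

lemma local_moment_sq:
  "expectation (\<lambda>w. (kernel_scaled K h (X w - x) * (X w - x) ^ j * \<phi> (f w))\<^sup>2) \<le>
   b\<^sup>2 * (kb * (1 + B)) * h ^ (2 * j) / h"
proof -
  have [measurable]: "(\<lambda>w. \<phi> (f w)) \<in> borel_measurable P" using \<phi> by measurable
  have kb0: "0 \<le> kb" using kb[of 0] K_nonneg[of 0] by linarith
  define c where "c = kb / h * h ^ (2 * j) * b\<^sup>2"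
  have c: "0 \<le> c" using kb0 h by (simp add: c_def)
  have le: "(kernel_scaled K h (X w - x) * (X w - x) ^ j * \<phi> (f w))\<^sup>2 \<le> c * kernel_scaled K h (X w - x)"
    if "w \<in> space P" for w
  proof -
    have "(\<phi> (f w))\<^sup>2 \<le> b\<^sup>2" using b[OF f_shape[OF that]] by (simp add: abs_le_square_iff[symmetric] b_nonneg)
    then have "(kernel_scaled K h (X w - x) * (X w - x) ^ j)\<^sup>2 * (\<phi> (f w))\<^sup>2 \<le>
      (kb / h * h ^ (2 * j) * kernel_scaled K h (X w - x)) * b\<^sup>2"
      using kernel_scaled_power_le(2)[OF h(1) kb] kb0 h kernel_scaled_nonneg[OF h(1)] by (intro mult_mono) auto
    then show ?thesis by (simp add: c_def power_mult_distrib mult_ac)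
  qed
  have ik: "integrable P (\<lambda>w. kernel_scaled K h (X w - x))"
    using kernel_scaled_power_le(1)[OF h(1) kb, of _ 0]
    by (intro integrable_const_bound[where B="kb / h"]) auto
  have "expectation (\<lambda>w. (kernel_scaled K h (X w - x) * (X w - x) ^ j * \<phi> (f w))\<^sup>2) \<le>
    expectation (\<lambda>w. c * kernel_scaled K h (X w - x))"
  proof (rule integral_mono)
    show "integrable P (\<lambda>w. (kernel_scaled K h (X w - x) * (X w - x) ^ j * \<phi> (f w))\<^sup>2)"
      by (rule Bochner_Integration.integrable_bound[of _ "\<lambda>w. c * kernel_scaled K h (X w - x)"])
         (use ik le c kernel_scaled_nonneg[OF h(1)] in \<open>auto intro!: AE_I2\<close>)
  qed (use ik le in auto)
  also have "\<dots> \<le> c * (1 + B)" using expectation_kernel_le c by (simp add: mult_left_mono)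
  finally show ?thesis by (simp add: c_def mult_ac)
qed

end

end

section \<open>Measurable functions of random intensities\<close>

abbreviation (input) data_space :: "real \<Rightarrow> (real \<times> (real \<Rightarrow> real)) measure" where
  "data_space T \<equiv> borel \<Otimes>\<^sub>M intensity_space T"

lemma space_intensity_space:
  "space (intensity_space T) = {l. (\<forall>t\<in>{0..T}. 0 \<le> l t) \<and> set_integrable lborel {0..T} l}"
  unfolding intensity_space_def by (subst space_Sup_eq_UN) auto

lemma set_integral_measurable:
  assumes "A \<in> sets borel" "A \<subseteq> {0..T}"
  shows "(\<lambda>l. LINT t:A|lborel. l t) \<in> borel_measurable (intensity_space T)"
proof -
  have "(\<lambda>l. LINT t:A \<inter> {0..T}|lborel. l t) \<in> borel_measurable (intensity_space T)"
    unfolding intensity_space_def using assms(1)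
    by (rule measurable_SUP1) (auto intro!: measurable_vimage_algebra1)
  moreover have "A \<inter> {0..T} = A" using assms(2) by auto
  ultimately show ?thesis by simp
qed

lemma total_intensity_measurable[measurable]: "total_intensity T \<in> borel_measurable (intensity_space T)"
  unfolding total_intensity_def[abs_def] by (rule set_integral_measurable) auto

lemma set_integral_intensity_bounds:
  assumes l: "l \<in> space (intensity_space T)" and A: "A \<in> sets borel" "A \<subseteq> {0..T}"
  shows "0 \<le> (LINT t:A|lborel. l t)" "(LINT t:A|lborel. l t) \<le> total_intensity T l"
proof -
  have nn: "\<And>t. t \<in> {0..T} \<Longrightarrow> 0 \<le> l t" and i: "set_integrable lborel {0..T} l"
    using l by (auto simp: space_intensity_space)
  show "0 \<le> (LINT t:A|lborel. l t)"
    unfolding set_lebesgue_integral_def using A nn by (intro integral_nonneg_AE AE_I2) (auto simp: indicator_def)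
  show "(LINT t:A|lborel. l t) \<le> total_intensity T l"
    unfolding total_intensity_def set_lebesgue_integral_def
  proof (rule integral_mono)
    show "integrable lborel (\<lambda>t. indicator A t *\<^sub>R l t)" "integrable lborel (\<lambda>t. indicator {0..T} t *\<^sub>R l t)"
      using set_integrable_subset[OF i] A i by (auto simp: set_integrable_def)
    show "indicator A t *\<^sub>R l t \<le> indicator {0..T} t *\<^sub>R l t" for t using A nn by (auto simp: indicator_def)
  qed
qed

lemma intensity_shape_density:
  assumes l: "l \<in> space (intensity_space T)" and \<tau>: "0 < total_intensity T l"
  shows "prob_density_on T (intensity_shape T l)"
  using l \<tau> unfolding prob_density_on_def intensity_shape_def space_intensity_space
  by (auto simp: total_intensity_def)

lemma cdf_intensity_shape:
  assumes l: "l \<in> space (intensity_space T)" and \<tau>: "0 < total_intensity T l" and u: "u \<in> {0..T}"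
  shows "cdf (density_measure T (intensity_shape T l)) u = (LINT t:{0..u}|lborel. l t) / total_intensity T l"
proof -
  have "{..u} \<inter> {0..T} = {0..u}" using u by auto
  then have "cdf (density_measure T (intensity_shape T l)) u = (LINT t:{0..u}|lborel. intensity_shape T l t)"
    unfolding cdf_density_measure[OF intensity_shape_density[OF l \<tau>]] by (simp only:)
  then show ?thesis by (simp add: intensity_shape_def)
qed

section \<open>Quantiles and shape constraints as functions of the intensity\<close>

context shape_space
begin

text \<open>The default 0 for vanishing total intensity keeps the range in [0,T] and the
  monotonicity in t, so that measurability can be stated on the whole intensity space.\<close>

definition intensity_quantile :: "real \<Rightarrow> (real \<Rightarrow> real) \<Rightarrow> real" where
  "intensity_quantile t l = (if 0 < total_intensity T l then density_quantile T (intensity_shape T l) t else 0)"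

lemma intensity_quantile_bounds:
  assumes l: "l \<in> space (intensity_space T)"
  shows "t \<in> {0..1} \<Longrightarrow> intensity_quantile t l \<in> {0..T}"
    and "mono_on {0..1} (\<lambda>t. intensity_quantile t l)"
proof -
  have *: "1 \<le> cdf (density_measure T (intensity_shape T l)) T" if "0 < total_intensity T l"
    using cdf_density_measure_T[OF intensity_shape_density[OF l that]] by simp
  show "t \<in> {0..1} \<Longrightarrow> intensity_quantile t l \<in> {0..T}"
    unfolding intensity_quantile_def density_quantile_def
    using quantile_fun_range[OF less_imp_le[OF T_pos] *] T_pos by auto
  show "mono_on {0..1} (\<lambda>t. intensity_quantile t l)"
    using quantile_fun_mono[OF less_imp_le[OF T_pos] *]
    unfolding intensity_quantile_def density_quantile_def by (auto simp: mono_on_def)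
qed

text \<open>The Galois connection turns a sublevel set at a into a condition on the integral of l
  over [0,a], and such integrals generate the sigma-algebra.\<close>

lemma intensity_quantile_measurable:
  assumes t: "t \<in> {0..1}"
  shows "intensity_quantile t \<in> borel_measurable (intensity_space T)"
  unfolding borel_measurable_iff_le
proof
  fix a :: real
  \<comment> \<open>Clamping a to [0,T] makes the interval admissible whatever a is; only the case
    of a inside the range uses it.\<close>
  have [measurable]: "(\<lambda>l. LINT t:{0..max 0 (min T a)}|lborel. l t) \<in> borel_measurable (intensity_space T)"
    by (rule set_integral_measurable) (use T_pos in auto)
  consider "a < 0" | "T \<le> a" | "0 \<le> a" "a < T" by linarith
  then show "{l \<in> space (intensity_space T). intensity_quantile t l \<le> a} \<in> sets (intensity_space T)"
  proof cases
    case 1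
    then have "{l \<in> space (intensity_space T). intensity_quantile t l \<le> a} = {}"
      using intensity_quantile_bounds(1)[OF _ t] by fastforce
    then show ?thesis by (simp only: sets.empty_sets)
  next
    case 2
    then have "{l \<in> space (intensity_space T). intensity_quantile t l \<le> a} = space (intensity_space T)"
      using intensity_quantile_bounds(1)[OF _ t] by fastforce
    then show ?thesis by (simp only: sets.top)
  next
    case 3
    have "{l \<in> space (intensity_space T). intensity_quantile t l \<le> a} =
      {l \<in> space (intensity_space T). 0 < total_intensity T l \<longrightarrow>
         t \<le> (LINT t:{0..max 0 (min T a)}|lborel. l t) / total_intensity T l}"
    proof (intro Collect_cong conj_cong refl)
      fix l assume l: "l \<in> space (intensity_space T)"
      show "intensity_quantile t l \<le> a \<longleftrightarrow> (0 < total_intensity T l \<longrightarrow>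
         t \<le> (LINT t:{0..max 0 (min T a)}|lborel. l t) / total_intensity T l)"
      proof (cases "0 < total_intensity T l")
        case True
        note pd = intensity_shape_density[OF l True]
        show ?thesis using True 3 t T_pos cdf_intensity_shape[OF l True, of a]
          quantile_fun_le_iff[OF real_distribution_density_measure[OF pd] _ cdf_density_measure_T[OF pd] t, of a]
          by (simp add: intensity_quantile_def density_quantile_def)
      qed (use 3 in \<open>auto simp: intensity_quantile_def\<close>)
    qed
    also have "\<dots> \<in> sets (intensity_space T)" by measurable
    finally show ?thesis .
  qed
qed

definition good_intensities :: "real \<Rightarrow> (real \<Rightarrow> real) set" where
  "good_intensities \<kappa> = {l \<in> space (intensity_space T). \<kappa> \<le> total_intensity T l \<and> intensity_shape T l \<in> shapes}"

text \<open>
  By monotonicity of quantile functions, the bi-Lipschitz bounds need only be checked at rational points.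
\<close>

lemma good_intensities_sets:
  assumes \<kappa>: "0 < \<kappa>"
  shows "good_intensities \<kappa> \<in> sets (intensity_space T)"
proof -
  define D where "D = \<rat> \<inter> {0..1::real}"
  have D: "countable D" "D \<subseteq> {0..1}" "0 \<in> D" "1 \<in> D" unfolding D_def by (auto intro: countable_rat)
  \<comment> \<open>The endpoints 0 and 1 belong to D, so at them the point itself is taken.\<close>
  have below: "\<exists>p\<in>D. p \<le> t \<and> t - e < p" and above: "\<exists>p\<in>D. t \<le> p \<and> p < t + e" if "t \<in> {0..1}" "0 < e" for t e
  proof -
    show "\<exists>p\<in>D. p \<le> t \<and> t - e < p"
    proof (cases "t = 0")
      case False
      then have "max 0 (t - e) < t" using that by auto
      then obtain p where "p \<in> \<rat>" "max 0 (t - e) < p" "p < t" using Rats_dense_in_real by blast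
      then show ?thesis using that by (intro bexI[of _ p]) (auto simp: D_def)
    qed (use that D in auto)
    show "\<exists>p\<in>D. t \<le> p \<and> p < t + e"
    proof (cases "t = 1")
      case False
      then have "t < min 1 (t + e)" using that by auto
      then obtain p where "p \<in> \<rat>" "t < p" "p < min 1 (t + e)" using Rats_dense_in_real by blast
      then show ?thesis using that by (intro bexI[of _ p]) (auto simp: D_def)
    qed (use that D in auto)
  qed
  have "good_intensities \<kappa> = {l \<in> space (intensity_space T). \<kappa> \<le> total_intensity T l \<and>
     intensity_quantile 0 l = 0 \<and> intensity_quantile 1 l = T \<and>
     (\<forall>s\<in>D. \<forall>t\<in>D. s \<le> t \<longrightarrow> M * (t - s) \<le> intensity_quantile t l - intensity_quantile s l \<and>
        intensity_quantile t l - intensity_quantile s l \<le> L * (t - s))}"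
    unfolding good_intensities_def
  proof (intro Collect_cong conj_cong refl)
    fix l assume l: "l \<in> space (intensity_space T)" and "\<kappa> \<le> total_intensity T l"
    then have \<tau>: "0 < total_intensity T l" using \<kappa> by simp
    define q where "q = density_quantile T (intensity_shape T l)"
    have q: "intensity_quantile t l = q t" for t using \<tau> by (simp add: intensity_quantile_def q_def)
    have mono: "q s \<le> q t" if "0 \<le> s" "s \<le> t" "t \<le> 1" for s t
      using mono_onD[OF intensity_quantile_bounds(2)[OF l], of s t] that by (simp add: q)
    have "intensity_shape T l \<in> shapes \<longleftrightarrow> q \<in> shape_quantiles T M L"
      using intensity_shape_density[OF l \<tau>] by (simp add: shape_densities_def q_def)
    also have "\<dots> \<longleftrightarrow> q 0 = 0 \<and> q 1 = T \<and>
     (\<forall>s\<in>D. \<forall>t\<in>D. s \<le> t \<longrightarrow> M * (t - s) \<le> q t - q s \<and> q t - q s \<le> L * (t - s))"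
    proof
      assume "q \<in> shape_quantiles T M L"
      then show "q 0 = 0 \<and> q 1 = T \<and>
        (\<forall>s\<in>D. \<forall>t\<in>D. s \<le> t \<longrightarrow> M * (t - s) \<le> q t - q s \<and> q t - q s \<le> L * (t - s))"
        using shape_quantile_incr[of q] shape_quantile_0[of q] shape_quantile_1[of q] D(2) by (meson atLeastAtMost_iff subsetD)
    next
      assume *: "q 0 = 0 \<and> q 1 = T \<and>
        (\<forall>s\<in>D. \<forall>t\<in>D. s \<le> t \<longrightarrow> M * (t - s) \<le> q t - q s \<and> q t - q s \<le> L * (t - s))"
      show "q \<in> shape_quantiles T M L"
      proof (rule shape_quantileI)
        show "q \<in> extensional {0..1}" unfolding q_def density_quantile_def by (rule quantile_fun_extensional)
        fix s t :: real assume st: "0 \<le> s" "s \<le> t" "t \<le> 1"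
        show "M * (t - s) \<le> q t - q s \<and> q t - q s \<le> L * (t - s)"
        proof
          show "q t - q s \<le> L * (t - s)"
          proof (rule field_le_epsilon)
            fix e :: real assume "0 < e"
            then have e: "0 < e / (2 * L)" using L_pos by simp
            obtain s' where s': "s' \<in> D" "s' \<le> s" "s - e / (2 * L) < s'" using below[OF _ e, of s] st by auto
            obtain t' where t': "t' \<in> D" "t \<le> t'" "t' < t + e / (2 * L)" using above[OF _ e, of t] st by auto
            \<comment> \<open>For the upper bound the interval is widened to rational endpoints, for
              the lower bound below it is shrunk.\<close>
            have "q t - q s \<le> q t' - q s'" using mono[of t t'] mono[of s' s] s' t' st D(2) by fastforce
            also have "\<dots> \<le> L * (t' - s')" using * s' t' st by auto
            also have "\<dots> \<le> L * ((t - s) + e / L)" using s' t' L_pos by (intro mult_left_mono) auto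
            also have "\<dots> = L * (t - s) + e" using L_pos by (simp add: distrib_left)
            finally show "q t - q s \<le> L * (t - s) + e" .
          qed
          show "M * (t - s) \<le> q t - q s"
          proof (rule field_le_epsilon)
            fix e :: real assume e0: "0 < e"
            then have e: "0 < e / (2 * M)" using M_pos by simp
            obtain s' where s': "s' \<in> D" "s \<le> s'" "s' < s + e / (2 * M)" using above[OF _ e, of s] st by auto
            obtain t' where t': "t' \<in> D" "t' \<le> t" "t - e / (2 * M) < t'" using below[OF _ e, of t] st by auto
            have "M * (t - s) \<le> M * ((t' - s') + e / M)" using s' t' M_pos by (intro mult_left_mono) auto
            also have "\<dots> = M * (t' - s') + e" using M_pos by (simp add: distrib_left)
            \<comment> \<open>Shrinking may make the endpoints cross; then the left side is negative
              and monotonicity suffices.\<close>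
            also have "M * (t' - s') \<le> q t - q s"
            proof (cases "s' \<le> t'")
              case True
              have "M * (t' - s') \<le> q t' - q s'" using * s' t' True by auto
              also have "\<dots> \<le> q t - q s" using mono[of t' t] mono[of s s'] s' t' st D(2) by fastforce
              finally show ?thesis .
            next
              case False
              then have "M * (t' - s') \<le> 0" using M_pos by (simp add: mult_le_0_iff)
              then show ?thesis using mono[of s t] st by simp
            qed
            finally show "M * (t - s) \<le> q t - q s + e" by simp
          qed
        qed
      qed (use * in auto)
    qed
    finally show "intensity_shape T l \<in> shapes \<longleftrightarrow>
      intensity_quantile 0 l = 0 \<and> intensity_quantile 1 l = T \<and>
      (\<forall>s\<in>D. \<forall>t\<in>D. s \<le> t \<longrightarrow> M * (t - s) \<le> intensity_quantile t l - intensity_quantile s l \<and>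
        intensity_quantile t l - intensity_quantile s l \<le> L * (t - s))"
      unfolding q .
  qed
  also have "\<dots> \<in> sets (intensity_space T)"
  proof -
    have [measurable]: "intensity_quantile 0 \<in> borel_measurable (intensity_space T)"
      "intensity_quantile 1 \<in> borel_measurable (intensity_space T)"
      by (rule intensity_quantile_measurable; simp)+
    have [measurable]: "intensity_quantile t \<in> borel_measurable (intensity_space T)" if "t \<in> D" for t
      using that D by (intro intensity_quantile_measurable) auto
    have "Measurable.pred (intensity_space T) (\<lambda>l. \<forall>s\<in>D. \<forall>t\<in>D. s \<le> t \<longrightarrow>
       M * (t - s) \<le> intensity_quantile t l - intensity_quantile s l \<and>
        intensity_quantile t l - intensity_quantile s l \<le> L * (t - s))"
      by (rule measurable_pred_countable(1)[OF D(1)], rule measurable_pred_countable(1)[OF D(1)]) measurable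
    then show ?thesis by measurable
  qed
  finally show ?thesis .
qed

end

section \<open>Mean square error of conditional Poisson counts\<close>

definition count_mean :: "real \<Rightarrow> real set \<Rightarrow> real \<times> (real \<Rightarrow> real) \<Rightarrow> real" where
  "count_mean a A z = a * (LINT t:A|lborel. snd z t)"

lemma poisson_prob_nonneg: "0 \<le> r \<Longrightarrow> 0 \<le> poisson_prob r m"
  by (simp add: poisson_prob_def)

text \<open>From the factorial moments r and r^2, using (m - r)^2 = m(m - 1) + (1 - 2r)m + r^2. The
  rate r = 0 is included.\<close>

lemma poisson_prob_variance: "(\<lambda>m. (real m - r)\<^sup>2 * poisson_prob r m) sums r"
proof -
  have e: "(\<lambda>m. r ^ m / fact m) sums exp r"
    using exp_converges[of r] by (simp add: field_simps)
  have e1: "(\<lambda>m. real m * (r ^ m / fact m)) sums (r * exp r)"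
  proof -
    have "(\<lambda>m. real (Suc m) * (r ^ Suc m / fact (Suc m))) = (\<lambda>m. r * (r ^ m / fact m))"
      by (auto simp: fact_Suc simp del: of_nat_Suc)
    then have "(\<lambda>m. real (Suc m) * (r ^ Suc m / fact (Suc m))) sums (r * exp r)"
      using sums_mult[OF e, of r] by (simp only:)
    from sums_Suc[OF this] show ?thesis by simp
  qed
  have e2: "(\<lambda>m. real m * (real m - 1) * (r ^ m / fact m)) sums (r\<^sup>2 * exp r)"
  proof -
    have "(\<lambda>m. real (Suc m) * (real (Suc m) - 1) * (r ^ Suc m / fact (Suc m))) = (\<lambda>m. r * (real m * (r ^ m / fact m)))"
    proof
      fix m
      have 1: "real (Suc m) * (r ^ Suc m / fact (Suc m)) = r * (r ^ m / fact m)"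
        by (simp add: fact_Suc del: of_nat_Suc)
      have "real (Suc m) * (real (Suc m) - 1) * (r ^ Suc m / fact (Suc m)) =
        (real (Suc m) - 1) * (real (Suc m) * (r ^ Suc m / fact (Suc m)))"
        by (simp only: mult_ac)
      then show "real (Suc m) * (real (Suc m) - 1) * (r ^ Suc m / fact (Suc m)) = r * (real m * (r ^ m / fact m))"
        unfolding 1 by simp
    qed
    then have "(\<lambda>m. real (Suc m) * (real (Suc m) - 1) * (r ^ Suc m / fact (Suc m))) sums (r * (r * exp r))"
      using sums_mult[OF e1, of r] by (simp only:)
    from sums_Suc[OF this] show ?thesis by (simp add: power2_eq_square mult.assoc)
  qed
  have "(\<lambda>m. (real m * (real m - 1) * (r ^ m / fact m) + (1 - 2 * r) * (real m * (r ^ m / fact m)) +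
     r\<^sup>2 * (r ^ m / fact m)) * exp (- r)) sums
     ((r\<^sup>2 * exp r + (1 - 2 * r) * (r * exp r) + r\<^sup>2 * exp r) * exp (- r))"
    by (intro sums_mult2 sums_add sums_mult e e1 e2)
  also have "(\<lambda>m. (real m * (real m - 1) * (r ^ m / fact m) + (1 - 2 * r) * (real m * (r ^ m / fact m)) +
     r\<^sup>2 * (r ^ m / fact m)) * exp (- r)) = (\<lambda>m. (real m - r)\<^sup>2 * poisson_prob r m)"
    unfolding poisson_prob_def by (rule ext) (simp add: power2_eq_square algebra_simps add_divide_distrib diff_divide_distrib)
  also have "(r\<^sup>2 * exp r + (1 - 2 * r) * (r * exp r) + r\<^sup>2 * exp r) * exp (- r) = r * (exp r * exp (- r))"
    by (simp add: power2_eq_square algebra_simps)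
  also have "\<dots> = r" by (simp flip: exp_add)
  finally show ?thesis .
qed

context
  fixes P :: "'w measure" and T a :: real and n :: nat and Z :: "nat \<Rightarrow> 'w \<Rightarrow> real \<times> (real \<Rightarrow> real)" and N
  assumes P: "prob_space P" and Z: "\<And>i. i < n \<Longrightarrow> Z i \<in> P \<rightarrow>\<^sub>M borel \<Otimes>\<^sub>M intensity_space T" and a: "0 < a"
    and N: "cond_poisson_processes P T a n Z N"
begin

interpretation prob_space P by (rule P)

lemma data_map_measurable: "(\<lambda>w. \<lambda>i\<in>{..<n}. Z i w) \<in> P \<rightarrow>\<^sub>M PiM {..<n} (\<lambda>_. data_space T)"
  by (rule measurable_restrict) (use Z in auto)

lemma data_subalgebra: "subalgebra P (data_algebra P T n Z)"
  using data_map_measurable unfolding subalgebra_def data_algebra_def measurable_iff_sets by auto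

lemma Z_data_measurable:
  assumes i: "i < n"
  shows "Z i \<in> data_algebra P T n Z \<rightarrow>\<^sub>M data_space T"
proof -
  have "(\<lambda>w. \<lambda>i\<in>{..<n}. Z i w) \<in> data_algebra P T n Z \<rightarrow>\<^sub>M PiM {..<n} (\<lambda>_. data_space T)"
    unfolding data_algebra_def using data_map_measurable
    by (intro measurable_vimage_algebra1) (auto dest: measurable_space)
  from measurable_compose[OF this measurable_component_singleton[of i]] show ?thesis using i by simp
qed

context
  fixes i A assumes i: "i < n" and A: "A \<in> sets borel" "A \<subseteq> {0..T}"
begin

lemma count_mean_measurable: "count_mean a A \<in> borel_measurable (data_space T)"
  unfolding count_mean_def[abs_def]
  by (intro borel_measurable_times borel_measurable_const measurable_compose[OF measurable_snd set_integral_measurable[OF A]])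

lemma count_mean_nonneg:
  assumes "w \<in> space P"
  shows "0 \<le> count_mean a A (Z i w)"
proof -
  have "snd (Z i w) \<in> space (intensity_space T)"
    using measurable_space[OF Z[OF i] assms] by (auto simp: space_pair_measure mem_Times_iff)
  then show ?thesis unfolding count_mean_def using a
    by (intro mult_nonneg_nonneg set_integral_intensity_bounds(1)[OF _ A]) auto
qed

lemma count_measurable: "(\<lambda>w. points_in (N i w) A) \<in> P \<rightarrow>\<^sub>M count_space UNIV"
  using N i A unfolding cond_poisson_processes_def by auto

text \<open>The event that \<open>Z i\<close> lies in D belongs to the data algebra, so the
  conditional expectation of the count event can be integrated over it.\<close>

lemma count_prob:
  assumes D: "D \<in> sets (data_space T)"
  shows "emeasure P {w \<in> space P. Z i w \<in> D \<and> points_in (N i w) A = m} =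
    (\<integral>\<^sup>+w. indicator D (Z i w) * ennreal (poisson_prob (count_mean a A (Z i w)) m) \<partial>P)"
proof -
  interpret F: finite_measure_subalgebra P "data_algebra P T n Z"
    by (unfold_locales) (rule data_subalgebra)
  note [measurable] = Z[OF i] D count_mean_measurable count_measurable
  define E where "E = {w \<in> space P. points_in (N i w) A = m}"
  have E[measurable]: "E \<in> sets P" unfolding E_def by measurable
  \<comment> \<open>The joint law is specialised to one set per process: the other processes receive
    the empty set and count 0, whose factor is \<open>poisson_prob 0 0 = 1\<close>.\<close>
  define A' where "A' i' j = (if i' = i then A else {})" for i' and j :: nat
  define m' where "m' i' j = (if i' = i then m else 0)" for i' and j :: nat
  have "AE w in P. real_cond_exp P (data_algebra P T n Z)
      (indicator {w \<in> space P. \<forall>i<n. \<forall>j<1. points_in (N i w) (A' i j) = m' i j}) w =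
     (\<Prod>i<n. \<Prod>j<1. poisson_prob (a * (LINT t:A' i j|lborel. snd (Z i w) t)) (m' i j))"
  proof -
    have "\<forall>i<n. disjoint_family_on (A' i) {..<1} \<and> (\<forall>j<1. A' i j \<in> sets borel \<and> A' i j \<subseteq> {0..T})"
      using A by (auto simp: A'_def disjoint_family_on_def)
    then show ?thesis
      using N[unfolded cond_poisson_processes_def, THEN conjunct2, rule_format, of A' 1 m'] by blast
  qed
  moreover have "{w \<in> space P. \<forall>i<n. \<forall>j<1. points_in (N i w) (A' i j) = m' i j} = E"
    using i by (auto simp: E_def A'_def m'_def points_in_def)
  moreover have "(\<Prod>i<n. \<Prod>j<1. poisson_prob (a * (LINT t:A' i j|lborel. snd (Z i w) t)) (m' i j)) =
     poisson_prob (count_mean a A (Z i w)) m" for w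
  proof -
    have "(\<Prod>i'<n. \<Prod>j<1. poisson_prob (a * (LINT t:A' i' j|lborel. snd (Z i' w) t)) (m' i' j)) =
      (\<Prod>i'<n. if i' = i then poisson_prob (count_mean a A (Z i w)) m else 1)"
      by (rule prod.cong) (auto simp: A'_def m'_def count_mean_def poisson_prob_def set_lebesgue_integral_def)
    also have "\<dots> = poisson_prob (count_mean a A (Z i w)) m" using i by (simp add: prod.delta)
    finally show ?thesis .
  qed
  ultimately have ae: "AE w in P. real_cond_exp P (data_algebra P T n Z) (indicator E) w = poisson_prob (count_mean a A (Z i w)) m"
    by simp
  have int: "integrable P (\<lambda>w. indicator D (Z i w) * indicator E w :: real)"
    by (rule integrable_bounded_mult[where a=1 and b=1]) auto
  have DF: "(\<lambda>w. indicator D (Z i w) :: real) \<in> borel_measurable (data_algebra P T n Z)"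
    using Z_data_measurable[OF i] D by measurable
  have pm[measurable]: "(\<lambda>w. poisson_prob (count_mean a A (Z i w)) m) \<in> borel_measurable P"
    unfolding poisson_prob_def by measurable
  have 1: "(LINT w|P. indicator D (Z i w) * real_cond_exp P (data_algebra P T n Z) (indicator E) w) =
     (LINT w|P. indicator D (Z i w) * indicator E w)"
    and 2: "integrable P (\<lambda>w. indicator D (Z i w) * real_cond_exp P (data_algebra P T n Z) (indicator E) w)"
    using F.real_cond_exp_intg[OF int DF] by auto
  have ae': "AE w in P. indicator D (Z i w) * real_cond_exp P (data_algebra P T n Z) (indicator E) w =
     indicator D (Z i w) * poisson_prob (count_mean a A (Z i w)) m"
    using ae by eventually_elim simp
  have i3: "integrable P (\<lambda>w. indicator D (Z i w) * poisson_prob (count_mean a A (Z i w)) m)"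
    using 2 ae' by (subst integrable_cong_AE[symmetric]) auto
  have "measure P {w \<in> space P. Z i w \<in> D \<and> points_in (N i w) A = m} = (LINT w|P. indicator D (Z i w) * indicator E w)"
  proof -
    have "(LINT w|P. indicator D (Z i w) * indicator E w :: real) =
      (LINT w|P. indicator {w \<in> space P. Z i w \<in> D \<and> points_in (N i w) A = m} w)"
      by (rule Bochner_Integration.integral_cong) (auto simp: indicator_def E_def)
    also have "\<dots> = measure P {w \<in> space P. Z i w \<in> D \<and> points_in (N i w) A = m}"
      by (subst Bochner_Integration.integral_indicator) (auto intro!: arg_cong[where f="measure P"])
    finally show ?thesis by simp
  qed
  also have "\<dots> = (LINT w|P. indicator D (Z i w) * poisson_prob (count_mean a A (Z i w)) m)"
    unfolding 1[symmetric] using ae' 2 by (intro Bochner_Integration.integral_cong_AE) auto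
  finally have "emeasure P {w \<in> space P. Z i w \<in> D \<and> points_in (N i w) A = m} =
     ennreal (LINT w|P. indicator D (Z i w) * poisson_prob (count_mean a A (Z i w)) m)"
    by (simp add: emeasure_eq_measure)
  also have "\<dots> = (\<integral>\<^sup>+w. ennreal (indicator D (Z i w) * poisson_prob (count_mean a A (Z i w)) m) \<partial>P)"
    using count_mean_nonneg by (intro nn_integral_eq_integral[symmetric] i3 AE_I2 mult_nonneg_nonneg poisson_prob_nonneg) auto
  also have "\<dots> = (\<integral>\<^sup>+w. indicator D (Z i w) * ennreal (poisson_prob (count_mean a A (Z i w)) m) \<partial>P)"
    by (intro nn_integral_cong) (auto simp: indicator_def)
  finally show ?thesis .
qed

text \<open>\<open>count_prob\<close> says that two measures on the data space agree on every D;
  hence they integrate every nonnegative u alike.\<close>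

lemma count_nn_integral:
  assumes u[measurable]: "u \<in> borel_measurable (data_space T)"
  shows "(\<integral>\<^sup>+w. u (Z i w) * indicator {w. points_in (N i w) A = m} w \<partial>P) =
    (\<integral>\<^sup>+w. u (Z i w) * ennreal (poisson_prob (count_mean a A (Z i w)) m) \<partial>P)"
proof -
  note [measurable] = Z[OF i] count_mean_measurable count_measurable
  have [measurable]: "(\<lambda>w. poisson_prob (count_mean a A (Z i w)) m) \<in> borel_measurable P"
    unfolding poisson_prob_def by measurable
  have [measurable]: "(\<lambda>w. indicator {w. points_in (N i w) A = m} w :: ennreal) \<in> borel_measurable P"
    by measurable
  define R1 where "R1 = distr (density P (\<lambda>w. indicator {w. points_in (N i w) A = m} w)) (data_space T) (Z i)"
  define R2 where "R2 = distr (density P (\<lambda>w. ennreal (poisson_prob (count_mean a A (Z i w)) m))) (data_space T) (Z i)"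
  have "R1 = R2"
  proof (rule measure_eqI)
    fix D assume "D \<in> sets R1"
    then have D[measurable]: "D \<in> sets (data_space T)" by (simp add: R1_def)
    have "emeasure R1 D = (\<integral>\<^sup>+w. indicator {w \<in> space P. Z i w \<in> D \<and> points_in (N i w) A = m} w \<partial>P)"
    proof -
      have "emeasure R1 D = (\<integral>\<^sup>+w. indicator {w. points_in (N i w) A = m} w * indicator (Z i -` D \<inter> space P) w \<partial>P)"
        unfolding R1_def by (subst emeasure_distr) (auto simp: emeasure_density)
      also have "\<dots> = (\<integral>\<^sup>+w. indicator {w \<in> space P. Z i w \<in> D \<and> points_in (N i w) A = m} w \<partial>P)"
        by (intro nn_integral_cong) (auto simp: indicator_def)
      finally show ?thesis .
    qed
    also have "\<dots> = emeasure P {w \<in> space P. Z i w \<in> D \<and> points_in (N i w) A = m}"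
      by (rule nn_integral_indicator) measurable
    also have "\<dots> = emeasure R2 D"
      unfolding R2_def count_prob[OF D]
      by (subst emeasure_distr) (auto simp: emeasure_density intro!: nn_integral_cong simp: indicator_def)
    finally show "emeasure R1 D = emeasure R2 D" .
  qed (simp add: R1_def R2_def)
  then have "(\<integral>\<^sup>+z. u z \<partial>R1) = (\<integral>\<^sup>+z. u z \<partial>R2)" by simp
  then show ?thesis
    unfolding R1_def R2_def by (simp add: nn_integral_distr nn_integral_density mult.commute)
qed

text \<open>Given the data, a Poisson count has variance equal to its mean; the integral is split
  according to the value m of the count and summed. The weight v carries the kernel and the
  normalisation, which depend on the data only.\<close>

lemma count_mean_square:
  assumes v[measurable]: "v \<in> borel_measurable (data_space T)" and v0: "\<And>z. 0 \<le> v z"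
  shows "(\<integral>\<^sup>+w. ennreal (v (Z i w) * (real (points_in (N i w) A) - count_mean a A (Z i w))\<^sup>2) \<partial>P) =
    (\<integral>\<^sup>+w. ennreal (v (Z i w) * count_mean a A (Z i w)) \<partial>P)"
proof -
  note [measurable] = Z[OF i] count_mean_measurable count_measurable
  have [measurable]: "(\<lambda>w. poisson_prob (count_mean a A (Z i w)) m) \<in> borel_measurable P" for m
    unfolding poisson_prob_def by measurable
  have [measurable]: "(\<lambda>w. indicator {w. points_in (N i w) A = m} w :: ennreal) \<in> borel_measurable P" for m
    by measurable
  define u where "u m z = ennreal (v z * (real m - count_mean a A z)\<^sup>2)" for m z
  have [measurable]: "u m \<in> borel_measurable (data_space T)" for m unfolding u_def[abs_def] by measurable
  have "(\<integral>\<^sup>+w. ennreal (v (Z i w) * (real (points_in (N i w) A) - count_mean a A (Z i w))\<^sup>2) \<partial>P) =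
    (\<integral>\<^sup>+w. (\<Sum>m. u m (Z i w) * indicator {w. points_in (N i w) A = m} w) \<partial>P)"
  proof (rule nn_integral_cong)
    fix w
    have "(\<lambda>m. u m (Z i w) * indicator {w. points_in (N i w) A = m} w) sums
      (\<Sum>m\<in>{points_in (N i w) A}. u m (Z i w) * indicator {w. points_in (N i w) A = m} w)"
      by (rule sums_finite) auto
    then have "(\<Sum>m. u m (Z i w) * indicator {w. points_in (N i w) A = m} w) = u (points_in (N i w) A) (Z i w)"
      by (simp add: sums_iff)
    then show "ennreal (v (Z i w) * (real (points_in (N i w) A) - count_mean a A (Z i w))\<^sup>2) =
      (\<Sum>m. u m (Z i w) * indicator {w. points_in (N i w) A = m} w)" by (simp add: u_def)
  qed
  also have "\<dots> = (\<Sum>m. \<integral>\<^sup>+w. u m (Z i w) * indicator {w. points_in (N i w) A = m} w \<partial>P)"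
    by (rule nn_integral_suminf) measurable
  also have "\<dots> = (\<Sum>m. \<integral>\<^sup>+w. u m (Z i w) * ennreal (poisson_prob (count_mean a A (Z i w)) m) \<partial>P)"
    by (intro suminf_cong count_nn_integral) measurable
  also have "\<dots> = (\<integral>\<^sup>+w. (\<Sum>m. u m (Z i w) * ennreal (poisson_prob (count_mean a A (Z i w)) m)) \<partial>P)"
    by (rule nn_integral_suminf[symmetric]) measurable
  also have "\<dots> = (\<integral>\<^sup>+w. ennreal (v (Z i w) * count_mean a A (Z i w)) \<partial>P)"
  proof (rule nn_integral_cong)
    fix w assume w: "w \<in> space P"
    define r where "r = count_mean a A (Z i w)"
    have r: "0 \<le> r" using count_mean_nonneg[OF w] by (simp add: r_def)
    have s: "(\<lambda>m. v (Z i w) * ((real m - r)\<^sup>2 * poisson_prob r m)) sums (v (Z i w) * r)"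
      by (intro sums_mult poisson_prob_variance)
    have "(\<Sum>m. u m (Z i w) * ennreal (poisson_prob r m)) =
      (\<Sum>m. ennreal (v (Z i w) * ((real m - r)\<^sup>2 * poisson_prob r m)))"
      using v0 poisson_prob_nonneg[OF r] by (intro suminf_cong) (simp add: u_def r_def[symmetric] ennreal_mult[symmetric] mult.assoc)
    also have "\<dots> = ennreal (v (Z i w) * r)"
      using v0 poisson_prob_nonneg[OF r] s
      by (subst suminf_ennreal2) (auto simp: sums_iff)
    finally show "(\<Sum>m. u m (Z i w) * ennreal (poisson_prob (count_mean a A (Z i w)) m)) =
      ennreal (v (Z i w) * count_mean a A (Z i w))" by (simp add: r_def)
  qed
  finally show ?thesis .
qed

end

end

section \<open>Deterministic error bound\<close>

lemma weighted_mean_square: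
  fixes k d :: "nat \<Rightarrow> real"
  assumes "\<And>i. i < n \<Longrightarrow> 0 \<le> k i"
  shows "(\<Sum>i<n. k i * d i)\<^sup>2 \<le> (\<Sum>i<n. k i) * (\<Sum>i<n. k i * (d i)\<^sup>2)"
proof -
  have "(\<Sum>i<n. k i * d i) = (\<Sum>i<n. sqrt (k i) * (sqrt (k i) * d i))"
    using assms by (intro sum.cong) (auto simp: mult.assoc[symmetric])
  also have "\<dots>\<^sup>2 \<le> (\<Sum>i<n. (sqrt (k i))\<^sup>2) * (\<Sum>i<n. (sqrt (k i) * d i)\<^sup>2)"
    by (rule Cauchy_Schwarz_ineq_sum)
  also have "\<dots> = (\<Sum>i<n. k i) * (\<Sum>i<n. k i * (d i)\<^sup>2)"
    using assms by (intro arg_cong2[where f="(*)"] sum.cong) (auto simp: power_mult_distrib)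
  finally show ?thesis .
qed

lemma square_sum3: "((a::real) + b + c)\<^sup>2 \<le> 3 * (a\<^sup>2 + b\<^sup>2 + c\<^sup>2)"
proof -
  have "0 \<le> (a - b)\<^sup>2 + (b - c)\<^sup>2 + (a - c)\<^sup>2" by simp
  then show ?thesis by (simp add: power2_eq_square algebra_simps)
qed

locale shape_kernel = shape_space T M L + smoothing_kernel K for T M L :: real and K
begin

text \<open>Relative squared count errors, summed over the grid: the sum dominates the maximum that
  the quantile bound needs, and its expectation is computed term by term.\<close>

definition count_error :: "real \<Rightarrow> nat \<Rightarrow> (real \<Rightarrow> real) \<Rightarrow> real multiset \<Rightarrow> real" where
  "count_error a k l N = (\<Sum>j\<le>k. (real (points_in N {0..real j * T / real k}) -
     a * (LINT t:{0..real j * T / real k}|lborel. l t))\<^sup>2) / (a * total_intensity T l)\<^sup>2"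

lemma empirical_quantile_error:
  assumes l: "l \<in> good_intensities \<kappa>" and \<kappa>: "0 < \<kappa>" and N: "set_mset N \<subseteq> {0..T}"
    and a: "0 < a" and k: "0 < k" and t: "t \<in> {0..1}"
  shows "(empirical_quantile T N t - density_quantile T (intensity_shape T l) t)\<^sup>2 \<le>
    L\<^sup>2 * (8 * count_error a k l N + 2 * (T / (real k * M))\<^sup>2)"
proof -
  define \<Delta> where "\<Delta> j = real (points_in N {0..real j * T / real k}) -
     a * (LINT t:{0..real j * T / real k}|lborel. l t)" for j
  \<comment> \<open>The root of the sum of squares bounds each single deviation, as
    \<open>empirical_quantile_close\<close> requires.\<close>
  define e where "e = sqrt (\<Sum>j\<le>k. (\<Delta> j)\<^sup>2)"
  define \<tau> where "\<tau> = total_intensity T l"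
  have \<tau>: "0 < \<tau>" using l \<kappa> by (auto simp: good_intensities_def \<tau>_def)
  have le: "\<bar>\<Delta> j\<bar> \<le> e" if "j \<le> k" for j
  proof -
    have "(\<Delta> j)\<^sup>2 \<le> (\<Sum>j\<le>k. (\<Delta> j)\<^sup>2)" using that by (intro member_le_sum) auto
    then show ?thesis unfolding e_def by (metis real_sqrt_abs real_sqrt_le_mono)
  qed
  have "\<bar>empirical_quantile T N t - density_quantile T (intensity_shape T l) t\<bar> \<le>
         L * (2 * e / (a * \<tau>) + T / (real k * M))"
    unfolding \<tau>_def
    by (rule empirical_quantile_close)
       (use l N a k t \<tau> le in \<open>auto simp: good_intensities_def space_intensity_space \<Delta>_def \<tau>_def\<close>)
  then have "(empirical_quantile T N t - density_quantile T (intensity_shape T l) t)\<^sup>2 \<le>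
    (L * (2 * e / (a * \<tau>) + T / (real k * M)))\<^sup>2"
    using power_mono[of "\<bar>empirical_quantile T N t - density_quantile T (intensity_shape T l) t\<bar>" _ 2] by simp
  also have "\<dots> = L\<^sup>2 * (2 * e / (a * \<tau>) + T / (real k * M))\<^sup>2" by (simp add: power_mult_distrib)
  also have "\<dots> \<le> L\<^sup>2 * (8 * (e\<^sup>2 / (a * \<tau>)\<^sup>2) + 2 * (T / (real k * M))\<^sup>2)"
  proof (rule mult_left_mono)
    have "(u + v)\<^sup>2 \<le> 2 * u\<^sup>2 + 2 * v\<^sup>2" for u v :: real
      using sum_squares_bound[of u v] by (simp add: power2_sum)
    from this[of "2 * e / (a * \<tau>)" "T / (real k * M)"]
    show "(2 * e / (a * \<tau>) + T / (real k * M))\<^sup>2 \<le> 8 * (e\<^sup>2 / (a * \<tau>)\<^sup>2) + 2 * (T / (real k * M))\<^sup>2"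
      by (simp add: power_divide power_mult_distrib)
  qed simp
  also have "e\<^sup>2 / (a * \<tau>)\<^sup>2 = count_error a k l N"
    by (simp add: e_def count_error_def \<Delta>_def \<tau>_def sum_nonneg)
  finally show ?thesis .
qed

text \<open>
  The weights have mean 1, so the weighted mean of the \<open>Q\<^sub>i - m\<close> is a combination of two
  unweighted averages, whose coefficients \<open>u\<^sub>2 / \<sigma>\<^sup>2\<close> and \<open>u\<^sub>1 / \<sigma>\<^sup>2\<close> are bounded.
\<close>

lemma estimator_error:
  fixes xs :: "nat \<Rightarrow> real" and ls :: "nat \<Rightarrow> real \<Rightarrow> real" and Ns :: "nat \<Rightarrow> real multiset"
    and m :: "real \<Rightarrow> real" and x h a c f0 k2 \<kappa> :: real and n k :: nat
  defines "u \<equiv> kernel_moment K h x n xs"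
  defines "A \<equiv> \<lambda>j t. (\<Sum>i<n. kernel_scaled K h (xs i - x) * (xs i - x) ^ j *
                 (density_quantile T (intensity_shape T (ls i)) t - m t)) / real n"
  defines "V \<equiv> (\<Sum>i<n. kernel_scaled K h (xs i - x) * count_error a k (ls i) (Ns i)) / real n"
  defines "R \<equiv> 16 / f0 + 8 * c / (k2 * f0\<^sup>2)"
  assumes m: "m \<in> shape_quantiles T M L" and n: "0 < n" and h: "0 < h" "h \<le> 1"
    and ls: "\<And>i. i < n \<Longrightarrow> ls i \<in> good_intensities \<kappa>" and \<kappa>: "0 < \<kappa>"
    and Ns: "\<And>i. i < n \<Longrightarrow> set_mset (Ns i) \<subseteq> {0..T}" and a: "0 < a" and k: "0 < k"
    and f0: "0 < f0" and k2: "0 < k2" and c: "0 \<le> c"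
    and u0: "\<bar>u 0 - f0\<bar> \<le> f0 / 2" and u1: "\<bar>u 1\<bar> \<le> c * h\<^sup>2" "(u 1)\<^sup>2 \<le> h\<^sup>2 * k2 * f0\<^sup>2 / 8"
    and u2: "\<bar>u 2 - h\<^sup>2 * k2 * f0\<bar> \<le> h\<^sup>2 * k2 * f0 / 2"
  shows "(L2_dist m (\<lambda>t. (\<Sum>i<n. local_weight K h x n xs i * empirical_quantile T (Ns i) t) / real n))\<^sup>2 \<le>
     3 * R\<^sup>2 * (2 * f0 * (8 * L\<^sup>2 * V + 4 * f0 * L\<^sup>2 * (T / (real k * M))\<^sup>2) +
       (LINT t|unit_lborel. (A 0 t)\<^sup>2) + (LINT t|unit_lborel. (A 1 t)\<^sup>2))"
proof -
  define s where "s = local_weight K h x n xs"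
  define \<kappa>w where "\<kappa>w i = kernel_scaled K h (xs i - x)" for i
  define d where "d i = xs i - x" for i
  define \<sigma> where "\<sigma> = u 0 * u 2 - (u 1)\<^sup>2"
  define Q where "Q i = density_quantile T (intensity_shape T (ls i))" for i
  define Qh where "Qh i = empirical_quantile T (Ns i)" for i
  define Y where "Y t = (\<Sum>i<n. s i * Qh i t) / real n" for t
  define D where "D i = L\<^sup>2 * (8 * count_error a k (ls i) (Ns i) + 2 * (T / (real k * M))\<^sup>2)" for i
  have kw: "0 \<le> \<kappa>w i" for i unfolding \<kappa>w_def by (rule kernel_scaled_nonneg[OF h(1)])
  have s_eq: "s i = \<kappa>w i * (u 2 - u 1 * d i) / \<sigma>" for i
    by (simp add: s_def local_weight_def \<kappa>w_def d_def \<sigma>_def u_def kernel_sigma2_def)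
  have u_eq: "u j = (\<Sum>i<n. \<kappa>w i * d i ^ j) / real n" for j
    by (simp add: u_def kernel_moment_def \<kappa>w_def d_def)
  have A_eq: "A j t = (\<Sum>i<n. \<kappa>w i * d i ^ j * (Q i t - m t)) / real n" for j t
    by (simp add: A_def \<kappa>w_def d_def Q_def)
  have Qsq: "Q i \<in> shape_quantiles T M L" if "i < n" for i
    using ls[OF that] by (auto simp: Q_def good_intensities_def intro: density_quantile_shape)
  have hk: "0 < h\<^sup>2 * k2 * f0" using h k2 f0 by simp
  have u0': "f0 / 2 \<le> u 0" "u 0 \<le> 2 * f0" using u0 f0 unfolding abs_le_iff by linarith+
  have u2': "h\<^sup>2 * k2 * f0 / 2 \<le> u 2" "u 2 \<le> 2 * (h\<^sup>2 * k2 * f0)"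
    using u2 hk unfolding abs_le_iff by linarith+
  \<comment> \<open>The product u_0 u_2 is at least h^2 k2 f0^2 / 4, twice the bound on
    u_1^2.\<close>
  have \<sigma>: "h\<^sup>2 * k2 * f0\<^sup>2 / 8 \<le> \<sigma>"
  proof -
    have "(f0 / 2) * (h\<^sup>2 * k2 * f0 / 2) \<le> u 0 * u 2"
      using u0'(1) u2'(1) f0 hk by (intro mult_mono) auto
    also have "(f0 / 2) * (h\<^sup>2 * k2 * f0 / 2) = h\<^sup>2 * k2 * f0\<^sup>2 / 8 + h\<^sup>2 * k2 * f0\<^sup>2 / 8"
      by (simp add: power2_eq_square)
    finally show ?thesis using u1(2) unfolding \<sigma>_def by linarith
  qed
  have hk2: "0 < h\<^sup>2 * k2 * f0\<^sup>2 / 8" using h k2 f0 by simp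
  then have \<sigma>_pos: "0 < \<sigma>" using \<sigma> by linarith
  \<comment> \<open>R is the sum of the two coefficient bounds: 16/f0 is 2 h^2 k2 f0 divided by the
    lower bound of \<sigma>, and the other summand is c h^2 divided by it. The factors h^2 cancel,
    so R does not depend on n.\<close>
  have r2: "u 2 / \<sigma> \<le> 16 / f0" "0 \<le> u 2 / \<sigma>"
  proof -
    have "u 2 / \<sigma> \<le> 2 * (h\<^sup>2 * k2 * f0) / (h\<^sup>2 * k2 * f0\<^sup>2 / 8)"
      using u2'(2) \<sigma> hk hk2 by (intro frac_le) auto
    also have "\<dots> = 16 / f0" using h k2 f0 by (simp add: power2_eq_square)
    finally show "u 2 / \<sigma> \<le> 16 / f0" .
    show "0 \<le> u 2 / \<sigma>" using u2'(1) hk \<sigma>_pos by simp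
  qed
  have r1: "\<bar>u 1\<bar> / \<sigma> \<le> 8 * c / (k2 * f0\<^sup>2)"
  proof -
    have "\<bar>u 1\<bar> / \<sigma> \<le> (c * h\<^sup>2) / (h\<^sup>2 * k2 * f0\<^sup>2 / 8)"
      using u1(1) \<sigma> hk2 c by (intro frac_le) auto
    also have "\<dots> = 8 * c / (k2 * f0\<^sup>2)" using h k2 f0 by (simp add: field_simps)
    finally show ?thesis .
  qed
  have c': "0 \<le> 8 * c / (k2 * f0\<^sup>2)" using c k2 by simp
  have R0: "0 \<le> R" using f0 c' by (simp add: R_def)
  \<comment> \<open>Where the kernel does not vanish, |d i| \<le> h \<le> 1, so u_1 d_i is at most
    |u_1|.\<close>
  have s_le: "\<bar>s i\<bar> \<le> \<kappa>w i * R" for i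
  proof (cases "\<bar>d i\<bar> \<le> h")
    case True
    have "\<bar>u 2 - u 1 * d i\<bar> \<le> u 2 + \<bar>u 1\<bar> * 1"
    proof -
      have "\<bar>u 1 * d i\<bar> \<le> \<bar>u 1\<bar> * 1" unfolding abs_mult using True h by (intro mult_left_mono) auto
      moreover have "0 \<le> u 2" using u2'(1) hk by linarith
      ultimately show ?thesis by linarith
    qed
    then have "\<bar>u 2 - u 1 * d i\<bar> / \<sigma> \<le> (u 2 + \<bar>u 1\<bar> * 1) / \<sigma>" using \<sigma>_pos by (intro divide_right_mono) auto
    also have "\<dots> \<le> R" using r2(1) r1 by (simp add: add_divide_distrib R_def)
    finally have "\<kappa>w i * (\<bar>u 2 - u 1 * d i\<bar> / \<sigma>) \<le> \<kappa>w i * R" using kw by (intro mult_left_mono) auto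
    then show ?thesis using kw[of i] \<sigma>_pos by (simp add: s_eq abs_mult abs_divide)
  next
    case False
    then have "\<kappa>w i = 0" unfolding \<kappa>w_def d_def[symmetric] using h by (intro kernel_scaled_zero) auto
    then show ?thesis by (simp add: s_eq)
  qed
  have sum_s: "(\<Sum>i<n. s i * p i) / real n =
      (u 2 * ((\<Sum>i<n. \<kappa>w i * d i ^ 0 * p i) / real n) - u 1 * ((\<Sum>i<n. \<kappa>w i * d i ^ 1 * p i) / real n)) / \<sigma>" for p
  proof -
    have "(\<Sum>i<n. s i * p i) = (\<Sum>i<n. (u 2 * (\<kappa>w i * d i ^ 0 * p i) - u 1 * (\<kappa>w i * d i ^ 1 * p i)) / \<sigma>)"
      by (rule sum.cong) (auto simp: s_eq algebra_simps)
    also have "\<dots> = (u 2 * (\<Sum>i<n. \<kappa>w i * d i ^ 0 * p i) - u 1 * (\<Sum>i<n. \<kappa>w i * d i ^ 1 * p i)) / \<sigma>"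
      by (simp only: sum_divide_distrib[symmetric] sum_subtractf sum_distrib_left[symmetric])
    finally show ?thesis using n \<sigma>_pos by (simp add: field_simps)
  qed
  have mean_s: "(\<Sum>i<n. s i) / real n = 1"
  proof -
    have "(\<Sum>i<n. s i) / real n = (u 2 * u 0 - u 1 * u 1) / \<sigma>"
      using sum_s[of "\<lambda>_. 1"] by (simp add: u_eq)
    also have "\<dots> = 1" using \<sigma>_pos by (simp add: \<sigma>_def power2_eq_square mult.commute)
    finally show ?thesis .
  qed
  have Y_m: "Y t - m t = (\<Sum>i<n. s i * (Qh i t - Q i t)) / real n + u 2 / \<sigma> * A 0 t + - (u 1 / \<sigma>) * A 1 t" for t
  proof -
    have "Y t - m t = Y t - (\<Sum>i<n. s i) / real n * m t" using mean_s by simp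
    also have "\<dots> = (\<Sum>i<n. s i * (Qh i t - Q i t)) / real n + (\<Sum>i<n. s i * (Q i t - m t)) / real n"
      by (simp add: Y_def sum_subtractf right_diff_distrib sum_distrib_right diff_divide_distrib)
    also have "(\<Sum>i<n. s i * (Q i t - m t)) / real n = (u 2 * A 0 t - u 1 * A 1 t) / \<sigma>"
      unfolding sum_s A_eq ..
    finally show ?thesis by (simp add: diff_divide_distrib)
  qed
  \<comment> \<open>Local linear weights can be negative. They are dominated by R times the kernel
    weights, and Cauchy-Schwarz is applied to the latter, whose mean is u_0.\<close>
  have err: "((\<Sum>i<n. s i * (Qh i t - Q i t)) / real n)\<^sup>2 \<le> R\<^sup>2 * (u 0 * ((\<Sum>i<n. \<kappa>w i * D i) / real n))"
    if t: "t \<in> {0..1}" for t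
  proof -
    have "\<bar>\<Sum>i<n. s i * (Qh i t - Q i t)\<bar> \<le> (\<Sum>i<n. \<bar>s i * (Qh i t - Q i t)\<bar>)" by (rule sum_abs)
    also have "\<dots> \<le> (\<Sum>i<n. R * (\<kappa>w i * \<bar>Qh i t - Q i t\<bar>))"
    proof (rule sum_mono)
      fix i
      show "\<bar>s i * (Qh i t - Q i t)\<bar> \<le> R * (\<kappa>w i * \<bar>Qh i t - Q i t\<bar>)"
        using mult_right_mono[OF s_le[of i], of "\<bar>Qh i t - Q i t\<bar>"] by (simp add: abs_mult mult_ac)
    qed
    also have "\<dots> = R * (\<Sum>i<n. \<kappa>w i * \<bar>Qh i t - Q i t\<bar>)" by (simp add: sum_distrib_left)
    finally have "\<bar>\<Sum>i<n. s i * (Qh i t - Q i t)\<bar> \<le> R * (\<Sum>i<n. \<kappa>w i * \<bar>Qh i t - Q i t\<bar>)" .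
    then have "(\<Sum>i<n. s i * (Qh i t - Q i t))\<^sup>2 \<le> (R * (\<Sum>i<n. \<kappa>w i * \<bar>Qh i t - Q i t\<bar>))\<^sup>2"
      using power_mono[of "\<bar>\<Sum>i<n. s i * (Qh i t - Q i t)\<bar>" _ 2] by simp
    also have "\<dots> \<le> R\<^sup>2 * ((\<Sum>i<n. \<kappa>w i) * (\<Sum>i<n. \<kappa>w i * \<bar>Qh i t - Q i t\<bar>\<^sup>2))"
      unfolding power_mult_distrib by (intro mult_left_mono weighted_mean_square kw) auto
    also have "\<dots> \<le> R\<^sup>2 * ((\<Sum>i<n. \<kappa>w i) * (\<Sum>i<n. \<kappa>w i * D i))"
    proof (intro mult_left_mono sum_mono sum_nonneg kw)
      fix i assume "i \<in> {..<n}"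
      then show "\<bar>Qh i t - Q i t\<bar>\<^sup>2 \<le> D i"
        unfolding power2_abs Qh_def Q_def D_def
        by (intro empirical_quantile_error[OF _ \<kappa> _ a k t] ls Ns) auto
    qed auto
    finally have "(\<Sum>i<n. s i * (Qh i t - Q i t))\<^sup>2 / (real n)\<^sup>2 \<le>
      (R\<^sup>2 * ((\<Sum>i<n. \<kappa>w i) * (\<Sum>i<n. \<kappa>w i * D i))) / (real n)\<^sup>2" by (rule divide_right_mono) simp
    then show ?thesis by (simp add: power_divide u_eq power2_eq_square)
  qed
  define E where "E = u 0 * ((\<Sum>i<n. \<kappa>w i * D i) / real n)"
  have E_le: "E \<le> 2 * f0 * (8 * L\<^sup>2 * V + 4 * f0 * L\<^sup>2 * (T / (real k * M))\<^sup>2)"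
  proof -
    have "(\<Sum>i<n. \<kappa>w i * D i) = (\<Sum>i<n. 8 * L\<^sup>2 * (\<kappa>w i * count_error a k (ls i) (Ns i)) +
      2 * L\<^sup>2 * (T / (real k * M))\<^sup>2 * (\<kappa>w i * d i ^ 0))"
      by (rule sum.cong) (auto simp: D_def algebra_simps)
    also have "\<dots> = 8 * L\<^sup>2 * (\<Sum>i<n. \<kappa>w i * count_error a k (ls i) (Ns i)) +
      2 * L\<^sup>2 * (T / (real k * M))\<^sup>2 * (\<Sum>i<n. \<kappa>w i * d i ^ 0)"
      by (simp only: sum.distrib sum_distrib_left)
    finally have eq: "(\<Sum>i<n. \<kappa>w i * D i) / real n = 8 * L\<^sup>2 * V + 2 * L\<^sup>2 * (T / (real k * M))\<^sup>2 * u 0"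
      by (simp add: V_def u_eq \<kappa>w_def add_divide_distrib)
    have V0: "0 \<le> V" unfolding V_def count_error_def
      by (intro divide_nonneg_nonneg sum_nonneg mult_nonneg_nonneg kernel_scaled_nonneg h) auto
    have "E \<le> 2 * f0 * (8 * L\<^sup>2 * V + 2 * L\<^sup>2 * (T / (real k * M))\<^sup>2 * (2 * f0))"
      unfolding E_def eq using u0' f0 V0 by (intro mult_mono add_left_mono mult_left_mono) auto
    then show ?thesis by (simp add: mult_ac)
  qed
  have point: "(m t - Y t)\<^sup>2 \<le> 3 * R\<^sup>2 * E + 3 * R\<^sup>2 * (A 0 t)\<^sup>2 + 3 * R\<^sup>2 * (A 1 t)\<^sup>2" if t: "t \<in> {0..1}" for t
  proof -
    have "(m t - Y t)\<^sup>2 = (Y t - m t)\<^sup>2" by (rule power2_commute)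
    also have "\<dots> \<le> 3 * (((\<Sum>i<n. s i * (Qh i t - Q i t)) / real n)\<^sup>2 + (u 2 / \<sigma> * A 0 t)\<^sup>2 + (- (u 1 / \<sigma>) * A 1 t)\<^sup>2)"
      unfolding Y_m by (rule square_sum3)
    also have "\<dots> \<le> 3 * (R\<^sup>2 * E + R\<^sup>2 * (A 0 t)\<^sup>2 + R\<^sup>2 * (A 1 t)\<^sup>2)"
    proof (intro mult_left_mono add_mono)
      show "((\<Sum>i<n. s i * (Qh i t - Q i t)) / real n)\<^sup>2 \<le> R\<^sup>2 * E" unfolding E_def by (rule err[OF t])
      have "(u 2 / \<sigma>)\<^sup>2 \<le> R\<^sup>2" using r2 c' by (intro power_mono) (auto simp: R_def)
      then show "(u 2 / \<sigma> * A 0 t)\<^sup>2 \<le> R\<^sup>2 * (A 0 t)\<^sup>2"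
        unfolding power_mult_distrib by (intro mult_right_mono) auto
      have "\<bar>u 1\<bar> / \<sigma> \<le> R" using r1 f0 by (simp add: R_def add_increasing)
      then have "(\<bar>u 1\<bar> / \<sigma>)\<^sup>2 \<le> R\<^sup>2" using \<sigma>_pos by (intro power_mono) auto
      then show "(- (u 1 / \<sigma>) * A 1 t)\<^sup>2 \<le> R\<^sup>2 * (A 1 t)\<^sup>2"
        unfolding power_mult_distrib by (intro mult_right_mono) (auto simp: power_divide)
    qed simp
    finally show ?thesis by (simp add: algebra_simps)
  qed
  have bA: "bounded_fun (A j)" for j
    unfolding A_eq[abs_def] divide_inverse
    by (intro bounded_fun_intros bounded_fun_shape_quantile Qsq m) auto
  have bY: "bounded_fun Y"
    unfolding Y_def[abs_def] Qh_def divide_inverse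
    by (intro bounded_fun_intros bounded_fun_empirical_quantile T_pos Ns) auto
  interpret U: prob_space unit_lborel by (rule prob_space_unit_lborel)
  have "(L2_dist m Y)\<^sup>2 \<le> (LINT t|unit_lborel. 3 * R\<^sup>2 * E + 3 * R\<^sup>2 * (A 0 t)\<^sup>2 + 3 * R\<^sup>2 * (A 1 t)\<^sup>2)"
    unfolding L2_dist_sq
    by (intro integral_mono bounded_fun_integrable bounded_fun_intros bA bY bounded_fun_shape_quantile m point)
       (auto simp: space_restrict_space)
  also have "\<dots> = 3 * R\<^sup>2 * E + 3 * R\<^sup>2 * (LINT t|unit_lborel. (A 0 t)\<^sup>2) + 3 * R\<^sup>2 * (LINT t|unit_lborel. (A 1 t)\<^sup>2)"
  proof -
    have i: "integrable unit_lborel (\<lambda>t. 3 * R\<^sup>2 * (A j t)\<^sup>2)" for j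
      by (intro bounded_fun_integrable bounded_fun_intros bA)
    have "(LINT t|unit_lborel. 3 * R\<^sup>2 * E + 3 * R\<^sup>2 * (A 0 t)\<^sup>2 + 3 * R\<^sup>2 * (A 1 t)\<^sup>2) =
      (LINT t|unit_lborel. 3 * R\<^sup>2 * E + 3 * R\<^sup>2 * (A 0 t)\<^sup>2) + (LINT t|unit_lborel. 3 * R\<^sup>2 * (A 1 t)\<^sup>2)"
      by (intro Bochner_Integration.integral_add Bochner_Integration.integrable_add i) simp
    also have "(LINT t|unit_lborel. 3 * R\<^sup>2 * E + 3 * R\<^sup>2 * (A 0 t)\<^sup>2) =
      (LINT t|unit_lborel. 3 * R\<^sup>2 * E) + (LINT t|unit_lborel. 3 * R\<^sup>2 * (A 0 t)\<^sup>2)"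
      by (intro Bochner_Integration.integral_add i) simp
    finally show ?thesis using U.prob_space by (simp add: space_restrict_space)
  qed
  also have "\<dots> = 3 * R\<^sup>2 * (E + (LINT t|unit_lborel. (A 0 t)\<^sup>2) + (LINT t|unit_lborel. (A 1 t)\<^sup>2))"
    by (simp add: algebra_simps)
  also have "\<dots> \<le> 3 * R\<^sup>2 * (2 * f0 * (8 * L\<^sup>2 * V + 4 * f0 * L\<^sup>2 * (T / (real k * M))\<^sup>2) +
       (LINT t|unit_lborel. (A 0 t)\<^sup>2) + (LINT t|unit_lborel. (A 1 t)\<^sup>2))"
    using E_le by (intro mult_left_mono) auto
  finally show ?thesis unfolding Y_def s_def Qh_def .
qed

text \<open>The target m is itself a competitor in the projection of Y, so q is no farther from Y
  than m is, and d(m,q)^2 \<le> 4 d(m,Y)^2. Another factor 2 pays for passing from m to the quantile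
  function of f. Existence of the projection and of a density with quantile function q makes both
  choices in the estimator genuine.\<close>

lemma estimator_le_weighted_mean:
  assumes m: "m \<in> shape_quantiles T M L" and Ns: "\<And>i. i < n \<Longrightarrow> set_mset (Ns i) \<subseteq> {0..T}"
    and f: "f \<in> shape_densities T M L" "L2_dist m (density_quantile T f) = 0"
  shows "(shape_dist T f (density_estimator T M L K h x n xs Ns))\<^sup>2 \<le>
    8 * (L2_dist m (\<lambda>t. (\<Sum>i<n. local_weight K h x n xs i * empirical_quantile T (Ns i) t) / real n))\<^sup>2"
proof -
  define Y where "Y t = (\<Sum>i<n. local_weight K h x n xs i * empirical_quantile T (Ns i) t) / real n" for t
  define q where "q = quantile_estimator T M L K h x n xs Ns"
  define fe where "fe = density_estimator T M L K h x n xs Ns"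
  have bY: "bounded_fun Y"
    unfolding Y_def[abs_def] divide_inverse
    by (intro bounded_fun_intros bounded_fun_empirical_quantile T_pos Ns) auto
  obtain p where p: "p \<in> shape_quantiles T M L" "\<And>r. r \<in> shape_quantiles T M L \<Longrightarrow> (L2_dist p Y)\<^sup>2 \<le> (L2_dist r Y)\<^sup>2"
    using shape_quantile_projection_exists[OF bY] by blast
  have "is_arg_min (\<lambda>q. (L2_dist q Y)\<^sup>2) (\<lambda>q. q \<in> shape_quantiles T M L) q"
    unfolding q_def quantile_estimator_def arg_min_on_def arg_min_def Y_def[symmetric]
    by (rule someI[of _ p]) (use p in \<open>auto simp: is_arg_min_linorder\<close>)
  then have q: "q \<in> shape_quantiles T M L" "(L2_dist q Y)\<^sup>2 \<le> (L2_dist m Y)\<^sup>2"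
    using m by (auto simp: is_arg_min_linorder)
  have "prob_density_on T fe \<and> density_quantile T fe = q"
    unfolding fe_def density_estimator_def q_def[symmetric]
    by (rule someI_ex[OF shape_quantile_density_exists[OF q(1)]])
  then have fe: "density_quantile T fe = q" by simp
  have bq: "bounded_fun q" "bounded_fun m" "bounded_fun (density_quantile T f)"
    using bounded_fun_shape_quantile q m density_quantile_shape[OF f(1)] by auto
  have "(shape_dist T f fe)\<^sup>2 \<le> 2 * (L2_dist (density_quantile T f) m)\<^sup>2 + 2 * (L2_dist m q)\<^sup>2"
    unfolding shape_dist_def fe by (rule L2_dist_triangle_sq) (use bq in auto)
  also have "\<dots> = 2 * (L2_dist m q)\<^sup>2" using f(2) by (simp add: L2_dist_commute[of m])
  also have "\<dots> \<le> 2 * (2 * (L2_dist m Y)\<^sup>2 + 2 * (L2_dist Y q)\<^sup>2)"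
    using L2_dist_triangle_sq[OF bq(2) bY bq(1)] by simp
  also have "\<dots> \<le> 8 * (L2_dist m Y)\<^sup>2" using q(2) by (simp add: L2_dist_commute[of Y])
  finally show ?thesis unfolding fe_def Y_def .
qed

end

section \<open>Events of high probability\<close>

text \<open>Stated for extended nonnegative variables, so that iterated integrals and sums can be
  inserted without first proving them finite.\<close>

lemma (in prob_space) markov_event:
  assumes W[measurable]: "W \<in> borel_measurable M" and le: "(\<integral>\<^sup>+w. W w \<partial>M) \<le> ennreal r" and r: "0 < r" and \<eta>: "0 < \<eta>"
  shows "1 - \<eta> \<le> prob {w \<in> space M. W w \<le> ennreal (r / \<eta>)}"
proof -
  have "emeasure M {w \<in> space M. 1 \<le> ennreal (\<eta> / r) * W w} \<le> ennreal (\<eta> / r) * (\<integral>\<^sup>+w. W w * indicator (space M) w \<partial>M)"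
    by (rule nn_integral_Markov_inequality) measurable
  also have "(\<integral>\<^sup>+w. W w * indicator (space M) w \<partial>M) = (\<integral>\<^sup>+w. W w \<partial>M)" by (rule nn_integral_cong) simp
  also have "ennreal (\<eta> / r) * (\<integral>\<^sup>+w. W w \<partial>M) \<le> ennreal (\<eta> / r) * ennreal r" by (intro mult_left_mono le) simp
  also have "\<dots> = ennreal \<eta>" using r \<eta> by (simp add: ennreal_mult[symmetric])
  finally have "prob {w \<in> space M. 1 \<le> ennreal (\<eta> / r) * W w} \<le> \<eta>"
    using \<eta> by (simp add: emeasure_eq_measure)
  moreover have "space M - {w \<in> space M. W w \<le> ennreal (r / \<eta>)} \<subseteq> {w \<in> space M. 1 \<le> ennreal (\<eta> / r) * W w}"
  proof safe
    fix w assume "w \<in> space M" "\<not> W w \<le> ennreal (r / \<eta>)"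
    then have "ennreal (\<eta> / r) * ennreal (r / \<eta>) \<le> ennreal (\<eta> / r) * W w" by (intro mult_left_mono) auto
    then show "1 \<le> ennreal (\<eta> / r) * W w" using r \<eta> by (simp add: ennreal_mult[symmetric])
  qed
  then have "prob (space M - {w \<in> space M. W w \<le> ennreal (r / \<eta>)}) \<le> prob {w \<in> space M. 1 \<le> ennreal (\<eta> / r) * W w}"
    by (intro finite_measure_mono) auto
  moreover have "prob (space M - {w \<in> space M. W w \<le> ennreal (r / \<eta>)}) = 1 - prob {w \<in> space M. W w \<le> ennreal (r / \<eta>)}"
    by (rule prob_compl) measurable
  ultimately show ?thesis by linarith
qed

lemma (in prob_space) markov_event_real:
  assumes W: "integrable M W" "\<And>w. 0 \<le> W w" and le: "expectation W \<le> r" and r: "0 < r" and \<eta>: "0 < \<eta>"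
  shows "1 - \<eta> \<le> prob {w \<in> space M. W w \<le> r / \<eta>}"
proof -
  have "(\<integral>\<^sup>+w. ennreal (W w) \<partial>M) = ennreal (expectation W)"
    using W by (intro nn_integral_eq_integral) auto
  also have "\<dots> \<le> ennreal r" using le by (rule ennreal_leI)
  finally have "1 - \<eta> \<le> prob {w \<in> space M. ennreal (W w) \<le> ennreal (r / \<eta>)}"
    using W r \<eta> by (intro markov_event) auto
  then show ?thesis using r \<eta> by (simp add: ennreal_le_iff)
qed

lemma (in prob_space) prob_Int_ge:
  assumes "A \<in> events" "B \<in> events" "1 - a \<le> prob A" "1 - b \<le> prob B"
  shows "1 - (a + b) \<le> prob (A \<inter> B)"
proof -
  have "prob (A \<union> B) = prob A + prob B - prob (A \<inter> B)"
    using finite_measure_Union'[of A B] finite_measure_Diff'[of B A] assms by (simp add: Int_commute)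
  then show ?thesis using assms prob_le_1[of "A \<union> B"] by linarith
qed

section \<open>The sampling model\<close>

locale sampling_model =
  shape_regression P T M L K X "\<lambda>w. intensity_shape T (\<Lambda> w)" fX g \<nu> B
  for P :: "'w measure" and T M L :: real and K X and \<Lambda> :: "'w \<Rightarrow> real \<Rightarrow> real" and fX g \<nu> B +
  fixes Xs :: "nat \<Rightarrow> 'w \<Rightarrow> real" and \<Lambda>s :: "nat \<Rightarrow> 'w \<Rightarrow> real \<Rightarrow> real" and \<kappa> x :: real
  assumes data_measurable: "(\<lambda>w. (X w, \<Lambda> w)) \<in> P \<rightarrow>\<^sub>M borel \<Otimes>\<^sub>M intensity_space T"
    and data_indep: "indep_vars (\<lambda>_. borel \<Otimes>\<^sub>M intensity_space T) (\<lambda>i w. (Xs i w, \<Lambda>s i w)) UNIV"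
    and data_distr: "\<And>i. distr P (borel \<Otimes>\<^sub>M intensity_space T) (\<lambda>w. (Xs i w, \<Lambda>s i w)) =
              distr P (borel \<Otimes>\<^sub>M intensity_space T) (\<lambda>w. (X w, \<Lambda> w))"
    and \<kappa>_pos: "\<kappa> > 0" and total_ge: "AE w in P. total_intensity T (\<Lambda> w) \<ge> \<kappa>"
begin

sublocale shape_kernel T M L K
  by (intro shape_kernel.intro shape_space_axioms smoothing_kernel_axioms)

sublocale shape_law T M L "\<nu> x"
  by (intro shape_law.intro shape_law_axioms.intro shape_space_axioms \<nu>_prob \<nu>_sets)

lemma sample_measurable[measurable]: "(\<lambda>w. (Xs i w, \<Lambda>s i w)) \<in> P \<rightarrow>\<^sub>M data_space T"
  using data_indep by (simp add: indep_vars_def)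

lemma Xs_measurable[measurable]: "Xs i \<in> borel_measurable P"
  and \<Lambda>s_measurable[measurable]: "\<Lambda>s i \<in> P \<rightarrow>\<^sub>M intensity_space T"
  and \<Lambda>_measurable[measurable]: "\<Lambda> \<in> P \<rightarrow>\<^sub>M intensity_space T"
  using measurable_compose[OF sample_measurable measurable_fst, of i]
    measurable_compose[OF sample_measurable measurable_snd, of i]
    measurable_compose[OF data_measurable measurable_snd] by simp_all

text \<open>An almost sure property passes from the pair to the sample through equality of laws, for
  which D must be measurable. This is the reason for \<open>good_intensities_sets\<close>.\<close>

lemma sample_AE:
  assumes [measurable]: "D \<in> sets (intensity_space T)" and "AE w in P. \<Lambda> w \<in> D"
  shows "AE w in P. \<Lambda>s i w \<in> D"
proof -
  have m: "Measurable.pred (data_space T) (\<lambda>z. snd z \<in> D)" by measurable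
  have "AE z in distr P (data_space T) (\<lambda>w. (X w, \<Lambda> w)). snd z \<in> D"
    using assms(2) m by (subst AE_distr_iff[OF data_measurable]) auto
  then have "AE z in distr P (data_space T) (\<lambda>w. (Xs i w, \<Lambda>s i w)). snd z \<in> D" unfolding data_distr .
  then show ?thesis using m by (subst (asm) AE_distr_iff) auto
qed

lemma \<Lambda>_good: "AE w in P. \<Lambda> w \<in> good_intensities \<kappa>"
  using total_ge AE_space
proof eventually_elim
  case (elim w)
  then show ?case using f_shape[of w] measurable_space[OF \<Lambda>_measurable, of w] by (simp add: good_intensities_def)
qed

lemma \<Lambda>s_good: "AE w in P. \<Lambda>s i w \<in> good_intensities \<kappa>"
  by (rule sample_AE[OF good_intensities_sets[OF \<kappa>_pos] \<Lambda>_good])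

text \<open>For \<phi> = 1 these are the kernel moments u_j, for the centred quantiles the averages
  A_j.\<close>

definition local_average :: "real \<Rightarrow> nat \<Rightarrow> nat \<Rightarrow> ((real \<Rightarrow> real) \<Rightarrow> real) \<Rightarrow> 'w \<Rightarrow> real" where
  "local_average h n j \<phi> w =
     (\<Sum>i<n. kernel_scaled K h (Xs i w - x) * (Xs i w - x) ^ j * \<phi> (\<Lambda>s i w)) / real n"

lemma local_average_measurable[measurable]:
  assumes [measurable]: "\<phi> \<in> borel_measurable (intensity_space T)"
  shows "local_average h n j \<phi> \<in> borel_measurable P"
  unfolding local_average_def[abs_def] by measurable

text \<open>Constant of the squared bias plus constant of the variance; c1 measures 1/(n h) in units
  of h^4.\<close>

definition mse_const :: "real \<Rightarrow> real \<Rightarrow> real" where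
  "mse_const kb c1 = (1 + 3 * B)\<^sup>2 + kb * (1 + B) * c1"

text \<open>
  Shapes are not known to depend measurably on intensities, so measurability is needed both of a
  function \<open>\<phi>\<close> of the intensity and of the function \<open>\<phi>'\<close> of the shape that it represents.
\<close>

context
  fixes \<phi> \<phi>' :: "(real \<Rightarrow> real) \<Rightarrow> real" and b h kb c1 :: real and n :: nat
  assumes \<phi>[measurable]: "\<phi> \<in> borel_measurable (intensity_space T)"
    and \<phi>_le: "\<And>l. l \<in> space (intensity_space T) \<Longrightarrow> \<bar>\<phi> l\<bar> \<le> b"
    and \<phi>': "\<phi>' \<in> borel_measurable (shape_borel T M L)" and \<phi>'_le: "\<And>y. y \<in> shapes \<Longrightarrow> \<bar>\<phi>' y\<bar> \<le> b"
    and \<phi>_eq: "\<And>l. l \<in> good_intensities \<kappa> \<Longrightarrow> \<phi> l = \<phi>' (intensity_shape T l)"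
    and h: "0 < h" "h \<le> 1" and kb: "\<And>v. K v \<le> kb" and n: "0 < n"
    and nh: "1 / (real n * h) \<le> c1 * h ^ 4"
begin

text \<open>The variance h^(2j)/(n h) is expressed through h alone by the condition 1/(n h) \<le> c1
  h^4, which puts it on the scale of the squared bias.\<close>

lemma local_average_mean_square:
  "integrable P (\<lambda>w. (local_average h n j \<phi> w - c)\<^sup>2)"
  "expectation (\<lambda>w. (local_average h n j \<phi> w - c)\<^sup>2) \<le>
    (expectation (\<lambda>w. kernel_scaled K h (X w - x) * (X w - x) ^ j * \<phi>' (intensity_shape T (\<Lambda> w))) - c)\<^sup>2 +
    b\<^sup>2 * (kb * (1 + B)) * c1 * h ^ (2 * j + 4)"
proof -
  define G where "G z = kernel_scaled K h (fst z - x) * (fst z - x) ^ j * \<phi> (snd z)" for z :: "real \<times> (real \<Rightarrow> real)"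
  have G[measurable]: "G \<in> borel_measurable (data_space T)" unfolding G_def[abs_def] by measurable
  have b0: "0 \<le> b" by (rule b_nonneg[OF \<phi>' \<phi>'_le h kb])
  have kb0: "0 \<le> kb" using kb[of 0] K_nonneg[of 0] by linarith
  have Gb: "\<bar>G z\<bar> \<le> kb / h * h ^ j * b" if "z \<in> space (data_space T)" for z
    unfolding G_def abs_mult[of "_ * _"] using \<phi>_le[of "snd z"] that b0 h kb0
    by (intro mult_mono kernel_scaled_power_le kb) (auto simp: space_pair_measure)
  have ave: "local_average h n j \<phi> w = (\<Sum>i<n. G (Xs i w, \<Lambda>s i w)) / real n" for w
    by (simp add: local_average_def G_def)
  note iid = iid_average_mean_square[OF data_indep data_measurable data_distr G Gb n, of c]
  show "integrable P (\<lambda>w. (local_average h n j \<phi> w - c)\<^sup>2)" unfolding ave by (rule iid(1))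
  \<comment> \<open>The sample average is a function of intensities while the moments are known for
    shapes; the two agree on good intensities, that is, almost surely.\<close>
  have G_eq: "AE w in P. G (X w, \<Lambda> w) = kernel_scaled K h (X w - x) * (X w - x) ^ j * \<phi>' (intensity_shape T (\<Lambda> w))"
    using \<Lambda>_good by eventually_elim (simp add: G_def \<phi>_eq)
  have GX[measurable]: "(\<lambda>w. G (X w, \<Lambda> w)) \<in> borel_measurable P"
    using measurable_compose[OF data_measurable G] by simp
  have \<phi>'f[measurable]: "(\<lambda>w. \<phi>' (intensity_shape T (\<Lambda> w))) \<in> borel_measurable P"
    by (rule measurable_compose[OF f_measurable \<phi>'])
  have 1: "expectation (\<lambda>w. G (X w, \<Lambda> w)) =
    expectation (\<lambda>w. kernel_scaled K h (X w - x) * (X w - x) ^ j * \<phi>' (intensity_shape T (\<Lambda> w)))"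
    by (rule Bochner_Integration.integral_cong_AE[OF _ _ G_eq]) measurable
  have "expectation (\<lambda>w. (G (X w, \<Lambda> w))\<^sup>2) =
    expectation (\<lambda>w. (kernel_scaled K h (X w - x) * (X w - x) ^ j * \<phi>' (intensity_shape T (\<Lambda> w)))\<^sup>2)"
  proof (rule Bochner_Integration.integral_cong_AE)
    show "AE w in P. (G (X w, \<Lambda> w))\<^sup>2 = (kernel_scaled K h (X w - x) * (X w - x) ^ j * \<phi>' (intensity_shape T (\<Lambda> w)))\<^sup>2"
      using G_eq by eventually_elim simp
  qed measurable
  also have "\<dots> \<le> b\<^sup>2 * (kb * (1 + B)) * h ^ (2 * j) / h"
    by (rule local_moment_sq[OF \<phi>' \<phi>'_le h kb])
  finally have "expectation (\<lambda>w. (G (X w, \<Lambda> w))\<^sup>2) / real n \<le> b\<^sup>2 * (kb * (1 + B)) * h ^ (2 * j) / h / real n"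
    by (rule divide_right_mono) simp
  also have "\<dots> = b\<^sup>2 * (kb * (1 + B)) * h ^ (2 * j) * (1 / (real n * h))" by simp
  also have "\<dots> \<le> b\<^sup>2 * (kb * (1 + B)) * h ^ (2 * j) * (c1 * h ^ 4)"
    using kb0 B_nonneg h by (intro mult_left_mono nh) auto
  also have "\<dots> = b\<^sup>2 * (kb * (1 + B)) * c1 * h ^ (2 * j + 4)" by (simp add: power_add mult_ac)
  finally have 2: "expectation (\<lambda>w. (G (X w, \<Lambda> w))\<^sup>2) / real n \<le> b\<^sup>2 * (kb * (1 + B)) * c1 * h ^ (2 * j + 4)" .
  show "expectation (\<lambda>w. (local_average h n j \<phi> w - c)\<^sup>2) \<le>
    (expectation (\<lambda>w. kernel_scaled K h (X w - x) * (X w - x) ^ j * \<phi>' (intensity_shape T (\<Lambda> w))) - c)\<^sup>2 +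
    b\<^sup>2 * (kb * (1 + B)) * c1 * h ^ (2 * j + 4)"
    unfolding ave using iid(2) 2 unfolding 1 by linarith
qed

lemma c1_nonneg: "0 \<le> c1"
proof -
  have "0 < 1 / (real n * h)" using n h by simp
  then have "0 < c1 * h ^ 4" using nh by linarith
  then show ?thesis using h by (simp add: zero_less_mult_iff)
qed

text \<open>The bias has order h^i, and the condition on i says that the variance is then of no
  larger order, as h \<le> 1.\<close>

lemma local_average_bound:
  assumes bias: "\<bar>expectation (\<lambda>w. kernel_scaled K h (X w - x) * (X w - x) ^ j * \<phi>' (intensity_shape T (\<Lambda> w))) - c\<bar>
      \<le> b * ((1 + 3 * B) * h ^ i)" and i: "2 * i \<le> 2 * j + 4"
  shows "expectation (\<lambda>w. (local_average h n j \<phi> w - c)\<^sup>2) \<le> b\<^sup>2 * mse_const kb c1 * h ^ (2 * i)"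
proof -
  have kb0: "0 \<le> kb" using kb[of 0] K_nonneg[of 0] by linarith
  have "(expectation (\<lambda>w. kernel_scaled K h (X w - x) * (X w - x) ^ j * \<phi>' (intensity_shape T (\<Lambda> w))) - c)\<^sup>2
      \<le> (b * ((1 + 3 * B) * h ^ i))\<^sup>2"
    using power_mono[OF bias, of 2] by simp
  also have "\<dots> = b\<^sup>2 * (1 + 3 * B)\<^sup>2 * h ^ (2 * i)" by (simp add: power_mult_distrib power_mult[symmetric] mult.commute)
  finally have 1: "(expectation (\<lambda>w. kernel_scaled K h (X w - x) * (X w - x) ^ j * \<phi>' (intensity_shape T (\<Lambda> w))) - c)\<^sup>2
      \<le> b\<^sup>2 * (1 + 3 * B)\<^sup>2 * h ^ (2 * i)" .
  have "h ^ (2 * j + 4) \<le> h ^ (2 * i)" using i h by (intro power_decreasing) auto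
  then have "b\<^sup>2 * (kb * (1 + B)) * c1 * h ^ (2 * j + 4) \<le> b\<^sup>2 * (kb * (1 + B)) * c1 * h ^ (2 * i)"
    using kb0 B_nonneg c1_nonneg by (intro mult_left_mono) auto
  then show ?thesis using local_average_mean_square(2)[of j c] 1 by (simp add: mse_const_def algebra_simps)
qed

lemma local_average_0:
  "expectation (\<lambda>w. (local_average h n 0 \<phi> w - expectation (\<lambda>w. \<phi>' (intensity_shape T (\<Lambda> w)) * g (intensity_shape T (\<Lambda> w)) x))\<^sup>2)
    \<le> b\<^sup>2 * mse_const kb c1 * h ^ 4"
proof -
  have b0: "0 \<le> b" by (rule b_nonneg[OF \<phi>' \<phi>'_le h kb])
  have "b * (B * h\<^sup>2) \<le> b * ((1 + 3 * B) * h\<^sup>2)" using b0 B_nonneg by (intro mult_left_mono mult_right_mono) auto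
  with local_moment_bias_0[OF \<phi>' \<phi>'_le h kb, of x]
  have "\<bar>expectation (\<lambda>w. kernel_scaled K h (X w - x) * (X w - x) ^ 0 * \<phi>' (intensity_shape T (\<Lambda> w))) -
    expectation (\<lambda>w. \<phi>' (intensity_shape T (\<Lambda> w)) * g (intensity_shape T (\<Lambda> w)) x)\<bar> \<le> b * ((1 + 3 * B) * h\<^sup>2)"
    by simp
  from local_average_bound[OF this] show ?thesis by simp
qed

text \<open>Symmetry of the kernel cancels the term of order h, so the average itself, without
  centring, has size h^2.\<close>

lemma local_average_1: "expectation (\<lambda>w. (local_average h n 1 \<phi> w)\<^sup>2) \<le> b\<^sup>2 * mse_const kb c1 * h ^ 4"
proof -
  have "\<bar>expectation (\<lambda>w. kernel_scaled K h (X w - x) * (X w - x) ^ 1 * \<phi>' (intensity_shape T (\<Lambda> w))) - 0\<bar>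
    \<le> b * ((1 + 3 * B) * h\<^sup>2)"
    using local_moment_bias[OF \<phi>' \<phi>'_le h kb, where j=1 and x=x] unfolding k_moment_1
    by (simp add: power2_eq_square)
  from local_average_bound[OF this] show ?thesis by simp
qed

text \<open>The error of order h^3 is small relative to the main term of order h^2, which is what a
  lower bound on u_2 needs.\<close>

lemma local_average_2:
  "expectation (\<lambda>w. (local_average h n 2 \<phi> w - h\<^sup>2 * k_moment 2 *
     expectation (\<lambda>w. \<phi>' (intensity_shape T (\<Lambda> w)) * g (intensity_shape T (\<Lambda> w)) x))\<^sup>2) \<le> b\<^sup>2 * mse_const kb c1 * h ^ 6"
  using local_average_bound[of 2 _ 3, OF local_moment_bias[OF \<phi>' \<phi>'_le h kb, where j=2 and x=x, unfolded eval_nat_numeral, folded eval_nat_numeral]]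
  by (simp add: eval_nat_numeral)

end

end

section \<open>Integrated deviations of the sample\<close>

context sampling_model
begin

text \<open>The value 0 in place of the quantile off the good intensities, a null event for the
  sample, makes it measurable in l; \<open>clamp01\<close> makes it continuous in t. Together they
  give joint measurability.\<close>

definition centred_quantile :: "real \<Rightarrow> (real \<Rightarrow> real) \<Rightarrow> real" where
  "centred_quantile t l = (if l \<in> good_intensities \<kappa> then density_quantile T (intensity_shape T l) (clamp01 t) else 0) -
     mean_quantile (clamp01 t)"

lemma centred_quantile_measurable[measurable]: "centred_quantile t \<in> borel_measurable (intensity_space T)"
proof -
  note [measurable] = good_intensities_sets[OF \<kappa>_pos] intensity_quantile_measurable[OF clamp01_mem]
  have "(\<lambda>l. (if l \<in> good_intensities \<kappa> then intensity_quantile (clamp01 t) l else 0) - mean_quantile (clamp01 t))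
    \<in> borel_measurable (intensity_space T)" by measurable
  also have "(\<lambda>l. (if l \<in> good_intensities \<kappa> then intensity_quantile (clamp01 t) l else 0) - mean_quantile (clamp01 t)) =
    centred_quantile t"
    using \<kappa>_pos by (auto simp: centred_quantile_def fun_eq_iff intensity_quantile_def good_intensities_def)
  finally show ?thesis .
qed

lemma centred_quantile_le: "\<bar>centred_quantile t l\<bar> \<le> T"
proof -
  have "mean_quantile (clamp01 t) \<in> {0..T}" by (rule shape_quantile_range[OF mean_quantile_shape clamp01_mem])
  moreover have "density_quantile T (intensity_shape T l) (clamp01 t) \<in> {0..T}" if "l \<in> good_intensities \<kappa>"
    using that by (intro density_quantile_range clamp01_mem) (auto simp: good_intensities_def)
  ultimately show ?thesis by (auto simp: centred_quantile_def)
qed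

lemma centred_quantile_continuous: "continuous_on UNIV (\<lambda>t. centred_quantile t l)"
proof -
  have comp: "continuous_on UNIV (\<lambda>t. p (clamp01 t))" if "p \<in> shape_quantiles T M L" for p
    by (rule continuous_on_compose2[OF shape_quantile_continuous[OF that] continuous_clamp01])
       (auto simp: clamp01_mem[simplified])
  have m: "continuous_on UNIV (\<lambda>t. mean_quantile (clamp01 t))" by (rule comp[OF mean_quantile_shape])
  show ?thesis
  proof (cases "l \<in> good_intensities \<kappa>")
    case True
    then have "continuous_on UNIV (\<lambda>t. density_quantile T (intensity_shape T l) (clamp01 t))"
      by (intro comp density_quantile_shape) (auto simp: good_intensities_def)
    from continuous_on_diff[OF this m] show ?thesis using True by (simp add: centred_quantile_def)
  next
    case False
    from continuous_on_minus[OF m] show ?thesis using False by (simp add: centred_quantile_def)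
  qed
qed

lemma expectation_kernel_sample:
  assumes h: "0 < h" "h \<le> 1"
  shows "(\<integral>\<^sup>+w. ennreal (kernel_scaled K h (Xs i w - x)) \<partial>P) \<le> ennreal (1 + B)"
proof -
  obtain kb where kb: "\<And>v. K v \<le> kb" using K_bounded by blast
  have m: "(\<lambda>z. ennreal (kernel_scaled K h (fst z - x))) \<in> borel_measurable (data_space T)" by measurable
  have int: "integrable P (\<lambda>w. kernel_scaled K h (X w - x))"
    using kernel_scaled_power_le(1)[OF h(1) kb, of _ 0]
    by (intro integrable_const_bound[where B="kb / h"]) auto
  have "(\<integral>\<^sup>+w. ennreal (kernel_scaled K h (Xs i w - x)) \<partial>P) =
    (\<integral>\<^sup>+z. ennreal (kernel_scaled K h (fst z - x)) \<partial>distr P (data_space T) (\<lambda>w. (Xs i w, \<Lambda>s i w)))"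
    using m by (subst nn_integral_distr) auto
  also have "\<dots> = (\<integral>\<^sup>+w. ennreal (kernel_scaled K h (X w - x)) \<partial>P)"
    unfolding data_distr using m data_measurable by (subst nn_integral_distr) auto
  also have "\<dots> = ennreal (expectation (\<lambda>w. kernel_scaled K h (X w - x)))"
    using kernel_scaled_nonneg[OF h(1)] by (intro nn_integral_eq_integral int) auto
  also have "\<dots> \<le> ennreal (1 + B)"
    using expectation_kernel_le[of "\<lambda>_. 1" 1 h kb x] h kb by (intro ennreal_leI) auto
  finally show ?thesis .
qed

context
  fixes h a kb c1 :: real and n k :: nat and N :: "nat \<Rightarrow> 'w \<Rightarrow> real multiset"
  assumes h: "0 < h" "h \<le> 1" and kb: "\<And>v. K v \<le> kb" and n: "0 < n"
    and nh: "1 / (real n * h) \<le> c1 * h ^ 4" and a: "0 < a" and k: "0 < k"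
    and N: "cond_poisson_processes P T a n (\<lambda>i w. (Xs i w, \<Lambda>s i w)) N"
begin

abbreviation "C0 \<equiv> mse_const kb c1"

text \<open>The integrated square of A_j, extended valued so that exchanging the integrals needs
  joint measurability only.\<close>

definition quantile_deviation :: "nat \<Rightarrow> 'w \<Rightarrow> ennreal" where
  "quantile_deviation j w = (\<integral>\<^sup>+t. ennreal ((local_average h n j (centred_quantile t) w)\<^sup>2) \<partial>unit_lborel)"

lemma quantile_deviation_joint:
  "(\<lambda>p. ennreal ((local_average h n j (centred_quantile (snd p)) (fst p))\<^sup>2)) \<in> borel_measurable (P \<Otimes>\<^sub>M unit_lborel)"
proof -
  have "(\<lambda>p. local_average h n j (centred_quantile (snd p)) (fst p)) \<in> borel_measurable (P \<Otimes>\<^sub>M borel)"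
  proof (rule borel_measurable_caratheodory[where F="\<lambda>w t. local_average h n j (centred_quantile t) w"])
    fix w
    show "continuous_on UNIV (\<lambda>t. local_average h n j (centred_quantile t) w)"
      unfolding local_average_def by (intro continuous_intros centred_quantile_continuous) (use n in auto)
  qed measurable
  moreover have "(\<lambda>p. (fst p, snd p)) \<in> P \<Otimes>\<^sub>M unit_lborel \<rightarrow>\<^sub>M P \<Otimes>\<^sub>M borel"
    by (intro measurable_Pair measurable_fst measurable_compose[OF measurable_snd] measurable_restrict_space1) simp
  ultimately have "(\<lambda>p. local_average h n j (centred_quantile (snd p)) (fst p)) \<in> borel_measurable (P \<Otimes>\<^sub>M unit_lborel)"
    using measurable_compose by fastforce
  then show ?thesis by measurable
qed

lemma quantile_deviation_measurable: "quantile_deviation j \<in> borel_measurable P"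
proof -
  interpret U: prob_space unit_lborel by (rule prob_space_unit_lborel)
  show ?thesis unfolding quantile_deviation_def[abs_def]
    using U.borel_measurable_nn_integral_fst[OF quantile_deviation_joint[of j]] by simp
qed

text \<open>After exchanging the integrals, every level t is an instance of the local averages with
  bound T, uniformly in t.\<close>

lemma quantile_deviation_le:
  assumes j: "j = 0 \<or> j = 1"
  shows "(\<integral>\<^sup>+w. quantile_deviation j w \<partial>P) \<le> ennreal (T\<^sup>2 * C0 * h ^ 4)"
proof -
  interpret U: prob_space unit_lborel by (rule prob_space_unit_lborel)
  interpret pair_sigma_finite P unit_lborel ..
  have "(\<integral>\<^sup>+w. quantile_deviation j w \<partial>P) =
    (\<integral>\<^sup>+t. (\<integral>\<^sup>+w. ennreal ((local_average h n j (centred_quantile t) w)\<^sup>2) \<partial>P) \<partial>unit_lborel)"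
    unfolding quantile_deviation_def
    using Fubini[OF quantile_deviation_joint[of j]] by simp
  also have "\<dots> \<le> (\<integral>\<^sup>+t. ennreal (T\<^sup>2 * C0 * h ^ 4) \<partial>unit_lborel)"
  proof (rule nn_integral_mono)
    fix t assume "t \<in> space unit_lborel"
    then have t: "t \<in> {0..1}" by (simp add: space_restrict_space)
    define \<phi>' where "\<phi>' y = density_quantile T y t - mean_quantile t" for y
    have 1: "\<phi>' \<in> borel_measurable (shape_borel T M L)"
      unfolding \<phi>'_def[abs_def] using density_quantile_measurable[OF t] by measurable
    have 2: "\<bar>\<phi>' y\<bar> \<le> T" if "y \<in> shapes" for y
      using density_quantile_range[OF that t] shape_quantile_range[OF mean_quantile_shape t] by (auto simp: \<phi>'_def)
    have 3: "centred_quantile t l = \<phi>' (intensity_shape T l)" if "l \<in> good_intensities \<kappa>" for l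
      using that t by (simp add: centred_quantile_def \<phi>'_def clamp01_id)
    note facts = centred_quantile_measurable centred_quantile_le 1 2 3 h kb n nh
    \<comment> \<open>Bayes' formula at x: the centre that \<open>local_average_0\<close> prescribes
      for A_0 is zero.\<close>
    have 0: "expectation (\<lambda>w. \<phi>' (intensity_shape T (\<Lambda> w)) * g (intensity_shape T (\<Lambda> w)) x) = 0"
      using expectation_g_at_centred[OF t, of x] t by (simp add: \<phi>'_def mean_quantile_def)
    have i: "integrable P (\<lambda>w. (local_average h n j (centred_quantile t) w)\<^sup>2)"
      using local_average_mean_square(1)[OF facts, of j 0] by simp
    have "expectation (\<lambda>w. (local_average h n j (centred_quantile t) w)\<^sup>2) \<le> T\<^sup>2 * C0 * h ^ 4"
      using j local_average_0[OF facts, unfolded 0] local_average_1[OF facts] by auto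
    then show "(\<integral>\<^sup>+w. ennreal ((local_average h n j (centred_quantile t) w)\<^sup>2) \<partial>P) \<le> ennreal (T\<^sup>2 * C0 * h ^ 4)"
      using i by (subst nn_integral_eq_integral) (auto intro: ennreal_leI)
  qed
  also have "\<dots> = ennreal (T\<^sup>2 * C0 * h ^ 4)" by (simp add: U.emeasure_space_1[simplified])
  finally show ?thesis .
qed

text \<open>The indicator makes the weight a bounded multiple of the kernel, since the total
  intensity is at least \<kappa> there.\<close>

definition count_weight :: "real \<times> (real \<Rightarrow> real) \<Rightarrow> real" where
  "count_weight z = indicator (good_intensities \<kappa>) (snd z) * kernel_scaled K h (fst z - x) / (a * total_intensity T (snd z))\<^sup>2"

definition count_deviation :: "'w \<Rightarrow> ennreal" where
  "count_deviation w = (\<Sum>i<n. \<Sum>j\<le>k. ennreal (count_weight (Xs i w, \<Lambda>s i w) *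
     (real (points_in (N i w) {0..real j * T / real k}) -
      a * (LINT t:{0..real j * T / real k}|lborel. \<Lambda>s i w t))\<^sup>2)) / of_nat n"

lemma grid_subset: "j \<le> k \<Longrightarrow> {0..real j * T / real k} \<subseteq> {0..T}"
  using k T_pos by (auto simp: field_simps intro: order_trans mult_right_mono)

lemma count_weight_measurable[measurable]: "count_weight \<in> borel_measurable (data_space T)"
  unfolding count_weight_def[abs_def] using good_intensities_sets[OF \<kappa>_pos] by measurable

lemma count_term_measurable:
  assumes "i < n" "j \<le> k"
  shows "(\<lambda>w. ennreal (count_weight (Xs i w, \<Lambda>s i w) *
     (real (points_in (N i w) {0..real j * T / real k}) -
      a * (LINT t:{0..real j * T / real k}|lborel. \<Lambda>s i w t))\<^sup>2)) \<in> borel_measurable P"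
proof -
  have [measurable]: "(\<lambda>w. points_in (N i w) {0..real j * T / real k}) \<in> P \<rightarrow>\<^sub>M count_space UNIV"
    using N assms unfolding cond_poisson_processes_def by auto
  have [measurable]: "(\<lambda>w. LINT t:{0..real j * T / real k}|lborel. \<Lambda>s i w t) \<in> borel_measurable P"
    by (rule measurable_compose[OF \<Lambda>s_measurable set_integral_measurable]) (use grid_subset[OF assms(2)] in auto)
  have [measurable]: "(\<lambda>w. count_weight (Xs i w, \<Lambda>s i w)) \<in> borel_measurable P"
    by (rule measurable_compose[OF sample_measurable count_weight_measurable])
  show ?thesis by measurable
qed

lemma count_deviation_measurable: "count_deviation \<in> borel_measurable P"
  unfolding count_deviation_def[abs_def]
  by (intro borel_measurable_divide_ennreal borel_measurable_sum count_term_measurable borel_measurable_const) auto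

text \<open>A grid count has variance at most a*\<tau>, which divided by (a*\<tau>)^2 leaves at most
  1/(a*\<kappa>). The kernel has expectation at most 1 + B, and there are k + 1 grid points.\<close>

lemma count_deviation_le:
  "(\<integral>\<^sup>+w. count_deviation w \<partial>P) \<le> ennreal ((real k + 1) * (1 + B) / (a * \<kappa>))"
proof -
  have summand_le: "(\<integral>\<^sup>+w. ennreal (count_weight (Xs i w, \<Lambda>s i w) *
     (real (points_in (N i w) {0..real j * T / real k}) -
      a * (LINT t:{0..real j * T / real k}|lborel. \<Lambda>s i w t))\<^sup>2) \<partial>P) \<le> ennreal ((1 + B) / (a * \<kappa>))"
    if i: "i < n" and j: "j \<le> k" for i j
  proof -
    define A where "A = {0..real j * T / real k}"
    have A: "A \<in> sets borel" "A \<subseteq> {0..T}" using grid_subset[OF j] by (auto simp: A_def)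
    have cw: "0 \<le> count_weight z" for z
      using kernel_scaled_nonneg[OF h(1)] by (simp add: count_weight_def)
    have "(\<integral>\<^sup>+w. ennreal (count_weight (Xs i w, \<Lambda>s i w) *
       (real (points_in (N i w) A) - a * (LINT t:A|lborel. \<Lambda>s i w t))\<^sup>2) \<partial>P) =
      (\<integral>\<^sup>+w. ennreal (count_weight (Xs i w, \<Lambda>s i w) * (a * (LINT t:A|lborel. \<Lambda>s i w t))) \<partial>P)"
      using count_mean_square[OF prob_space_axioms sample_measurable a N i A count_weight_measurable cw]
      by (simp add: count_mean_def)
    also have "\<dots> \<le> (\<integral>\<^sup>+w. ennreal (1 / (a * \<kappa>)) * ennreal (kernel_scaled K h (Xs i w - x)) \<partial>P)"
    proof (rule nn_integral_mono)
      fix w assume w: "w \<in> space P"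
      define l where "l = \<Lambda>s i w"
      define r where "r = (LINT t:A|lborel. l t)"
      have l: "l \<in> space (intensity_space T)" unfolding l_def by (rule measurable_space[OF \<Lambda>s_measurable w])
      have r: "0 \<le> r" "r \<le> total_intensity T l" using set_integral_intensity_bounds[OF l A] by (auto simp: r_def)
      have "count_weight (Xs i w, l) * (a * r) \<le> 1 / (a * \<kappa>) * kernel_scaled K h (Xs i w - x)"
      proof (cases "l \<in> good_intensities \<kappa>")
        case True
        then have \<tau>: "\<kappa> \<le> total_intensity T l" by (simp add: good_intensities_def)
        then have \<tau>0: "0 < total_intensity T l" using \<kappa>_pos by linarith
        have "(a * r) / (a * total_intensity T l)\<^sup>2 \<le> (a * total_intensity T l) / (a * total_intensity T l)\<^sup>2"
          using r a by (intro divide_right_mono mult_left_mono) auto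
        also have "\<dots> = 1 / (a * total_intensity T l)" using a \<tau>0 by (simp add: power2_eq_square)
        also have "\<dots> \<le> 1 / (a * \<kappa>)" using a \<tau> \<kappa>_pos by (intro divide_left_mono mult_left_mono) auto
        finally have "kernel_scaled K h (Xs i w - x) * ((a * r) / (a * total_intensity T l)\<^sup>2) \<le>
          kernel_scaled K h (Xs i w - x) * (1 / (a * \<kappa>))"
          using kernel_scaled_nonneg[OF h(1)] by (intro mult_left_mono) auto
        then show ?thesis using True by (simp add: count_weight_def mult_ac)
      next
        case False
        then show ?thesis using kernel_scaled_nonneg[OF h(1)] a \<kappa>_pos by (simp add: count_weight_def)
      qed
      then show "ennreal (count_weight (Xs i w, \<Lambda>s i w) * (a * (LINT t:A|lborel. \<Lambda>s i w t))) \<le>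
        ennreal (1 / (a * \<kappa>)) * ennreal (kernel_scaled K h (Xs i w - x))"
        using kernel_scaled_nonneg[OF h(1)] a \<kappa>_pos
        by (simp add: ennreal_mult[symmetric] l_def r_def ennreal_leI)
    qed
    also have "\<dots> = ennreal (1 / (a * \<kappa>)) * (\<integral>\<^sup>+w. ennreal (kernel_scaled K h (Xs i w - x)) \<partial>P)"
      by (rule nn_integral_cmult) measurable
    also have "\<dots> \<le> ennreal (1 / (a * \<kappa>)) * ennreal (1 + B)"
      by (intro mult_left_mono expectation_kernel_sample h) simp
    also have "\<dots> = ennreal ((1 + B) / (a * \<kappa>))" using a \<kappa>_pos B_nonneg by (subst ennreal_mult[symmetric]) auto
    finally show ?thesis unfolding A_def .
  qed
  have "(\<integral>\<^sup>+w. count_deviation w \<partial>P) = (\<Sum>i<n. \<Sum>j\<le>k. (\<integral>\<^sup>+w. ennreal (count_weight (Xs i w, \<Lambda>s i w) *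
     (real (points_in (N i w) {0..real j * T / real k}) -
      a * (LINT t:{0..real j * T / real k}|lborel. \<Lambda>s i w t))\<^sup>2) \<partial>P)) / of_nat n"
    unfolding count_deviation_def
    by (subst nn_integral_divide, (intro borel_measurable_sum count_term_measurable; simp),
        subst nn_integral_sum, (intro borel_measurable_sum count_term_measurable; simp),
        intro arg_cong2[where f="(/)"] sum.cong refl nn_integral_sum count_term_measurable) auto
  also have "\<dots> \<le> (\<Sum>i<n. \<Sum>j\<le>k. ennreal ((1 + B) / (a * \<kappa>))) / of_nat n"
    by (intro divide_right_mono_ennreal sum_mono summand_le) auto
  also have "(\<Sum>i<n. \<Sum>j\<le>k. ennreal ((1 + B) / (a * \<kappa>))) = ennreal (\<Sum>i<n. \<Sum>j\<le>k. (1 + B) / (a * \<kappa>))"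
  proof -
    have "0 \<le> (1 + B) / (a * \<kappa>)" using a \<kappa>_pos B_nonneg by simp
    then show ?thesis
      by (simp only: sum_ennreal sum_nonneg)
  qed
  also have "\<dots> / of_nat n = ennreal ((\<Sum>i<n. \<Sum>j\<le>k. (1 + B) / (a * \<kappa>)) / real n)"
    using n a \<kappa>_pos B_nonneg by (simp add: ennreal_of_nat_eq_real_of_nat divide_ennreal sum_nonneg)
  also have "(\<Sum>i<n. \<Sum>j\<le>k. (1 + B) / (a * \<kappa>)) / real n = (real k + 1) * (1 + B) / (a * \<kappa>)"
    using n by simp
  finally show ?thesis .
qed

text \<open>c is chosen so that Markov's inequality at level \<eta> gives |u_1| \<le> c h^2. The
  smallness conditions, satisfied once h is small, turn the deviations of u_0, u_2 and u_1^2 into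
  the relative bounds demanded by \<open>estimator_error\<close>.\<close>

lemma estimator_event:
  fixes \<eta> :: real
  defines "f0 \<equiv> fX x" and "k2 \<equiv> k_moment 2" and "c \<equiv> sqrt (C0 / \<eta>)"
  defines "R \<equiv> 16 / f0 + 8 * c / (k2 * f0\<^sup>2)"
  assumes \<eta>: "0 < \<eta>"
    and small: "c * h\<^sup>2 \<le> f0 / 2" "c * h \<le> k2 * f0 / 2" "c\<^sup>2 * h\<^sup>2 \<le> k2 * f0\<^sup>2 / 8"
  shows "\<exists>E\<in>sets P. 1 - 6 * \<eta> \<le> prob E \<and> (\<forall>w\<in>E.
    (shape_dist T (frechet_mean T M L (\<nu> x)) (density_estimator T M L K h x n (\<lambda>i. Xs i w) (\<lambda>i. N i w)))\<^sup>2 \<le>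
    24 * R\<^sup>2 * (2 * f0 * (8 * L\<^sup>2 * ((real k + 1) * (1 + B) / (a * \<kappa>) / \<eta>) + 4 * f0 * L\<^sup>2 * (T / (real k * M))\<^sup>2) +
       2 * (T\<^sup>2 * C0 * h ^ 4 / \<eta>)))"
proof -
  define u where "u j w = local_average h n j (\<lambda>_. 1) w" for j w
  define V0 where "V0 = (real k + 1) * (1 + B) / (a * \<kappa>)"
  define W0 where "W0 = T\<^sup>2 * C0 * h ^ 4"
  have f0: "0 < f0" and k2: "0 < k2" by (auto simp: f0_def k2_def fX_pos k_moment_2)
  have kb0: "0 \<le> kb" using kb[of 0] K_nonneg[of 0] by linarith
  have c1: "0 \<le> c1"
  proof -
    have "0 < 1 / (real n * h)" using n h by simp
    then have "0 < c1 * h ^ 4" using nh by linarith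
    then show ?thesis using h by (simp add: zero_less_mult_iff)
  qed
  have C0: "0 < C0" unfolding mse_const_def using kb0 B_nonneg c1
    by (intro add_pos_nonneg mult_nonneg_nonneg zero_less_power) auto
  have c: "0 \<le> c" "c\<^sup>2 = C0 / \<eta>" using C0 \<eta> by (auto simp: c_def)
  have V0: "0 < V0" using a \<kappa>_pos B_nonneg by (simp add: V0_def)
  have W0: "0 < W0" using T_pos C0 h by (simp add: W0_def)
  have 1: "(\<lambda>_. 1::real) \<in> borel_measurable (intensity_space T)" "(\<lambda>_. 1::real) \<in> borel_measurable (shape_borel T M L)"
    by auto
  note facts = 1(1) _ 1(2) _ _ h kb n nh
  have i: "integrable P (\<lambda>w. (u j w - r)\<^sup>2)" for j r
    unfolding u_def by (rule local_average_mean_square(1)[OF facts, where b=1]) auto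
  have e0: "expectation (\<lambda>w. (u 0 w - f0)\<^sup>2) \<le> C0 * h ^ 4"
    using local_average_0[OF facts, where b=1] by (simp add: u_def f0_def expectation_g_at_1)
  have e1: "expectation (\<lambda>w. (u 1 w - 0)\<^sup>2) \<le> C0 * h ^ 4"
    using local_average_1[OF facts, where b=1] by (simp add: u_def)
  have e2: "expectation (\<lambda>w. (u 2 w - h\<^sup>2 * k2 * f0)\<^sup>2) \<le> C0 * h ^ 6"
    using local_average_2[OF facts, where b=1] by (simp add: u_def f0_def k2_def expectation_g_at_1)
  have u_meas[measurable]: "u j \<in> borel_measurable P" for j unfolding u_def[abs_def] by measurable
  note [measurable] = quantile_deviation_measurable count_deviation_measurable
  \<comment> \<open>G has probability 1. Each of the six other events (three moments, A_0 and A_1,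
    the counts) fails with probability at most \<eta>.\<close>
  define G where "G = {w \<in> space P. \<forall>i\<in>{..<n}. \<Lambda>s i w \<in> good_intensities \<kappa>}"
  define E0 where "E0 = {w \<in> space P. (u 0 w - f0)\<^sup>2 \<le> C0 * h ^ 4 / \<eta>}"
  define E1 where "E1 = {w \<in> space P. (u 1 w - 0)\<^sup>2 \<le> C0 * h ^ 4 / \<eta>}"
  define E2 where "E2 = {w \<in> space P. (u 2 w - h\<^sup>2 * k2 * f0)\<^sup>2 \<le> C0 * h ^ 6 / \<eta>}"
  define F where "F j = {w \<in> space P. quantile_deviation j w \<le> ennreal (W0 / \<eta>)}" for j
  define H where "H = {w \<in> space P. count_deviation w \<le> ennreal (V0 / \<eta>)}"
  have ev: "G \<in> events" "E0 \<in> events" "E1 \<in> events" "E2 \<in> events" "F j \<in> events" "H \<in> events" for j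
    unfolding G_def E0_def E1_def E2_def F_def H_def using good_intensities_sets[OF \<kappa>_pos] by measurable
  have p: "1 - \<eta> \<le> prob E0" "1 - \<eta> \<le> prob E1" "1 - \<eta> \<le> prob E2"
    unfolding E0_def E1_def E2_def
    by (rule markov_event_real[OF i _ e0 _ \<eta>] markov_event_real[OF i _ e1 _ \<eta>]
          markov_event_real[OF i _ e2 _ \<eta>]; use C0 h in simp)+
  have pF: "1 - \<eta> \<le> prob (F j)" if "j = 0 \<or> j = 1" for j
    unfolding F_def using quantile_deviation_le[OF that] W0
    by (intro markov_event \<eta>) (auto simp: W0_def)
  have pH: "1 - \<eta> \<le> prob H"
    unfolding H_def using count_deviation_le V0 by (intro markov_event \<eta>) (auto simp: V0_def)
  have pG: "1 - 0 \<le> prob G"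
  proof -
    have "AE w in P. \<forall>i\<in>{..<n}. \<Lambda>s i w \<in> good_intensities \<kappa>"
      by (intro AE_finite_allI \<Lambda>s_good) auto
    then have "AE w in P. w \<in> G" using AE_space by eventually_elim (simp add: G_def)
    then show ?thesis using prob_eq_1[OF ev(1)] by simp
  qed
  define E where "E = G \<inter> (E0 \<inter> (E1 \<inter> (E2 \<inter> (F 0 \<inter> (F 1 \<inter> H)))))"
  have E: "E \<in> events" unfolding E_def by (intro sets.Int ev)
  have "1 - (0 + (\<eta> + (\<eta> + (\<eta> + (\<eta> + (\<eta> + \<eta>)))))) \<le> prob E"
    unfolding E_def by (intro prob_Int_ge sets.Int ev p pG pF pH) auto
  then have prob_E: "1 - 6 * \<eta> \<le> prob E" by (simp add: algebra_simps)
  have "(shape_dist T (frechet_mean T M L (\<nu> x)) (density_estimator T M L K h x n (\<lambda>i. Xs i w) (\<lambda>i. N i w)))\<^sup>2 \<le>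
    24 * R\<^sup>2 * (2 * f0 * (8 * L\<^sup>2 * (V0 / \<eta>) + 4 * f0 * L\<^sup>2 * (T / (real k * M))\<^sup>2) + 2 * (W0 / \<eta>))"
    if w: "w \<in> E" for w
  proof -
    have wP: "w \<in> space P" and good: "\<And>i. i < n \<Longrightarrow> \<Lambda>s i w \<in> good_intensities \<kappa>"
      and w0: "(u 0 w - f0)\<^sup>2 \<le> C0 * h ^ 4 / \<eta>" and w1: "(u 1 w)\<^sup>2 \<le> C0 * h ^ 4 / \<eta>"
      and w2: "(u 2 w - h\<^sup>2 * k2 * f0)\<^sup>2 \<le> C0 * h ^ 6 / \<eta>"
      and wF: "\<And>j. j = 0 \<or> j = 1 \<Longrightarrow> quantile_deviation j w \<le> ennreal (W0 / \<eta>)"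
      and wH: "count_deviation w \<le> ennreal (V0 / \<eta>)"
      using w by (auto simp: E_def G_def E0_def E1_def E2_def F_def H_def)
    have Ns: "set_mset (N i w) \<subseteq> {0..T}" if "i < n" for i
      using N that wP unfolding cond_poisson_processes_def by blast
    \<comment> \<open>Used with i = 2 for u_0 and u_1 and with i = 3 for u_2.\<close>
    have abs: "\<bar>y\<bar> \<le> c * h ^ i" if "y\<^sup>2 \<le> C0 * h ^ (2 * i) / \<eta>" for y :: real and i
    proof -
      have "y\<^sup>2 \<le> (c * h ^ i)\<^sup>2" using that unfolding power_mult_distrib c(2) by (simp add: power_mult[symmetric] mult.commute)
      then show ?thesis using c(1) h by (simp add: abs_le_square_iff[symmetric])
    qed
    have v0: "\<bar>u 0 w - f0\<bar> \<le> f0 / 2" using abs[of "u 0 w - f0" 2] w0 small(1) by simp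
    have v1: "\<bar>u 1 w\<bar> \<le> c * h\<^sup>2" using abs[of "u 1 w" 2] w1 by simp
    have v1': "(u 1 w)\<^sup>2 \<le> h\<^sup>2 * k2 * f0\<^sup>2 / 8"
    proof -
      have "(u 1 w)\<^sup>2 \<le> h\<^sup>2 * (c\<^sup>2 * h\<^sup>2)" using w1 unfolding c(2) by (simp add: power2_eq_square eval_nat_numeral mult_ac)
      also have "\<dots> \<le> h\<^sup>2 * (k2 * f0\<^sup>2 / 8)" by (intro mult_left_mono small) simp
      finally show ?thesis by (simp add: mult_ac)
    qed
    have v2: "\<bar>u 2 w - h\<^sup>2 * k2 * f0\<bar> \<le> h\<^sup>2 * k2 * f0 / 2"
    proof -
      have "\<bar>u 2 w - h\<^sup>2 * k2 * f0\<bar> \<le> h\<^sup>2 * (c * h)"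
        using abs[of "u 2 w - h\<^sup>2 * k2 * f0" 3] w2 by (simp add: power2_eq_square power3_eq_cube mult_ac)
      also have "\<dots> \<le> h\<^sup>2 * (k2 * f0 / 2)" by (intro mult_left_mono small) simp
      finally show ?thesis by (simp add: mult_ac)
    qed
    have km: "kernel_moment K h x n (\<lambda>i. Xs i w) j = u j w" for j
      by (simp add: kernel_moment_def u_def local_average_def)
    define A where "A j t = (\<Sum>i<n. kernel_scaled K h (Xs i w - x) * (Xs i w - x) ^ j *
                 (density_quantile T (intensity_shape T (\<Lambda>s i w)) t - mean_quantile t)) / real n" for j t
    define V where "V = (\<Sum>i<n. kernel_scaled K h (Xs i w - x) * count_error a k (\<Lambda>s i w) (N i w)) / real n"
    \<comment> \<open>On G no sample intensity takes the default value in
      \<open>centred_quantile\<close>.\<close>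
    have A_eq: "A j t = local_average h n j (centred_quantile t) w" if "t \<in> {0..1}" for j t
      unfolding A_def local_average_def using good that
      by (intro arg_cong2[where f="(/)"] sum.cong) (auto simp: centred_quantile_def clamp01_id)
    have A_le: "(LINT t|unit_lborel. (A j t)\<^sup>2) \<le> W0 / \<eta>" if j: "j = 0 \<or> j = 1" for j
    proof -
      have "bounded_fun (A j)" unfolding A_def[abs_def] divide_inverse
        using good by (intro bounded_fun_intros bounded_fun_shape_quantile density_quantile_shape mean_quantile_shape)
          (auto simp: good_intensities_def)
      then have "ennreal (LINT t|unit_lborel. (A j t)\<^sup>2) = (\<integral>\<^sup>+t. ennreal ((A j t)\<^sup>2) \<partial>unit_lborel)"
        by (intro nn_integral_eq_integral[symmetric] bounded_fun_integrable bounded_fun_intros) auto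
      also have "\<dots> = quantile_deviation j w" unfolding quantile_deviation_def
        by (intro nn_integral_cong) (auto simp: A_eq space_restrict_space)
      also have "\<dots> \<le> ennreal (W0 / \<eta>)" by (rule wF[OF j])
      finally show ?thesis using W0 \<eta> by (simp add: ennreal_le_iff)
    qed
    have V_le: "V \<le> V0 / \<eta>"
    proof -
      have nn: "0 \<le> count_weight (Xs i w, \<Lambda>s i w)" for i
        using kernel_scaled_nonneg[OF h(1)] by (simp add: count_weight_def)
      have "ennreal V = ennreal (\<Sum>i<n. \<Sum>j\<le>k. count_weight (Xs i w, \<Lambda>s i w) *
         (real (points_in (N i w) {0..real j * T / real k}) -
          a * (LINT t:{0..real j * T / real k}|lborel. \<Lambda>s i w t))\<^sup>2) / of_nat n"
      proof -
        have "(\<Sum>i<n. kernel_scaled K h (Xs i w - x) * count_error a k (\<Lambda>s i w) (N i w)) =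
          (\<Sum>i<n. \<Sum>j\<le>k. count_weight (Xs i w, \<Lambda>s i w) *
         (real (points_in (N i w) {0..real j * T / real k}) -
          a * (LINT t:{0..real j * T / real k}|lborel. \<Lambda>s i w t))\<^sup>2)"
          using good by (intro sum.cong) (auto simp: count_error_def count_weight_def sum_distrib_left sum_divide_distrib)
        then show ?thesis unfolding V_def using n nn
          by (simp add: ennreal_of_nat_eq_real_of_nat divide_ennreal sum_nonneg)
      qed
      also have "\<dots> = count_deviation w" unfolding count_deviation_def using nn
        by (subst sum_ennreal[symmetric], (intro sum_nonneg mult_nonneg_nonneg; simp))
           (intro arg_cong2[where f="(/)"] sum.cong refl sum_ennreal[symmetric] mult_nonneg_nonneg, auto)
      also have "\<dots> \<le> ennreal (V0 / \<eta>)" by (rule wH)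
      finally show ?thesis using V0 \<eta> by (simp add: ennreal_le_iff)
    qed
    have "(L2_dist mean_quantile (\<lambda>t. (\<Sum>i<n. local_weight K h x n (\<lambda>i. Xs i w) i * empirical_quantile T (N i w) t) / real n))\<^sup>2 \<le>
     3 * R\<^sup>2 * (2 * f0 * (8 * L\<^sup>2 * V + 4 * f0 * L\<^sup>2 * (T / (real k * M))\<^sup>2) +
       (LINT t|unit_lborel. (A 0 t)\<^sup>2) + (LINT t|unit_lborel. (A 1 t)\<^sup>2))"
      unfolding R_def A_def V_def
      by (rule estimator_error[OF mean_quantile_shape n h good \<kappa>_pos Ns a k f0 k2 c(1)])
         (use v0 v1 v1' v2 in \<open>simp_all add: km\<close>)
    also have "\<dots> \<le> 3 * R\<^sup>2 * (2 * f0 * (8 * L\<^sup>2 * (V0 / \<eta>) + 4 * f0 * L\<^sup>2 * (T / (real k * M))\<^sup>2) + W0 / \<eta> + W0 / \<eta>)"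
      using f0 V_le by (intro mult_left_mono add_mono A_le) auto
    also have "\<dots> = 3 * R\<^sup>2 * (2 * f0 * (8 * L\<^sup>2 * (V0 / \<eta>) + 4 * f0 * L\<^sup>2 * (T / (real k * M))\<^sup>2) + 2 * (W0 / \<eta>))"
      by simp
    finally have "8 * (L2_dist mean_quantile (\<lambda>t. (\<Sum>i<n. local_weight K h x n (\<lambda>i. Xs i w) i * empirical_quantile T (N i w) t) / real n))\<^sup>2 \<le>
      24 * R\<^sup>2 * (2 * f0 * (8 * L\<^sup>2 * (V0 / \<eta>) + 4 * f0 * L\<^sup>2 * (T / (real k * M))\<^sup>2) + 2 * (W0 / \<eta>))"
      by linarith
    then show ?thesis
      using estimator_le_weighted_mean[where n=n and Ns="\<lambda>i. N i w" and h=h and x=x and xs="\<lambda>i. Xs i w",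
          OF mean_quantile_shape Ns frechet_mean_mem frechet_mean_quantile]
      by linarith
  qed
  then show ?thesis using E prob_E unfolding V0_def W0_def by blast
qed

end

end

section \<open>Rates\<close>

text \<open>The count term (k + 1)/a wants k at most of order a^(1/2), the mesh term 1/k^2 wants k
  at least of order a^(1/4); both are then of order a^(-1/2), the square of the stated rate. The
  upper end of this range is taken.\<close>

lemma grid_size:
  fixes a :: real
  assumes a: "1 \<le> a"
  defines "k \<equiv> nat \<lceil>sqrt a\<rceil>"
  shows "0 < k" "(real k + 1) / a \<le> 3 * (a powr (- 1 / 4))\<^sup>2" "1 / (real k)\<^sup>2 \<le> (a powr (- 1 / 4))\<^sup>2"
proof -
  have s: "1 \<le> sqrt a" using a by simp
  have k: "sqrt a \<le> real k" "real k \<le> sqrt a + 1" using s unfolding k_def by linarith+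
  have p: "(a powr (- 1 / 4))\<^sup>2 = 1 / sqrt a"
  proof -
    have "(a powr (- 1 / 4))\<^sup>2 = a powr (- (1 / 2))"
      using a by (simp add: powr_power)
    then show ?thesis using a by (simp add: powr_minus powr_half_sqrt field_simps)
  qed
  have aa: "sqrt a * sqrt a = a" using a by simp
  show "0 < k" using k(1) s by linarith
  have "(real k + 1) / a \<le> (3 * sqrt a) / (sqrt a * sqrt a)"
  proof -
    have "real k + 1 \<le> 3 * sqrt a" using k s by linarith
    then show ?thesis unfolding aa using a by (intro divide_right_mono) auto
  qed
  also have "\<dots> = 3 * (1 / sqrt a)" using s by (simp add: field_simps del: real_sqrt_mult_self)
  finally show "(real k + 1) / a \<le> 3 * (a powr (- 1 / 4))\<^sup>2" unfolding p .
  have "(sqrt a)\<^sup>2 \<le> (real k)\<^sup>2" using k s by (intro power_mono) auto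
  moreover have "sqrt a * 1 \<le> (sqrt a)\<^sup>2" unfolding power2_eq_square using s by (intro mult_left_mono) auto
  ultimately have "sqrt a \<le> (real k)\<^sup>2" by simp
  then show "1 / (real k)\<^sup>2 \<le> (a powr (- 1 / 4))\<^sup>2" unfolding p using s \<open>0 < k\<close> by (intro divide_left_mono mult_pos_pos) auto
qed

text \<open>Asymptotic equivalence is used as a sandwich between half and twice c0 n^(-1/5). Since
  (n^(-1/5))^5 = 1/n, the lower bound gives 1/n \<le> (2/c0)^5 h^5, the balance of the variance 1/(n
  h) with the squared bias h^4.\<close>

lemma bandwidth_rate:
  fixes h :: "nat \<Rightarrow> real"
  assumes c0: "0 < c0" and h: "h \<sim>[sequentially] (\<lambda>n. c0 * real n powr (- 1 / 5))"
  shows "eventually (\<lambda>n. 1 / (real n * h n) \<le> (2 / c0) ^ 5 * h n ^ 4 \<and>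
      h n ^ 4 \<le> (2 * c0) ^ 4 * (real n powr (- 2 / 5))\<^sup>2) sequentially"
    and "h \<longlonglongrightarrow> 0"
proof -
  have lim: "(\<lambda>n. real n powr (- 1 / 5)) \<longlonglongrightarrow> 0"
    by (rule tendsto_neg_powr) (auto intro: filterlim_real_sequentially)
  have ratio: "((\<lambda>n. h n / (c0 * real n powr (- 1 / 5))) \<longlongrightarrow> 1) sequentially"
    using h c0 by (intro asymp_equivD_strong) (auto intro: eventually_mono[OF eventually_gt_at_top[of 0]])
  have "eventually (\<lambda>n. 1 / 2 < h n / (c0 * real n powr (- 1 / 5))) sequentially"
    by (rule order_tendstoD(1)[OF ratio]) simp
  moreover have "eventually (\<lambda>n. h n / (c0 * real n powr (- 1 / 5)) < 2) sequentially"
    by (rule order_tendstoD(2)[OF ratio]) simp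
  ultimately have ev: "eventually (\<lambda>n. 0 < n \<and> c0 / 2 * real n powr (- 1 / 5) \<le> h n \<and> h n \<le> 2 * c0 * real n powr (- 1 / 5)) sequentially"
    using eventually_gt_at_top[of 0]
  proof eventually_elim
    case (elim n)
    then have "0 < c0 * real n powr (- 1 / 5)" using c0 by simp
    then show ?case using elim by (simp add: pos_less_divide_eq pos_divide_less_eq)
  qed
  show "eventually (\<lambda>n. 1 / (real n * h n) \<le> (2 / c0) ^ 5 * h n ^ 4 \<and>
      h n ^ 4 \<le> (2 * c0) ^ 4 * (real n powr (- 2 / 5))\<^sup>2) sequentially"
    using ev
  proof eventually_elim
    case (elim n)
    define p where "p = real n powr (- 1 / 5)"
    have n: "0 < real n" and p: "0 < p" using elim by (auto simp: p_def)
    have h0: "0 < h n" using elim c0 p unfolding p_def by (smt (verit) half_gt_zero mult_pos_pos)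
    have p5: "p ^ 5 = 1 / real n" 
    proof -
      have "p ^ 5 = real n powr (real 5 * (- 1 / 5))" unfolding p_def using n by (simp only: powr_power)
      also have "\<dots> = 1 / real n" using n by (simp add: powr_minus_divide)
      finally show ?thesis .
    qed
    have p2: "p\<^sup>2 = real n powr (- 2 / 5)" using n by (simp add: p_def powr_power)
    have p4: "(real n powr (- 2 / 5))\<^sup>2 = p ^ 4" unfolding p2[symmetric] by (simp flip: power_mult)
    have "(c0 / 2 * p) ^ 5 \<le> h n ^ 5" using elim c0 p by (intro power_mono) (auto simp: p_def)
    then have "(c0 / 2) ^ 5 * (1 / real n) \<le> h n ^ 5" by (simp only: power_mult_distrib p5)
    then have "(2 / c0) ^ 5 * ((c0 / 2) ^ 5 * (1 / real n)) \<le> (2 / c0) ^ 5 * h n ^ 5"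
      using c0 by (intro mult_left_mono) auto
    then have "1 / real n \<le> (2 / c0) ^ 5 * h n ^ 5"
      using c0 by (simp add: mult.assoc[symmetric] power_mult_distrib[symmetric])
    then have "1 / real n / h n \<le> (2 / c0) ^ 5 * h n ^ 5 / h n" using h0 by (intro divide_right_mono) auto
    also have "(2 / c0) ^ 5 * h n ^ 5 / h n = (2 / c0) ^ 5 * h n ^ 4" using h0 by (simp add: eval_nat_numeral)
    finally have "1 / (real n * h n) \<le> (2 / c0) ^ 5 * h n ^ 4" by simp
    moreover have "h n ^ 4 \<le> (2 * c0 * p) ^ 4" using elim h0 by (intro power_mono) (auto simp: p_def)
    ultimately show ?case unfolding p4 by (simp add: power_mult_distrib)
  qed
  show "h \<longlonglongrightarrow> 0"
  proof (rule tendsto_sandwich)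
    show "eventually (\<lambda>n. 0 \<le> h n) sequentially"
      using ev by eventually_elim (use c0 in \<open>smt (verit) half_gt_zero mult_nonneg_nonneg powr_ge_zero\<close>)
    show "eventually (\<lambda>n. h n \<le> 2 * c0 * real n powr (- 1 / 5)) sequentially"
      using ev by eventually_elim simp
    show "(\<lambda>n. 2 * c0 * real n powr (- 1 / 5)) \<longlonglongrightarrow> 0" using tendsto_mult_right_zero[OF lim, of "2 * c0"] by simp
  qed simp
qed

theorem theorem1:
  fixes P :: "'w measure"
    and T M L x \<kappa> c0 :: real
    and X :: "'w \<Rightarrow> real" and \<Lambda> :: "'w \<Rightarrow> real \<Rightarrow> real"
    and Xs :: "nat \<Rightarrow> 'w \<Rightarrow> real" and \<Lambda>s :: "nat \<Rightarrow> 'w \<Rightarrow> real \<Rightarrow> real"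
    and N :: "nat \<Rightarrow> nat \<Rightarrow> 'w \<Rightarrow> real multiset"
    and \<alpha> h :: "nat \<Rightarrow> real"
    and K fX :: "real \<Rightarrow> real"
    and g :: "(real \<Rightarrow> real) \<Rightarrow> real \<Rightarrow> real"
    and \<nu> :: "real \<Rightarrow> (real \<Rightarrow> real) measure"
  assumes "prob_space P"
    and "T > 0" "0 < M" "M < L" "shape_quantiles T M L \<noteq> {}"
    and "(\<lambda>w. (X w, \<Lambda> w)) \<in> P \<rightarrow>\<^sub>M borel \<Otimes>\<^sub>M intensity_space T"
    and "prob_space.indep_vars P (\<lambda>_. borel \<Otimes>\<^sub>M intensity_space T) (\<lambda>i w. (Xs i w, \<Lambda>s i w)) UNIV"
    and "\<And>i. distr P (borel \<Otimes>\<^sub>M intensity_space T) (\<lambda>w. (Xs i w, \<Lambda>s i w)) =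
              distr P (borel \<Otimes>\<^sub>M intensity_space T) (\<lambda>w. (X w, \<Lambda> w))"
    and "\<And>n. \<alpha> n > 0"
    and "\<And>n. cond_poisson_processes P T (\<alpha> n) n (\<lambda>i w. (Xs i w, \<Lambda>s i w)) (N n)"
    and "continuous_on UNIV K" "\<And>u. K (- u) = K u" "\<And>u. 0 \<le> K u"
    and "integrable lborel K" "(LINT u|lborel. K u) = 1" "closure {u. K u \<noteq> 0} = {-1..1}"
    and "\<And>n. h n > 0"
    and "\<And>w. w \<in> space P \<Longrightarrow> intensity_shape T (\<Lambda> w) \<in> shape_densities T M L"
    and "\<kappa> > 0" "AE w in P. total_intensity T (\<Lambda> w) \<ge> \<kappa>"
    and "distributed P lborel X (\<lambda>u. ennreal (fX u))"
    and "twice_continuously_differentiable fX" "\<And>u. fX u > 0"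
    and "regular_cond_distr P (shape_borel T M L) (\<lambda>w. intensity_shape T (\<Lambda> w)) borel X
              (\<lambda>y. density lborel (\<lambda>u. ennreal (g y u)))"
    and "\<And>y u. y \<in> shape_densities T M L \<Longrightarrow> 0 \<le> g y u"
    and "\<And>y. y \<in> shape_densities T M L \<Longrightarrow> twice_continuously_differentiable (g y)"
    and "\<exists>B. \<forall>y\<in>shape_densities T M L. \<forall>u. \<bar>deriv (deriv (g y)) u\<bar> \<le> B"
    and "regular_cond_distr P borel X (shape_borel T M L) (\<lambda>w. intensity_shape T (\<Lambda> w)) \<nu>"
    and "\<And>U. shape_open T M L U \<Longrightarrow> continuous_on UNIV (\<lambda>u. measure (\<nu> u) U)"
    and "filterlim (\<lambda>n. \<alpha> n / ln (real n)) at_top sequentially"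
    and "c0 > 0" "h \<sim>[sequentially] (\<lambda>n. c0 * real n powr (- 1 / 5))"
  shows "bigo_in_prob P
           (\<lambda>n w. shape_dist T (frechet_mean T M L (\<nu> x))
                    (density_estimator T M L K (h n) x n (\<lambda>i. Xs i w) (\<lambda>i. N n i w)))
           (\<lambda>n. real n powr (- 2 / 5) + \<alpha> n powr (- 1 / 4))"
proof -
  interpret prob_space P by fact
  obtain B where B: "\<And>y u. y \<in> shape_densities T M L \<Longrightarrow> \<bar>deriv (deriv (g y)) u\<bar> \<le> B"
    using assms(27) by blast
  interpret sampling_model P T M L K X \<Lambda> fX g \<nu> B Xs \<Lambda>s \<kappa> x
  proof (intro sampling_model.intro shape_regression.intro shape_space.intro smoothing_kernel.intro
      shape_regression_axioms.intro sampling_model_axioms.intro)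
    show "continuous_on UNIV fX" by (rule twice_continuously_differentiable_continuous) fact
  qed (use assms B in auto)
  obtain kb where kb: "\<And>v. K v \<le> kb" using K_bounded by blast
  \<comment> \<open>The constant that \<open>bandwidth_rate\<close> supplies for 1/(n h).\<close>
  define c1 where "c1 = (2 / c0) ^ 5"
  define f0 where "f0 = fX x"
  define k2 where "k2 = k_moment 2"
  have f0: "0 < f0" and k2: "0 < k2" by (auto simp: f0_def k2_def fX_pos k_moment_2)
  have kb0: "0 \<le> kb" using kb[of 0] K_nonneg[of 0] by linarith
  have C0: "0 \<le> mse_const kb c1" using kb0 B_nonneg assms(31) by (simp add: mse_const_def c1_def)
  have h0: "h \<longlonglongrightarrow> 0" by (rule bandwidth_rate(2)[OF assms(31,32)])
  have \<alpha>_ge: "eventually (\<lambda>n. 1 \<le> \<alpha> n) sequentially"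
  proof -
    have "eventually (\<lambda>n. 1 \<le> \<alpha> n / ln (real n)) sequentially"
      using assms(30) by (simp add: filterlim_at_top)
    moreover have "eventually (\<lambda>n. 1 \<le> ln (real n)) sequentially"
      using filterlim_compose[OF ln_at_top filterlim_real_sequentially] by (simp add: filterlim_at_top)
    ultimately show ?thesis
    proof eventually_elim
      case (elim n)
      then show ?case by (simp add: le_divide_eq)
    qed
  qed
  show ?thesis
    unfolding bigo_in_prob_def
  proof (intro allI impI)
    fix \<epsilon> :: real assume \<epsilon>: "0 < \<epsilon>"
    \<comment> \<open>Six exceptional events share \<epsilon>.\<close>
    define \<eta> where "\<eta> = \<epsilon> / 6"
    have \<eta>: "0 < \<eta>" using \<epsilon> by (simp add: \<eta>_def)
    define c where "c = sqrt (mse_const kb c1 / \<eta>)"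
    define R where "R = 16 / f0 + 8 * c / (k2 * f0\<^sup>2)"
    \<comment> \<open>a1 collects what multiplies \<alpha>^(-1/2) in the squared error inside the
      factor 2 f0, and a2 what multiplies n^(-4/5).\<close>
    define a1 where "a1 = 8 * L\<^sup>2 * (3 * (1 + B) / \<kappa> / \<eta>) + 4 * f0 * L\<^sup>2 * (T / M)\<^sup>2"
    define a2 where "a2 = 2 * (T\<^sup>2 * mse_const kb c1 / \<eta>) * (2 * c0) ^ 4"
    define D where "D = sqrt (24 * R\<^sup>2 * (2 * f0 * a1 + a2))"
    have a1: "0 \<le> a1" unfolding a1_def using B_nonneg \<kappa>_pos \<eta> f0 by simp
    have a2: "0 \<le> a2" unfolding a2_def using C0 \<eta> assms(31) by simp
    have D: "0 \<le> D" "D\<^sup>2 = 24 * R\<^sup>2 * (2 * f0 * a1 + a2)" using a1 a2 f0 by (auto simp: D_def)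
    have "eventually (\<lambda>n. c * (h n)\<^sup>2 < f0 / 2) sequentially"
      by (rule order_tendstoD(2)[of _ "c * 0\<^sup>2"]) (use f0 in \<open>auto intro!: tendsto_eq_intros h0\<close>)
    moreover have "eventually (\<lambda>n. c * h n < k2 * f0 / 2) sequentially"
      by (rule order_tendstoD(2)[of _ "c * 0"]) (use f0 k2 in \<open>auto intro!: tendsto_eq_intros h0\<close>)
    moreover have "eventually (\<lambda>n. c\<^sup>2 * (h n)\<^sup>2 < k2 * f0\<^sup>2 / 8) sequentially"
      by (rule order_tendstoD(2)[of _ "c\<^sup>2 * 0\<^sup>2"]) (use f0 k2 in \<open>auto intro!: tendsto_eq_intros h0\<close>)
    moreover have "eventually (\<lambda>n. h n < 1) sequentially"
      by (rule order_tendstoD(2)[OF h0]) simp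
    ultimately have "eventually (\<lambda>n. \<exists>E\<in>sets P. measure P E \<ge> 1 - \<epsilon> \<and>
      (\<forall>w\<in>E. \<bar>shape_dist T (frechet_mean T M L (\<nu> x))
                    (density_estimator T M L K (h n) x n (\<lambda>i. Xs i w) (\<lambda>i. N n i w))\<bar> \<le>
         (D + 1) * (real n powr (- 2 / 5) + \<alpha> n powr (- 1 / 4)))) sequentially"
      using \<alpha>_ge bandwidth_rate(1)[OF assms(31,32)] eventually_gt_at_top[of 0]
    proof eventually_elim
      case (elim n)
      define p where "p = real n powr (- 2 / 5)"
      define q where "q = \<alpha> n powr (- 1 / 4)"
      define k where "k = nat \<lceil>sqrt (\<alpha> n)\<rceil>"
      note k = grid_size[OF elim(5), folded k_def q_def]
      have "\<exists>E\<in>sets P. 1 - 6 * \<eta> \<le> prob E \<and> (\<forall>w\<in>E.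
        (shape_dist T (frechet_mean T M L (\<nu> x)) (density_estimator T M L K (h n) x n (\<lambda>i. Xs i w) (\<lambda>i. N n i w)))\<^sup>2 \<le>
        24 * R\<^sup>2 * (2 * f0 * (8 * L\<^sup>2 * ((real k + 1) * (1 + B) / (\<alpha> n * \<kappa>) / \<eta>) + 4 * f0 * L\<^sup>2 * (T / (real k * M))\<^sup>2) +
           2 * (T\<^sup>2 * mse_const kb c1 * h n ^ 4 / \<eta>)))"
        unfolding R_def c_def f0_def k2_def
        by (rule estimator_event[OF assms(17) _ kb _ _ assms(9) k(1) assms(10) \<eta>])
           (use elim in \<open>auto simp: c1_def c_def f0_def k2_def\<close>)
      then obtain E where E: "E \<in> sets P" "1 - \<epsilon> \<le> prob E" and bound: "\<And>w. w \<in> E \<Longrightarrow>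
        (shape_dist T (frechet_mean T M L (\<nu> x)) (density_estimator T M L K (h n) x n (\<lambda>i. Xs i w) (\<lambda>i. N n i w)))\<^sup>2 \<le>
        24 * R\<^sup>2 * (2 * f0 * (8 * L\<^sup>2 * ((real k + 1) * (1 + B) / (\<alpha> n * \<kappa>) / \<eta>) + 4 * f0 * L\<^sup>2 * (T / (real k * M))\<^sup>2) +
           2 * (T\<^sup>2 * mse_const kb c1 * h n ^ 4 / \<eta>))"
        by (auto simp: \<eta>_def)
      have "(real k + 1) * (1 + B) / (\<alpha> n * \<kappa>) / \<eta> = (real k + 1) / \<alpha> n * ((1 + B) / \<kappa> / \<eta>)" by simp
      also have "\<dots> \<le> 3 * q\<^sup>2 * ((1 + B) / \<kappa> / \<eta>)"
        using B_nonneg \<kappa>_pos \<eta> by (intro mult_right_mono k(2)) auto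
      also have "\<dots> = 3 * (1 + B) / \<kappa> / \<eta> * q\<^sup>2" by (simp add: field_simps)
      finally have b1: "(real k + 1) * (1 + B) / (\<alpha> n * \<kappa>) / \<eta> \<le> 3 * (1 + B) / \<kappa> / \<eta> * q\<^sup>2" .
      have "(T / (real k * M))\<^sup>2 = (T / M)\<^sup>2 * (1 / (real k)\<^sup>2)" by (simp add: power_divide power_mult_distrib mult.commute)
      also have "\<dots> \<le> (T / M)\<^sup>2 * q\<^sup>2" by (intro mult_left_mono k(3)) simp
      finally have b2: "(T / (real k * M))\<^sup>2 \<le> (T / M)\<^sup>2 * q\<^sup>2" .
      have b3: "T\<^sup>2 * mse_const kb c1 * h n ^ 4 / \<eta> \<le> T\<^sup>2 * mse_const kb c1 * ((2 * c0) ^ 4 * p\<^sup>2) / \<eta>"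
        using elim C0 \<eta> by (intro divide_right_mono mult_left_mono) (auto simp: p_def)
      have "24 * R\<^sup>2 * (2 * f0 * (8 * L\<^sup>2 * ((real k + 1) * (1 + B) / (\<alpha> n * \<kappa>) / \<eta>) + 4 * f0 * L\<^sup>2 * (T / (real k * M))\<^sup>2) +
           2 * (T\<^sup>2 * mse_const kb c1 * h n ^ 4 / \<eta>)) \<le>
        24 * R\<^sup>2 * (2 * f0 * (8 * L\<^sup>2 * (3 * (1 + B) / \<kappa> / \<eta> * q\<^sup>2) + 4 * f0 * L\<^sup>2 * ((T / M)\<^sup>2 * q\<^sup>2)) +
           2 * (T\<^sup>2 * mse_const kb c1 * ((2 * c0) ^ 4 * p\<^sup>2) / \<eta>))"
        using f0 by (intro mult_left_mono add_mono b1 b2 b3) auto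
      also have "\<dots> = 24 * R\<^sup>2 * (2 * f0 * a1 * q\<^sup>2 + a2 * p\<^sup>2)"
        by (simp add: a1_def a2_def algebra_simps)
      \<comment> \<open>Both squared rates are at most the square of their sum, which allows taking
        roots at the end.\<close>
      also have "\<dots> \<le> 24 * R\<^sup>2 * ((2 * f0 * a1 + a2) * (p + q)\<^sup>2)"
      proof (rule mult_left_mono)
        have "p\<^sup>2 \<le> (p + q)\<^sup>2" "q\<^sup>2 \<le> (p + q)\<^sup>2" by (auto intro!: power_mono simp: p_def q_def)
        then have "2 * f0 * a1 * q\<^sup>2 + a2 * p\<^sup>2 \<le> 2 * f0 * a1 * (p + q)\<^sup>2 + a2 * (p + q)\<^sup>2"
          using a1 a2 f0 by (intro add_mono mult_left_mono) auto
        then show "2 * f0 * a1 * q\<^sup>2 + a2 * p\<^sup>2 \<le> (2 * f0 * a1 + a2) * (p + q)\<^sup>2" by (simp add: distrib_right)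
      qed simp
      also have "\<dots> = (D * (p + q))\<^sup>2" unfolding power_mult_distrib D(2) by simp
      finally have le: "24 * R\<^sup>2 * (2 * f0 * (8 * L\<^sup>2 * ((real k + 1) * (1 + B) / (\<alpha> n * \<kappa>) / \<eta>) + 4 * f0 * L\<^sup>2 * (T / (real k * M))\<^sup>2) +
           2 * (T\<^sup>2 * mse_const kb c1 * h n ^ 4 / \<eta>)) \<le> (D * (p + q))\<^sup>2" .
      have pq: "0 \<le> p + q" by (simp add: p_def q_def)
      have "\<bar>shape_dist T (frechet_mean T M L (\<nu> x))
                    (density_estimator T M L K (h n) x n (\<lambda>i. Xs i w) (\<lambda>i. N n i w))\<bar> \<le> (D + 1) * (p + q)"
        if "w \<in> E" for w
      proof -
        have "\<bar>shape_dist T (frechet_mean T M L (\<nu> x))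
                    (density_estimator T M L K (h n) x n (\<lambda>i. Xs i w) (\<lambda>i. N n i w))\<bar> \<le> \<bar>D * (p + q)\<bar>"
          unfolding abs_le_square_iff using bound[OF that] le by linarith
        also have "\<dots> \<le> (D + 1) * (p + q)" using D(1) pq by (simp add: distrib_right)
        finally show ?thesis .
      qed
      then show ?case using E unfolding p_def q_def by blast
    qed
    then show "\<exists>C>0. \<forall>\<^sub>F n in sequentially. \<exists>E\<in>sets P. measure P E \<ge> 1 - \<epsilon> \<and>
      (\<forall>w\<in>E. \<bar>shape_dist T (frechet_mean T M L (\<nu> x))
                    (density_estimator T M L K (h n) x n (\<lambda>i. Xs i w) (\<lambda>i. N n i w))\<bar> \<le>
         C * (real n powr (- 2 / 5) + \<alpha> n powr (- 1 / 4)))"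
      \<comment> \<open>D + 1 serves as the constant because it has to be positive, while D is only
        known to be nonnegative.\<close>
      using D(1) by (intro exI[of _ "D + 1"]) auto
  qed
qed

end
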